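(* Let $I=[0,1]$ and let $f\colon I\to I$ be a piecewise $C^1$ uniformly expanding transitive Markov map. Suppose there exist $\delta>0$ and $\alpha>1$ such that $f(x)=x^{1/\alpha}$ for all $x\in[0,\delta]$, and suppose that $f$ has no singularities other than the one at $0$. Then the (unique) measure of maximal entropy for $(I,f)$ is adapted with respect to $0$ if and only if $h_{\mathrm{top}}(f)>\log(\alpha)$.
   Context: Piecewise $C^1$ uniformly expanding Markov map: a map $f\colon I\to I$ on a closed bounded interval $I=[a,b]$ for which there exist $\lambda>1$ and a finite set $B=\{a=x_0<x_1<\dots<x_m=b\}$, defining subintervals $I_i=[x_i,x_{i+1}]$ ($0\le i\le m-1$), such that (A) on each $I_i$ there is a continuous monotonic map $\tilde f_i\colon I_i\to I$ with $f=\tilde f_i$ on $\operatorname{int}(I_i)$; (B) for each $x_i$, $f(x_i)=\lim_{x\to x_i^+}f(x)$ or $f(x_i)=\lim_{x\to x_i^-}f(x)$ (only the one-sided limit that makes sense being considered at $a$ and $b$); (C) $f|_{\operatorname{int}(I_i)}$ is $C^1$ with $|(f|_{\operatorname{int}(I_i)})'|\ge\lambda$ for each $i$; (D) for each $i$, $\tilde f_i(I_i)=\bigcup_{j\in V(i)}I_j$ for some $V(i)\subset\{0,\dots,m-1\}$. Transitive: for all $i,j\in\{0,\dots,m-1\}$ there is $n\ge 1$ with $f^{-n}(\operatorname{int}(I_j))\cap I_i\neq\emptyset$. Singularities: $f$ has a singularity $x_i^+$ ($0\le i\le m-1$) if $\limsup_{x\to x_i^+}|f'(x)|=\infty$, and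 a singularity $x_i^-$ ($1\le i\le m$) if $\limsup_{x\to x_i^-}|f'(x)|=\infty$. (By convention $x_0^+=x_0=a$ and $x_m^-=x_m=b$.) Entropy: $h_{\mathrm{top}}(f):=\sup_\mu h_\mu$, the supremum of the measure-theoretic entropies $h_\mu$ of $(I,f,\mu)$ over all $f$-invariant Borel probability measures $\mu$ on $I$. A measure of maximal entropy (MME) is an $f$-invariant Borel probability measure $\mu$ with $h_\mu=h_{\mathrm{top}}(f)$. The hypotheses of the claim imply that there is a unique MME for $(I,f)$. Adaptedness: for a point $p\in I$ put $I_p^+=\{x\in I: x>p\}$. An $f$-invariant Borel probability measure $\mu$ is adapted with respect to $p$ if $\mu(\{p\})=0$ and $\int_{I_p^+}|\log(x-p)|\,d\mu(x)<\infty$. *)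

theory Defs
  imports "HOL-Probability.Probability"
begin

text \<open>
  A self-map of the interval \<open>{a..b}\<close> is represented by a total function on the reals; only its
  values on \<open>{a..b}\<close> matter. A finite set of partition points is represented by its increasing
  enumeration \<open>x 0 < \<dots> < x m\<close>. The branches \<open>f\<^sub>i\<close> (continuous extensions of \<open>f\<close> from the open
  to the closed partition intervals) are the functions \<open>g i\<close>.
\<close>

definition expanding_markov_map ::
  "real \<Rightarrow> real \<Rightarrow> (real \<Rightarrow> real) \<Rightarrow> nat \<Rightarrow> (nat \<Rightarrow> real) \<Rightarrow> bool" where
  "expanding_markov_map a b f m x \<longleftrightarrow>
     f \<in> {a..b} \<rightarrow> {a..b} \<and>
     0 < m \<and> x 0 = a \<and> x m = b \<and> (\<forall>i<m. x i < x (Suc i)) \<and>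
     (\<forall>i<m. \<exists>g V.
        continuous_on {x i..x (Suc i)} g \<and>
        (mono_on {x i..x (Suc i)} g \<or> antimono_on {x i..x (Suc i)} g) \<and>
        g \<in> {x i..x (Suc i)} \<rightarrow> {a..b} \<and>
        (\<forall>t\<in>{x i<..<x (Suc i)}. f t = g t) \<and>
        V \<subseteq> {..<m} \<and>
        g ` {x i..x (Suc i)} = (\<Union>j\<in>V. {x j..x (Suc j)})) \<and>
     (\<forall>i\<le>m. (i < m \<and> (f \<longlongrightarrow> f (x i)) (at_right (x i))) \<or>
             (0 < i \<and> (f \<longlongrightarrow> f (x i)) (at_left (x i)))) \<and>
     (\<exists>c>1. \<forall>i<m. f C1_differentiable_on {x i<..<x (Suc i)} \<and>
                   (\<forall>t\<in>{x i<..<x (Suc i)}. c \<le> \<bar>deriv f t\<bar>))"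

definition transitive_markov :: "(real \<Rightarrow> real) \<Rightarrow> nat \<Rightarrow> (nat \<Rightarrow> real) \<Rightarrow> bool" where
  "transitive_markov f m x \<longleftrightarrow>
     (\<forall>i<m. \<forall>j<m. \<exists>n\<ge>1.
        (f ^^ n) -` {x j<..<x (Suc j)} \<inter> {x i..x (Suc i)} \<noteq> {})"

definition right_singularity :: "(real \<Rightarrow> real) \<Rightarrow> real \<Rightarrow> bool" where
  "right_singularity f p \<longleftrightarrow> Limsup (at_right p) (\<lambda>t. ereal \<bar>deriv f t\<bar>) = \<infinity>"

definition left_singularity :: "(real \<Rightarrow> real) \<Rightarrow> real \<Rightarrow> bool" where
  "left_singularity f p \<longleftrightarrow> Limsup (at_left p) (\<lambda>t. ereal \<bar>deriv f t\<bar>) = \<infinity>"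

definition invariant_prob :: "('a \<Rightarrow> 'a) \<Rightarrow> 'a measure \<Rightarrow> bool" where
  "invariant_prob f M \<longleftrightarrow>
     prob_space M \<and> f \<in> measurable M M \<and>
     (\<forall>A\<in>sets M. emeasure M (f -` A \<inter> space M) = emeasure M A)"

definition invariant_borel_prob :: "real \<Rightarrow> real \<Rightarrow> (real \<Rightarrow> real) \<Rightarrow> real measure \<Rightarrow> bool" where
  "invariant_borel_prob a b f M \<longleftrightarrow>
     sets M = sets (restrict_space borel {a..b}) \<and> invariant_prob f M"

definition measurable_partition :: "'a measure \<Rightarrow> 'a set set \<Rightarrow> bool" where
  "measurable_partition M P \<longleftrightarrow> finite P \<and> P \<subseteq> sets M \<and> partition_on (space M) P"

text \<open>The convention \<open>0 log 0 = 0\<close> is built in, because \<open>ln 0 = 0\<close>.\<close>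

definition partition_entropy :: "'a measure \<Rightarrow> 'a set set \<Rightarrow> real" where
  "partition_entropy M P = - (\<Sum>A\<in>P. measure M A * ln (measure M A))"

definition pullback_partition :: "'a measure \<Rightarrow> ('a \<Rightarrow> 'a) \<Rightarrow> 'a set set \<Rightarrow> 'a set set" where
  "pullback_partition M f P = (\<lambda>A. f -` A \<inter> space M) ` P - {{}}"

text \<open>The join of the partitions \<open>f\<^sup>-\<^sup>k P\<close> for \<open>k < n\<close>; only \<open>n \<ge> 1\<close> is meaningful.\<close>

definition iterated_join :: "'a measure \<Rightarrow> ('a \<Rightarrow> 'a) \<Rightarrow> 'a set set \<Rightarrow> nat \<Rightarrow> 'a set set" where
  "iterated_join M f P n =
     common_refinement ((\<lambda>k. pullback_partition M (f ^^ k) P) ` {..<n})"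

definition entropy_wrt_partition :: "'a measure \<Rightarrow> ('a \<Rightarrow> 'a) \<Rightarrow> 'a set set \<Rightarrow> real" where
  "entropy_wrt_partition M f P =
     lim (\<lambda>n. partition_entropy M (iterated_join M f P n) / real n)"

text \<open>Kolmogorov--Sinai entropy, with natural logarithms.\<close>

definition measure_entropy :: "'a measure \<Rightarrow> ('a \<Rightarrow> 'a) \<Rightarrow> ereal" where
  "measure_entropy M f =
     (SUP P\<in>{P. measurable_partition M P}. ereal (entropy_wrt_partition M f P))"

text \<open>
  Defined through invariant measures, as \<open>f\<close> need not be continuous.
\<close>

definition topological_entropy :: "real \<Rightarrow> real \<Rightarrow> (real \<Rightarrow> real) \<Rightarrow> ereal" where
  "topological_entropy a b f = (SUP M\<in>{M. invariant_borel_prob a b f M}. measure_entropy M f)"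

definition max_entropy_measure :: "real \<Rightarrow> real \<Rightarrow> (real \<Rightarrow> real) \<Rightarrow> real measure \<Rightarrow> bool" where
  "max_entropy_measure a b f M \<longleftrightarrow>
     invariant_borel_prob a b f M \<and> measure_entropy M f = topological_entropy a b f"

definition adapted :: "real measure \<Rightarrow> real \<Rightarrow> bool" where
  "adapted M p \<longleftrightarrow>
     emeasure M {p} = 0 \<and>
     (\<integral>\<^sup>+x\<in>{x \<in> space M. p < x}. ennreal \<bar>ln (x - p)\<bar> \<partial>M) < \<infinity>"

end

theory Submission
  imports Defs "HOL-Real_Asymp.Real_Asymp"
begin

text \<open>
  The partition points form a forward invariant set, and the branch on the \<open>i\<close>-th open partition
  interval covers, up to partition points, a run of consecutive intervals, those with index in
  \<open>{p i..<q i}\<close>. The resulting 0/1 matrix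
  \<open>A\<close> is irreducible by transitivity. Let \<open>\<rho>\<close> be its Perron eigenvalue, with positive left and right
  eigenvectors \<open>u\<close> and \<open>v\<close> (\<open>perron_frobenius\<close>); expansion forces \<open>\<rho> > 1\<close>. The topological
  entropy is \<open>ln \<rho>\<close>, and the only measure of maximal entropy is the Parry measure.

  The Parry measure has a concrete description. There is a continuous distribution function \<open>F\<close>
  whose increments every branch multiplies by \<open>\<rho>\<close>, up to sign, and which gives the \<open>i\<close>-th interval mass \<open>v i\<close>:
  it is the fixed point of a contraction with factor \<open>1 / \<rho>\<close> (\<open>conformal_cdf_exists\<close>). The measure with
  density \<open>u i\<close> on the \<open>i\<close>-th interval with respect to \<open>F\<close> is invariant because \<open>u\<close> is a left
  eigenvector (\<open>invariant_parry\<close>).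

  Points with the same itinerary of length \<open>n\<close> are at distance at most \<open>c\<close> to the power \<open>- n\<close>, so
  the coding by partition elements generates, and the entropy of any invariant measure is the
  entropy rate of the coding (\<open>measure_entropy_symb\<close>). Block entropies are concave in the block
  length, hence the rate is at most each single increment of block entropy. Gibbs' inequality,
  applied with the Markov kernel \<open>A i j * v j / (\<rho> * v i)\<close>, bounds each increment by \<open>ln \<rho>\<close> times the mass
  off the partition points (\<open>block_increment_le\<close>). If the rate equals \<open>ln \<rho>\<close>, then equality holds everywhere:
  the partition points are null, the block probabilities are those of the Markov chain with this
  kernel, and its stationary distribution is \<open>u i * v i\<close>. So at most one measure attains
  \<open>ln \<rho>\<close> (\<open>max_entropy_unique\<close>). The Parry measure attains it, because its cylinders of length \<open>n\<close>
  have mass at most a constant times \<open>\<rho>\<close> to the power \<open>- n\<close> (\<open>measure_entropy_parry\<close>).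

  Near \<open>0\<close> conformality reads \<open>F (t powr (1 / \<alpha>)) = \<rho> * F t\<close>. Hence the points whose logarithms are
  proportional to the powers of \<open>\<alpha>\<close> cut a neighbourhood of \<open>0\<close> into pieces whose masses are proportional to
  the powers of \<open>1 / \<rho>\<close>. The integral of the logarithm is thus comparable with the geometric series of ratio
  \<open>\<alpha> / \<rho>\<close>, which converges if and only if \<open>ln \<alpha> < ln \<rho>\<close> (\<open>adapted_parry_iff\<close>).
\<close>

section \<open>Shannon entropy of functions with finitely many values\<close>

definition atom_prob :: "'a measure \<Rightarrow> ('a \<Rightarrow> 'b) \<Rightarrow> 'b \<Rightarrow> real" where
  "atom_prob M X a = measure M (X -` {a} \<inter> space M)"

text \<open>
  Shannon entropy as the expected information of the atom that contains a point. In this form it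
  depends only on the partition into fibres, entropies of several functions can be combined under
  one integral, and invariance is a change of variables.
\<close>

definition label_entropy :: "'a measure \<Rightarrow> ('a \<Rightarrow> 'b) \<Rightarrow> real" where
  "label_entropy M X = (\<integral>t. - ln (atom_prob M X (X t)) \<partial>M)"

context prob_space
begin

lemma sum_atom_prob:
  assumes X: "simple_function M X" and S: "finite S" "X ` space M \<subseteq> S"
  shows "(\<Sum>a\<in>S. atom_prob M X a) = 1"
proof -
  have "(\<Sum>a\<in>S. atom_prob M X a) = prob (\<Union>a\<in>S. X -` {a} \<inter> space M)"
    unfolding atom_prob_def
    by (rule finite_measure_finite_Union[symmetric])
       (use S simple_functionD(2)[OF X] in \<open>auto simp: disjoint_family_on_def\<close>)
  also have "(\<Union>a\<in>S. X -` {a} \<inter> space M) = space M" using S by auto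
  finally show ?thesis by (simp add: prob_space)
qed

lemma atom_prob_outside: "a \<notin> X ` space M \<Longrightarrow> atom_prob M X a = 0"
proof -
  assume "a \<notin> X ` space M"
  then have "X -` {a} \<inter> space M = {}" by auto
  then show ?thesis by (simp add: atom_prob_def)
qed

lemma integrable_simple:
  assumes X: "simple_function M X"
  shows "integrable M (\<lambda>t. h (X t) :: real)"
proof -
  have "simple_function M (\<lambda>t. h (X t))" using X by (rule simple_function_compose1)
  then have "Bochner_Integration.simple_bochner_integrable M (\<lambda>t. h (X t))"
    by (simp add: Bochner_Integration.simple_bochner_integrable.simps emeasure_eq_measure)
  then show ?thesis by (rule integrableI_simple_bochner_integrable)
qed

lemma expectation_simple:
  assumes X: "simple_function M X" and S: "finite S" "X ` space M \<subseteq> S"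
  shows "expectation (\<lambda>t. h (X t)) = (\<Sum>a\<in>S. atom_prob M X a * h a)"
proof -
  have "expectation (\<lambda>t. h (X t)) = expectation (\<lambda>t. \<Sum>a\<in>S. indicator (X -` {a} \<inter> space M) t * h a)"
  proof (rule Bochner_Integration.integral_cong[OF refl])
    fix t assume w: "t \<in> space M"
    then have "(\<Sum>a\<in>S. indicator (X -` {a} \<inter> space M) t * h a) = (\<Sum>a\<in>S. if a = X t then h a else 0)"
      by (intro sum.cong) (auto simp: indicator_def)
    also have "\<dots> = h (X t)" using S w by auto
    finally show "h (X t) = (\<Sum>a\<in>S. indicator (X -` {a} \<inter> space M) t * h a)" ..
  qed
  also have "\<dots> = (\<Sum>a\<in>S. expectation (\<lambda>t. indicator (X -` {a} \<inter> space M) t * h a))"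
    by (rule Bochner_Integration.integral_sum)
       (use simple_functionD(2)[OF X] in \<open>auto intro!: integrable_real_mult_indicator simp: emeasure_eq_measure\<close>)
  also have "\<dots> = (\<Sum>a\<in>S. atom_prob M X a * h a)"
    using simple_functionD(2)[OF X] by (auto simp: atom_prob_def)
  finally show ?thesis .
qed

lemma label_entropy_sum:
  assumes X: "simple_function M X" and S: "finite S" "X ` space M \<subseteq> S"
  shows "label_entropy M X = - (\<Sum>a\<in>S. atom_prob M X a * ln (atom_prob M X a))"
  unfolding label_entropy_def
  by (subst expectation_simple[OF X S, where h="\<lambda>a. - ln (atom_prob M X a)"]) (simp add: sum_negf)

lemma AE_atom_prob_pos:
  assumes X: "simple_function M X"
  shows "AE t in M. atom_prob M X (X t) > 0"
proof -
  have "AE t in M. \<forall>a\<in>X ` space M. atom_prob M X a = 0 \<longrightarrow> X t \<noteq> a"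
  proof (subst AE_ball_countable, safe)
    show "countable (X ` space M)" using simple_functionD(1)[OF X] by (rule countable_finite)
  next
    fix t0 assume "t0 \<in> space M"
    let ?a = "X t0"
    show "AE t in M. atom_prob M X ?a = 0 \<longrightarrow> X t \<noteq> ?a"
    proof (cases "atom_prob M X ?a = 0")
      case True
      then have "X -` {?a} \<inter> space M \<in> null_sets M"
        using simple_functionD(2)[OF X] by (auto simp: atom_prob_def emeasure_eq_measure null_sets_def)
      then show ?thesis by (rule AE_I') auto
    qed auto
  qed
  with AE_space show ?thesis
  proof eventually_elim
    case (elim t)
    then have "atom_prob M X (X t) \<noteq> 0" by auto
    then show ?case by (simp add: atom_prob_def zero_less_measure_iff)
  qed
qed

lemma atom_prob_nonneg: "0 \<le> atom_prob M X a"
  by (simp add: atom_prob_def)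

text \<open>
  Each summand \<open>q - p - p * ln (q / p)\<close> of the relative entropy is non-negative and vanishes only
  for \<open>q = p\<close>. The weights \<open>q\<close> may have total mass below 1, so kernels that lose mass are allowed.
  The equality case is what makes the measure of maximal entropy unique.
\<close>

lemma gibbs:
  assumes X: "simple_function M X" and S: "finite S" "X ` space M \<subseteq> S"
    and q0: "\<And>a. a \<in> S \<Longrightarrow> 0 \<le> q a" and q1: "sum q S \<le> 1"
    and qp: "AE t in M. q (X t) > 0"
  shows gibbs_le: "label_entropy M X \<le> expectation (\<lambda>t. - ln (q (X t)))"
    and gibbs_eq: "label_entropy M X = expectation (\<lambda>t. - ln (q (X t))) \<Longrightarrow> a \<in> S \<Longrightarrow> q a = atom_prob M X a"
proof -
  let ?p = "atom_prob M X"
  define \<tau> where "\<tau> a = (q a - ?p a) - ?p a * (ln (q a) - ln (?p a))" for a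
  have pos: "q a > 0" if "?p a > 0" for a
  proof (rule ccontr)
    assume "\<not> q a > 0"
    with qp have "AE t in M. X t \<noteq> a" by (auto elim: eventually_mono)
    then have "AE t in M. t \<notin> X -` {a} \<inter> space M" by eventually_elim auto
    then have "X -` {a} \<inter> space M \<in> null_sets M"
      using simple_functionD(2)[OF X] by (subst AE_iff_null_sets) auto
    then have "?p a = 0" by (simp add: atom_prob_def measure_eq_0_null_sets)
    with that show False by simp
  qed
  have t0: "\<tau> a \<ge> 0" and t1: "\<tau> a = 0 \<Longrightarrow> q a = ?p a" if "a \<in> S" for a
  proof -
    have "\<tau> a \<ge> 0 \<and> (\<tau> a = 0 \<longrightarrow> q a = ?p a)"
    proof (cases "?p a = 0")
      case True
      then show ?thesis using q0[OF that] by (auto simp: \<tau>_def)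
    next
      case False
      then have p: "?p a > 0" using atom_prob_nonneg[of X a] by linarith
      have q: "q a > 0" by (rule pos[OF p])
      have e: "\<tau> a = ?p a * (q a / ?p a - 1 - ln (q a / ?p a))"
        using p q by (simp add: \<tau>_def ln_div field_simps)
      have "ln (q a / ?p a) \<le> q a / ?p a - 1" using p q by (intro ln_le_minus_one) auto
      moreover have "q a = ?p a" if "ln (q a / ?p a) = q a / ?p a - 1"
        using ln_eq_minus_one[OF _ that] p q by auto
      ultimately show ?thesis using p unfolding e by auto
    qed
    then show "\<tau> a \<ge> 0" "\<tau> a = 0 \<Longrightarrow> q a = ?p a" by auto
  qed
  have E: "expectation (\<lambda>t. - ln (q (X t))) = - (\<Sum>a\<in>S. ?p a * ln (q a))"
    by (subst expectation_simple[OF X S, where h="\<lambda>a. - ln (q a)"]) (simp add: sum_negf)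
  have sum: "sum \<tau> S = sum q S - 1 + expectation (\<lambda>t. - ln (q (X t))) - label_entropy M X"
    unfolding E label_entropy_sum[OF X S] \<tau>_def
    by (simp add: sum_subtractf right_diff_distrib sum_atom_prob[OF X S])
  have "sum \<tau> S \<ge> 0" by (intro sum_nonneg t0)
  then show "label_entropy M X \<le> expectation (\<lambda>t. - ln (q (X t)))" using sum q1 by linarith
  assume "label_entropy M X = expectation (\<lambda>t. - ln (q (X t)))" and a: "a \<in> S"
  then have "sum \<tau> S \<le> 0" using sum q1 by linarith
  then have "sum \<tau> S = 0" using \<open>sum \<tau> S \<ge> 0\<close> by linarith
  then have "\<tau> a = 0" using sum_nonneg_eq_0_iff[OF S(1), of \<tau>] t0 a by auto
  then show "q a = ?p a" using t1 a by auto
qed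

lemma label_entropy_cong_atoms:
  assumes "\<And>t t'. t \<in> space M \<Longrightarrow> t' \<in> space M \<Longrightarrow> X t = X t' \<longleftrightarrow> Y t = Y t'"
  shows "label_entropy M X = label_entropy M Y"
  unfolding label_entropy_def atom_prob_def
proof (rule Bochner_Integration.integral_cong[OF refl])
  fix t assume "t \<in> space M"
  then have "X -` {X t} \<inter> space M = Y -` {Y t} \<inter> space M" using assms by auto
  then show "- ln (measure M (X -` {X t} \<inter> space M)) = - ln (measure M (Y -` {Y t} \<inter> space M))" by simp
qed

lemma label_entropy_mono:
  assumes X: "simple_function M X" and Y: "simple_function M Y"
    and fin: "\<And>t t'. t \<in> space M \<Longrightarrow> t' \<in> space M \<Longrightarrow> Y t = Y t' \<Longrightarrow> X t = X t'"
  shows "label_entropy M X \<le> label_entropy M Y"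
  unfolding label_entropy_def
proof (rule integral_mono_AE)
  show "integrable M (\<lambda>t. - ln (atom_prob M X (X t)))" by (rule integrable_simple[OF X])
  show "integrable M (\<lambda>t. - ln (atom_prob M Y (Y t)))" by (rule integrable_simple[OF Y])
  show "AE t in M. - ln (atom_prob M X (X t)) \<le> - ln (atom_prob M Y (Y t))"
    using AE_atom_prob_pos[OF Y] AE_space
  proof eventually_elim
    case (elim t)
    have "atom_prob M Y (Y t) \<le> atom_prob M X (X t)"
      unfolding atom_prob_def
    proof (rule finite_measure_mono)
      show "Y -` {Y t} \<inter> space M \<subseteq> X -` {X t} \<inter> space M"
        using fin[OF _ elim(2)] by blast
    qed (rule simple_functionD(2)[OF X])
    with elim show ?case by simp
  qed
qed

lemma atom_prob_marginal:
  assumes X: "simple_function M X" and Y: "simple_function M Y"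
  shows "(\<Sum>a\<in>X ` space M. atom_prob M (\<lambda>t. (X t, Y t)) (a, b)) = atom_prob M Y b"
proof -
  have eq: "(\<lambda>t. (X t, Y t)) -` {(a, b)} = X -` {a} \<inter> Y -` {b}" for a
    by (rule set_eqI) simp
  have "(\<Sum>a\<in>X ` space M. atom_prob M (\<lambda>t. (X t, Y t)) (a, b))
     = (\<Sum>a\<in>X ` space M. prob ((X -` {a} \<inter> space M) \<inter> (Y -` {b} \<inter> space M)))"
    unfolding atom_prob_def eq by (rule sum.cong[OF refl], rule arg_cong[where f=prob]) (rule set_eqI, simp, metis)
  also have "\<dots> = prob (\<Union>a\<in>X ` space M. (X -` {a} \<inter> space M) \<inter> (Y -` {b} \<inter> space M))"
  proof (rule finite_measure_finite_Union[symmetric])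
    show "finite (X ` space M)" by (rule simple_functionD(1)[OF X])
    show "(\<lambda>a. (X -` {a} \<inter> space M) \<inter> (Y -` {b} \<inter> space M)) ` X ` space M \<subseteq> sets M"
      by (intro image_subsetI sets.Int simple_functionD(2)[OF X] simple_functionD(2)[OF Y])
    show "disjoint_family_on (\<lambda>a. (X -` {a} \<inter> space M) \<inter> (Y -` {b} \<inter> space M)) (X ` space M)"
      unfolding disjoint_family_on_def by auto
  qed
  also have "(\<Union>a\<in>X ` space M. (X -` {a} \<inter> space M) \<inter> (Y -` {b} \<inter> space M)) = Y -` {b} \<inter> space M" by fast
  finally show ?thesis by (simp add: atom_prob_def)
qed

text \<open>
  Non-negativity of conditional mutual information: compare the joint law with the one that makes
  \<open>X\<close> and \<open>Y\<close> conditionally independent given \<open>Z\<close>.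
\<close>

lemma label_entropy_submodular:
  assumes X: "simple_function M X" and Y: "simple_function M Y" and Z: "simple_function M Z"
  shows "label_entropy M (\<lambda>t. (X t, Y t, Z t)) + label_entropy M Z
     \<le> label_entropy M (\<lambda>t. (X t, Z t)) + label_entropy M (\<lambda>t. (Y t, Z t))"
proof -
  note XZ = simple_function_Pair[OF X Z] and YZ = simple_function_Pair[OF Y Z]
  note XYZ = simple_function_Pair[OF X YZ]
  let ?xz = "\<lambda>x z. atom_prob M (\<lambda>t. (X t, Z t)) (x, z)"
  let ?yz = "\<lambda>y z. atom_prob M (\<lambda>t. (Y t, Z t)) (y, z)"
  let ?z = "atom_prob M Z"
  let ?S = "X ` space M \<times> Y ` space M \<times> Z ` space M"
  define q where "q = (\<lambda>(x,y,z). ?xz x z * ?yz y z / ?z z)"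
  have S: "finite ?S" "(\<lambda>t. (X t, Y t, Z t)) ` space M \<subseteq> ?S"
    using simple_functionD(1)[OF X] simple_functionD(1)[OF Y] simple_functionD(1)[OF Z] by auto
  have q0: "0 \<le> q a" for a by (auto simp: q_def atom_prob_nonneg split: prod.splits)
  have "sum q ?S = (\<Sum>x\<in>X ` space M. \<Sum>y\<in>Y ` space M. \<Sum>z\<in>Z ` space M. ?xz x z * ?yz y z / ?z z)"
    unfolding q_def by (simp add: sum.cartesian_product)
  also have "\<dots> = (\<Sum>z\<in>Z ` space M. \<Sum>x\<in>X ` space M. \<Sum>y\<in>Y ` space M. ?xz x z * ?yz y z / ?z z)"
    by (subst sum.swap[of _ "Z ` space M"], subst (2) sum.swap, rule refl)
  also have "\<dots> = (\<Sum>z\<in>Z ` space M. (\<Sum>x\<in>X ` space M. ?xz x z) * (\<Sum>y\<in>Y ` space M. ?yz y z) / ?z z)"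
    by (simp add: sum_product sum_divide_distrib)
  also have "\<dots> = (\<Sum>z\<in>Z ` space M. ?z z)"
    by (simp add: atom_prob_marginal[OF X Z] atom_prob_marginal[OF Y Z])
  also have "\<dots> = 1" by (rule sum_atom_prob[OF Z simple_functionD(1)[OF Z]]) auto
  finally have q1: "sum q ?S \<le> 1" by simp
  note pos = AE_atom_prob_pos[OF XZ] AE_atom_prob_pos[OF YZ] AE_atom_prob_pos[OF Z]
  have qp: "AE t in M. q (X t, Y t, Z t) > 0"
    using pos by eventually_elim (auto simp: q_def)
  have "label_entropy M (\<lambda>t. (X t, Y t, Z t)) \<le> expectation (\<lambda>t. - ln (q (X t, Y t, Z t)))"
    by (rule gibbs_le[OF XYZ S q0 q1 qp])
  also have "\<dots> = expectation (\<lambda>t. (- ln (?xz (X t) (Z t)) + - ln (?yz (Y t) (Z t))) - - ln (?z (Z t)))"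
  proof (rule integral_cong_AE)
    show "AE t in M. - ln (q (X t, Y t, Z t)) = (- ln (?xz (X t) (Z t)) + - ln (?yz (Y t) (Z t))) - - ln (?z (Z t))"
      using pos by eventually_elim (auto simp: q_def ln_mult ln_div)
    show "(\<lambda>t. - ln (q (X t, Y t, Z t))) \<in> borel_measurable M"
      by (rule borel_measurable_integrable[OF integrable_simple[OF XYZ, of "\<lambda>a. - ln (q a)"]])
    show "(\<lambda>t. (- ln (?xz (X t) (Z t)) + - ln (?yz (Y t) (Z t))) - - ln (?z (Z t))) \<in> borel_measurable M"
      using integrable_simple[OF XYZ, of "\<lambda>(x,y,z). (- ln (?xz x z) + - ln (?yz y z)) - - ln (?z z)"]
      by (intro borel_measurable_integrable) (simp only: split)
  qed
  also have "\<dots> = label_entropy M (\<lambda>t. (X t, Z t)) + label_entropy M (\<lambda>t. (Y t, Z t)) - label_entropy M Z"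
    unfolding label_entropy_def
    using integrable_simple[OF XZ, of "\<lambda>a. - ln (atom_prob M (\<lambda>t. (X t, Z t)) a)"]
      integrable_simple[OF YZ, of "\<lambda>a. - ln (atom_prob M (\<lambda>t. (Y t, Z t)) a)"]
      integrable_simple[OF Z, of "\<lambda>a. - ln (atom_prob M Z a)"]
    by (simp only: Bochner_Integration.integral_diff Bochner_Integration.integral_add Bochner_Integration.integrable_add)
  finally show ?thesis by simp
qed

text \<open>
  Fano's inequality. If \<open>X\<close> can be guessed from \<open>U\<close> with small error probability, then
  observing \<open>X\<close> after \<open>U\<close> adds little entropy. The comparison kernel puts mass \<open>1 - \<eta>\<close> on the
  guess and spreads \<open>\<eta>\<close> evenly over all values.
\<close>

lemma label_entropy_fano:
  assumes X: "simple_function M X" and U: "simple_function M U"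
    and \<eta>: "0 < \<eta>" "\<eta> < 1" and err: "prob {t\<in>space M. X t \<noteq> \<phi> (U t)} \<le> \<eta>"
    and L: "finite L" "X ` space M \<subseteq> L"
  shows "label_entropy M (\<lambda>t. (X t, U t))
     \<le> label_entropy M U + (- ln (1 - \<eta>) + \<eta> * (ln (card L) - ln \<eta>))"
proof -
  note XU = simple_function_Pair[OF X U]
  obtain t0 where "t0 \<in> space M" using not_empty by auto
  then have "L \<noteq> {}" using L by auto
  then have cL: "real (card L) \<ge> 1" using L(1) by (simp add: Suc_leI card_gt_0_iff)
  let ?S = "L \<times> U ` space M"
  define r where "r = (\<lambda>a u. if a = \<phi> u then 1 - \<eta> else \<eta> / card L)"
  have S: "finite ?S" "(\<lambda>t. (X t, U t)) ` space M \<subseteq> ?S"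
    using simple_functionD(1)[OF U] L by auto
  have rpos: "r a u > 0" for a u using \<eta> cL by (auto simp: r_def)
  have rsum: "(\<Sum>a\<in>L. r a u) \<le> 1" for u
  proof -
    have "(\<Sum>a\<in>L. r a u) \<le> (\<Sum>a\<in>L. (if a = \<phi> u then 1 - \<eta> else 0) + \<eta> / card L)"
      by (intro sum_mono) (use \<eta> cL in \<open>auto simp: r_def\<close>)
    also have "\<dots> = (\<Sum>a\<in>L. (if a = \<phi> u then 1 - \<eta> else 0)) + \<eta>"
      using cL by (simp add: sum.distrib)
    also have "\<dots> \<le> 1" using L(1) \<eta> by simp
    finally show ?thesis .
  qed
  define q where "q = (\<lambda>(a,u). atom_prob M U u * r a u)"
  have q0: "0 \<le> q a" for a using rpos by (auto simp: q_def atom_prob_nonneg less_imp_le split: prod.splits)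
  have "sum q ?S = (\<Sum>u\<in>U ` space M. atom_prob M U u * (\<Sum>a\<in>L. r a u))"
    unfolding q_def by (simp add: sum.cartesian_product[symmetric] sum_distrib_left) (rule sum.swap)
  also have "\<dots> \<le> (\<Sum>u\<in>U ` space M. atom_prob M U u * 1)"
    by (intro sum_mono mult_left_mono rsum atom_prob_nonneg)
  also have "\<dots> = 1" using sum_atom_prob[OF U simple_functionD(1)[OF U]] by simp
  finally have q1: "sum q ?S \<le> 1" .
  note pos = AE_atom_prob_pos[OF U]
  have qp: "AE t in M. q (X t, U t) > 0"
    using pos by eventually_elim (use rpos in \<open>auto simp: q_def\<close>)
  let ?E = "{t\<in>space M. X t \<noteq> \<phi> (U t)}"
  have Em: "?E \<in> sets M"
  proof -
    have "?E = (\<lambda>t. X t \<noteq> \<phi> (U t)) -` {True} \<inter> space M" by auto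
    also have "\<dots> \<in> sets M"
      by (rule simple_functionD(2)[OF simple_function_compose1[OF XU, of "\<lambda>(a,u). a \<noteq> \<phi> u", simplified]])
    finally show ?thesis .
  qed
  let ?K = "ln (card L) - ln \<eta>"
  have K0: "?K \<ge> 0" using cL \<eta> by (smt (verit) ln_ge_zero ln_less_zero)
  have "label_entropy M (\<lambda>t. (X t, U t)) \<le> expectation (\<lambda>t. - ln (q (X t, U t)))"
    by (rule gibbs_le[OF XU S q0 q1 qp])
  also have "\<dots> \<le> expectation (\<lambda>t. - ln (atom_prob M U (U t)) + (- ln (1 - \<eta>) + indicator ?E t * ?K))"
  proof (rule integral_mono_AE)
    show "integrable M (\<lambda>t. - ln (q (X t, U t)))" by (rule integrable_simple[OF XU])
    show "integrable M (\<lambda>t. - ln (atom_prob M U (U t)) + (- ln (1 - \<eta>) + indicator ?E t * ?K))"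
      using Em by (intro Bochner_Integration.integrable_add integrable_simple[OF U] integrable_const integrable_mult_left)
         (auto simp: emeasure_eq_measure)
    have "1 - \<eta> < 1" using \<eta> by simp
    then have l: "- ln (1 - \<eta>) \<ge> 0" using \<eta> by (simp add: ln_le_zero_iff)
    show "AE t in M. - ln (q (X t, U t)) \<le> - ln (atom_prob M U (U t)) + (- ln (1 - \<eta>) + indicator ?E t * ?K)"
      using pos AE_space
    proof eventually_elim
      case (elim t)
      have "ln (q (X t, U t)) = ln (atom_prob M U (U t)) + ln (r (X t) (U t))"
        using elim rpos[of "X t" "U t"] by (simp add: q_def ln_mult)
      moreover have "- ln (r (X t) (U t)) \<le> - ln (1 - \<eta>) + indicator ?E t * ?K"
        using elim \<eta> cL l by (auto simp: r_def indicator_def ln_div)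
      ultimately show ?case by simp
    qed
  qed
  also have "\<dots> = label_entropy M U + (- ln (1 - \<eta>) + prob ?E * ?K)"
  proof -
    have "integrable M (\<lambda>t. - ln (atom_prob M U (U t)))" by (rule integrable_simple[OF U])
    moreover have "integrable M (\<lambda>t. indicator ?E t * ?K)" using Em by (auto simp: emeasure_eq_measure)
    ultimately show ?thesis using Em
      by (subst Bochner_Integration.integral_add, simp, simp, subst Bochner_Integration.integral_add)
         (auto simp: label_entropy_def prob_space)
  qed
  also have "\<dots> \<le> label_entropy M U + (- ln (1 - \<eta>) + \<eta> * ?K)"
    using mult_right_mono[OF err K0] by simp
  finally show ?thesis .
qed

end

section \<open>Entropy rate of a measure-preserving map and generators\<close>

definition itinerary :: "('a \<Rightarrow> 'a) \<Rightarrow> ('a \<Rightarrow> 'b) \<Rightarrow> nat \<Rightarrow> 'a \<Rightarrow> 'b list" where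
  "itinerary T X n t = map (\<lambda>k. X ((T ^^ k) t)) [0..<n]"

lemma itinerary_0: "itinerary T X 0 t = []" by (simp add: itinerary_def)

lemma itinerary_Cons: "itinerary T X (Suc n) t = X t # itinerary T X n (T t)"
  unfolding itinerary_def upt_conv_Cons[OF zero_less_Suc] map_Suc_upt[symmetric]
  by (simp add: funpow_Suc_right del: funpow.simps)

lemma itinerary_snoc: "itinerary T X (Suc n) t = itinerary T X n t @ [X ((T ^^ n) t)]"
  by (simp add: itinerary_def)

lemma itinerary_eq_iff:
  "itinerary T X n t = itinerary T X n t' \<longleftrightarrow> (\<forall>k<n. X ((T ^^ k) t) = X ((T ^^ k) t'))"
  by (auto simp: itinerary_def)

lemma length_itinerary [simp]: "length (itinerary T X n t) = n"
  by (simp add: itinerary_def)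

lemma take_drop_itinerary:
  assumes "k + N \<le> n"
  shows "take N (drop k (itinerary T X n t)) = itinerary T X N ((T ^^ k) t)"
  by (rule nth_equalityI) (use assms in \<open>auto simp: itinerary_def funpow_add add.commute[of k]\<close>)

lemma fano_error_tendsto:
  fixes h c :: real
  shows "((\<lambda>\<eta>. h + (- ln (1 - \<eta>) + \<eta> * (c - ln \<eta>))) \<longlongrightarrow> h) (at_right 0)"
  by real_asymp

text \<open>
  The increments decrease, hence converge, and their Cesaro means have the same limit. This gives
  both the existence of entropy rates and the bound of the rate by every single increment.
\<close>

lemma concave_sequence_slope:
  fixes a :: "nat \<Rightarrow> real"
  assumes conc: "\<And>n. a (Suc (Suc n)) + a n \<le> 2 * a (Suc n)" and mono: "\<And>n. a n \<le> a (Suc n)"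
  shows "\<exists>h. (\<lambda>n. a n / n) \<longlonglongrightarrow> h \<and> (\<forall>n. h \<le> a (Suc n) - a n)"
proof -
  define d where "d n = a (Suc n) - a n" for n
  have dec: "decseq d" unfolding decseq_Suc_iff d_def using conc by (smt (verit))
  have "\<And>n. 0 \<le> d n" using mono by (simp add: d_def)
  then obtain h where h: "d \<longlonglongrightarrow> h" "\<And>n. h \<le> d n" using decseq_convergent[OF dec, of 0] by blast
  have a: "a n = a 0 + (\<Sum>k<n. d k)" for n by (induction n) (auto simp: d_def)
  have "(\<lambda>n. (\<Sum>k<n. d k - h) / n) \<longlonglongrightarrow> 0"
  proof (rule LIMSEQ_I)
    fix e :: real assume e: "e > 0"
    from h(1) e obtain N where N: "\<And>k. k \<ge> N \<Longrightarrow> norm (d k - h) < e / 2"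
      unfolding LIMSEQ_iff by (meson half_gt_zero)
    define C where "C = (\<Sum>k<N. d k - h)"
    obtain N2 :: nat where N2: "2 * C / e < N2" using reals_Archimedean2 by blast
    have "norm ((\<Sum>k<n. d k - h) / n - 0) < e" if n: "n \<ge> Suc (N + N2)" for n
    proof -
      have "(\<Sum>k<n. d k - h) = C + (\<Sum>k=N..<n. d k - h)"
        unfolding C_def using n
        by (subst sum.atLeastLessThan_concat[of 0 N n, symmetric, unfolded atLeast0LessThan]) auto
      also have "(\<Sum>k=N..<n. d k - h) \<le> (\<Sum>k=N..<n. e / 2)"
        proof (rule sum_mono)
          fix k assume "k \<in> {N..<n}"
          then have "norm (d k - h) < e / 2" by (intro N) simp
          then have "\<bar>d k - h\<bar> < e / 2" by (simp only: real_norm_def)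
          then show "d k - h \<le> e / 2" by linarith
        qed
      also have "(\<Sum>k=N..<n. e / 2) \<le> n * (e / 2)" using e n by (simp add: mult_right_mono)
      also have "C < e * n / 2"
      proof -
        have "2 * C / e < n" using N2 n by (smt (verit) of_nat_mono le_add2 Suc_leD of_nat_le_iff)
        then show ?thesis using e by (simp add: field_simps)
      qed
      finally have "(\<Sum>k<n. d k - h) < e * n" by (simp add: field_simps)
      moreover have "(\<Sum>k<n. d k - h) \<ge> 0" by (intro sum_nonneg) (use h(2) in auto)
      ultimately show ?thesis using n by (simp add: field_simps)
    qed
    then show "\<exists>no. \<forall>n\<ge>no. norm ((\<Sum>k<n. d k - h) / n - 0) < e" by blast
  qed
  moreover have "(\<lambda>n. a 0 / real n) \<longlonglongrightarrow> 0" by (rule lim_const_over_n)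
  ultimately have "(\<lambda>n. a 0 / real n + ((\<Sum>k<n. d k - h) / n + h)) \<longlonglongrightarrow> 0 + (0 + h)"
    by (intro tendsto_add tendsto_const)
  moreover have "\<forall>\<^sub>F n in sequentially. a 0 / real n + ((\<Sum>k<n. d k - h) / n + h) = a n / n"
    using eventually_gt_at_top[of 0]
    by eventually_elim (subst (2) a, simp add: sum_subtractf field_simps)
  ultimately have "(\<lambda>n. a n / n) \<longlonglongrightarrow> h" by (simp add: tendsto_cong)
  then show ?thesis using h(2) by (auto simp: d_def)
qed

locale inv_map = prob_space M for M :: "'a measure" +
  fixes T :: "'a \<Rightarrow> 'a"
  assumes T [measurable]: "T \<in> measurable M M"
    and emeasure_T: "\<And>A. A \<in> sets M \<Longrightarrow> emeasure M (T -` A \<inter> space M) = emeasure M A"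
begin

lemma T_pow [measurable]: "T ^^ n \<in> measurable M M"
  by (induction n) auto

lemma T_pow_space: "t \<in> space M \<Longrightarrow> (T ^^ n) t \<in> space M"
  using measurable_space[OF T_pow] .

lemma distr_T_pow: "distr M M (T ^^ n) = M"
proof (induction n)
  case 0
  then show ?case using distr_id[of M] by (simp add: id_def)
next
  case (Suc n)
  have "distr M M T = M" by (rule measure_eqI) (simp_all add: emeasure_distr emeasure_T)
  then have "distr M M (T ^^ Suc n) = distr (distr M M (T ^^ n)) M T"
    unfolding funpow.simps(2) by (subst distr_distr) auto
  then show ?case unfolding Suc.IH \<open>distr M M T = M\<close> .
qed

lemma simple_function_T_pow: "simple_function M X \<Longrightarrow> simple_function M (\<lambda>t. X ((T ^^ n) t))"
  by (rule simple_function_comp[OF T_pow])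

lemma expectation_T_pow:
  assumes "g \<in> borel_measurable M"
  shows "expectation (\<lambda>t. g ((T ^^ n) t) :: real) = expectation g"
  using integral_distr[OF T_pow[of n] assms] by (simp add: distr_T_pow)

lemma prob_T_pow:
  assumes "A \<in> sets M"
  shows "prob ((T ^^ n) -` A \<inter> space M) = prob A"
  using measure_distr[OF T_pow[of n] assms] by (simp add: distr_T_pow)

lemma AE_T_pow:
  assumes "AE t in M. P t"
  shows "AE t in M. P ((T ^^ n) t)"
proof -
  from assms obtain N where N: "{t \<in> space M. \<not> P t} \<subseteq> N" "emeasure M N = 0" "N \<in> sets M"
    by (rule AE_E)
  show ?thesis
  proof (rule AE_I[of _ _ "(T ^^ n) -` N \<inter> space M"])
    show "{t \<in> space M. \<not> P ((T ^^ n) t)} \<subseteq> (T ^^ n) -` N \<inter> space M"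
      using N(1) T_pow_space by auto
    show "emeasure M ((T ^^ n) -` N \<inter> space M) = 0"
      using prob_T_pow[OF N(3), of n] N(2) by (simp add: emeasure_eq_measure)
  qed (use N(3) in measurable)
qed

lemma atom_prob_T_pow:
  assumes X: "simple_function M X"
  shows "atom_prob M (\<lambda>t. X ((T ^^ n) t)) a = atom_prob M X a"
proof -
  have "(\<lambda>t. X ((T ^^ n) t)) -` {a} \<inter> space M = (T ^^ n) -` (X -` {a} \<inter> space M) \<inter> space M"
    using T_pow_space by auto
  then show ?thesis
    unfolding atom_prob_def using prob_T_pow[OF simple_functionD(2)[OF X, of "{a}"], of n] by simp
qed

lemma label_entropy_T_pow:
  assumes X: "simple_function M X"
  shows "label_entropy M (\<lambda>t. X ((T ^^ n) t)) = label_entropy M X"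
  unfolding label_entropy_def atom_prob_T_pow[OF X]
  by (rule expectation_T_pow[of "\<lambda>t. - ln (atom_prob M X (X t))"])
     (rule borel_measurable_integrable[OF integrable_simple[OF X]])

lemma simple_function_itinerary:
  assumes X: "simple_function M X"
  shows "simple_function M (itinerary T X n)"
proof (induction n)
  case 0
  then show ?case by (simp add: itinerary_0[abs_def])
next
  case (Suc n)
  have "simple_function M (\<lambda>t. itinerary T X n t @ [X ((T ^^ n) t)])"
    by (rule simple_function_compose2[OF Suc simple_function_T_pow[OF X], of "\<lambda>w a. w @ [a]"])
  then show ?case by (simp add: itinerary_snoc[abs_def])
qed

abbreviation block_entropy :: "('a \<Rightarrow> 'b) \<Rightarrow> nat \<Rightarrow> real" where
  "block_entropy X n \<equiv> label_entropy M (itinerary T X n)"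

text \<open>
  Submodularity for the first symbol, the last symbol and the block between them.
\<close>

lemma block_entropy_concave:
  assumes X: "simple_function M X"
  shows "block_entropy X (Suc (Suc n)) + block_entropy X n \<le> 2 * block_entropy X (Suc n)"
proof -
  let ?Z = "\<lambda>t. itinerary T X n ((T ^^ 1) t)" and ?Y = "\<lambda>t. X ((T ^^ Suc n) t)"
  note I = simple_function_itinerary[OF X]
  have Z: "simple_function M ?Z" by (rule simple_function_T_pow[OF I])
  have Y: "simple_function M ?Y" by (rule simple_function_T_pow[OF X])
  have 1: "label_entropy M ?Z = block_entropy X n" by (rule label_entropy_T_pow[OF I])
  have 2: "label_entropy M (\<lambda>t. (X t, ?Z t)) = block_entropy X (Suc n)"
    by (rule label_entropy_cong_atoms) (simp add: itinerary_Cons)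
  have 3: "label_entropy M (\<lambda>t. (?Y t, ?Z t)) = block_entropy X (Suc n)"
  proof -
    have "label_entropy M (\<lambda>t. (?Y t, ?Z t)) = label_entropy M (\<lambda>t. itinerary T X (Suc n) ((T ^^ 1) t))"
      by (rule label_entropy_cong_atoms) (auto simp add: itinerary_snoc funpow_swap1)
    also have "\<dots> = block_entropy X (Suc n)" by (rule label_entropy_T_pow[OF I])
    finally show ?thesis .
  qed
  have 4: "label_entropy M (\<lambda>t. (X t, ?Y t, ?Z t)) = block_entropy X (Suc (Suc n))"
    by (rule label_entropy_cong_atoms)
       (auto simp add: itinerary_Cons[of _ _ "Suc n"] itinerary_snoc[of _ _ n] funpow_swap1)
  show ?thesis using label_entropy_submodular[OF X Y Z] unfolding 1 2 3 4 by simp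
qed

lemma block_entropy_mono:
  assumes X: "simple_function M X"
  shows "block_entropy X n \<le> block_entropy X (Suc n)"
  by (rule label_entropy_mono[OF simple_function_itinerary[OF X] simple_function_itinerary[OF X]])
     (simp add: itinerary_snoc)

definition entropy_rate :: "('a \<Rightarrow> 'b) \<Rightarrow> real" where
  "entropy_rate X = lim (\<lambda>n. block_entropy X n / real n)"

lemma
  assumes X: "simple_function M X"
  shows entropy_rate_tendsto: "(\<lambda>n. block_entropy X n / n) \<longlonglongrightarrow> entropy_rate X"
    and entropy_rate_le_increment: "entropy_rate X \<le> block_entropy X (Suc n) - block_entropy X n"
proof -
  obtain h where h: "(\<lambda>n. block_entropy X n / n) \<longlonglongrightarrow> h"
    "\<And>n. h \<le> block_entropy X (Suc n) - block_entropy X n"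
    using concave_sequence_slope[of "block_entropy X"] block_entropy_concave[OF X] block_entropy_mono[OF X]
    by blast
  moreover have "entropy_rate X = h" unfolding entropy_rate_def using h(1) by (rule limI)
  ultimately show "(\<lambda>n. block_entropy X n / n) \<longlonglongrightarrow> entropy_rate X"
    "entropy_rate X \<le> block_entropy X (Suc n) - block_entropy X n" by auto
qed

end

definition fibers :: "'a measure \<Rightarrow> ('a \<Rightarrow> 'b) \<Rightarrow> 'a set set" where
  "fibers M X = (\<lambda>a. X -` {a} \<inter> space M) ` X ` space M"

lemma fibers_iff: "A \<in> fibers M X \<longleftrightarrow> (\<exists>t\<in>space M. A = {t'\<in>space M. X t' = X t})"
  unfolding fibers_def by (auto simp: image_iff vimage_def Int_def conj_commute)

lemma fibers_memD: "A \<in> fibers M X \<Longrightarrow> t \<in> A \<Longrightarrow> A = {t'\<in>space M. X t' = X t}"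
  unfolding fibers_iff by auto

context inv_map
begin

lemma pullback_fibers:
  "pullback_partition M (T ^^ k) (fibers M X) = fibers M (\<lambda>t. X ((T ^^ k) t))" (is "?L = ?R")
proof (intro set_eqI iffI)
  fix A assume "A \<in> ?L"
  then obtain B where "A \<noteq> {}" "B \<in> fibers M X" "A = (T ^^ k) -` B \<inter> space M"
    unfolding pullback_partition_def by blast
  then obtain t0 t where "t \<in> A" and A: "A = (T ^^ k) -` {t'\<in>space M. X t' = X t0} \<inter> space M"
    unfolding fibers_iff by blast
  then have w: "t \<in> space M" "X t0 = X ((T ^^ k) t)" by auto
  show "A \<in> ?R" unfolding fibers_iff
    by (rule bexI[OF _ w(1)]) (auto simp: A w(2) T_pow_space)
next
  fix A assume "A \<in> ?R"
  then obtain t where w: "t \<in> space M" and A: "A = {t'\<in>space M. X ((T ^^ k) t') = X ((T ^^ k) t)}"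
    unfolding fibers_iff by auto
  have "A = (T ^^ k) -` {t'\<in>space M. X t' = X ((T ^^ k) t)} \<inter> space M"
    using T_pow_space by (auto simp: A)
  moreover have "{t'\<in>space M. X t' = X ((T ^^ k) t)} \<in> fibers M X"
    using T_pow_space[OF w] by (auto simp: fibers_iff)
  moreover have "t \<in> A" using w by (simp add: A)
  ultimately show "A \<in> ?L" unfolding pullback_partition_def by blast
qed

text \<open>
  The join of the pullbacks of a partition into fibres is the partition according to itineraries.
  This turns entropies of set partitions into entropies of functions.
\<close>

lemma iterated_join_fibers:
  assumes n: "n \<ge> 1"
  shows "iterated_join M T (fibers M X) n = fibers M (itinerary T X n)" (is "?L = ?R")
proof -
  define \<P> where "\<P> = (\<lambda>k. fibers M (\<lambda>t. X ((T ^^ k) t))) ` {..<n}"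
  have L: "?L = common_refinement \<P>"
    unfolding iterated_join_def \<P>_def pullback_fibers ..
  have atom: "\<Inter> (\<phi> ` \<P>) = {t'\<in>space M. itinerary T X n t' = itinerary T X n t}"
    if \<phi>: "\<And>P. P \<in> \<P> \<Longrightarrow> \<phi> P \<in> P" "\<And>P. P \<in> \<P> \<Longrightarrow> t \<in> \<phi> P" for \<phi> t
  proof -
    have "\<phi> (fibers M (\<lambda>t. X ((T ^^ k) t))) = {t'\<in>space M. X ((T ^^ k) t') = X ((T ^^ k) t)}" if "k < n" for k
    proof -
      have "fibers M (\<lambda>t. X ((T ^^ k) t)) \<in> \<P>" using that by (auto simp: \<P>_def)
      from fibers_memD[OF \<phi>(1)[OF this] \<phi>(2)[OF this]] show ?thesis by simp
    qed
    then have "\<Inter> (\<phi> ` \<P>) = (\<Inter>k<n. {t'\<in>space M. X ((T ^^ k) t') = X ((T ^^ k) t)})"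
      unfolding \<P>_def image_image by simp
    also have "\<dots> = {t'\<in>space M. itinerary T X n t' = itinerary T X n t}"
      unfolding itinerary_eq_iff using n by (auto simp: Suc_le_eq)
    finally show ?thesis .
  qed
  show ?thesis unfolding L
  proof (intro set_eqI iffI)
    fix A assume "A \<in> common_refinement \<P>"
    then obtain \<phi> t where \<phi>: "\<And>P. P \<in> \<P> \<Longrightarrow> \<phi> P \<in> P" and A: "A = \<Inter> (\<phi> ` \<P>)" "t \<in> A"
      unfolding common_refinement by auto
    have A': "A = {t'\<in>space M. itinerary T X n t' = itinerary T X n t}"
      unfolding A(1) by (rule atom[OF \<phi>]) (use A in auto)
    then show "A \<in> ?R" using A(2) unfolding fibers_iff by blast
  next
    fix A assume "A \<in> ?R"
    then obtain t where w: "t \<in> space M" and A: "A = {t'\<in>space M. itinerary T X n t' = itinerary T X n t}"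
      unfolding fibers_iff by auto
    have "\<forall>P\<in>\<P>. \<exists>B\<in>P. t \<in> B"
    proof
      fix P assume "P \<in> \<P>"
      then obtain k where P: "P = fibers M (\<lambda>t. X ((T ^^ k) t))" by (auto simp: \<P>_def)
      show "\<exists>B\<in>P. t \<in> B" unfolding P
        by (rule bexI[of _ "{t'\<in>space M. X ((T ^^ k) t') = X ((T ^^ k) t)}"]) (use w in \<open>auto simp: fibers_iff\<close>)
    qed
    then obtain \<phi> where \<phi>: "\<forall>P\<in>\<P>. \<phi> P \<in> P \<and> t \<in> \<phi> P" by metis
    have "\<Inter> (\<phi> ` \<P>) = A" unfolding A by (rule atom) (use \<phi> in auto)
    moreover have "t \<in> A" using w by (simp add: A)
    ultimately show "A \<in> common_refinement \<P>" unfolding common_refinement using \<phi> by blast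
  qed
qed

lemma partition_entropy_fibers:
  assumes X: "simple_function M X"
  shows "partition_entropy M (fibers M X) = label_entropy M X"
proof -
  have "inj_on (\<lambda>a. X -` {a} \<inter> space M) (X ` space M)" by (rule inj_onI) blast
  then show ?thesis
    unfolding partition_entropy_def fibers_def
    by (subst sum.reindex) (auto simp: label_entropy_sum[OF X simple_functionD(1)[OF X]] atom_prob_def)
qed

lemma entropy_wrt_fibers:
  assumes X: "simple_function M X"
  shows "entropy_wrt_partition M T (fibers M X) = entropy_rate X"
proof -
  have "(\<lambda>n. partition_entropy M (iterated_join M T (fibers M X) n) / real n)
     = (\<lambda>n. block_entropy X n / real n)"
  proof
    fix n
    show "partition_entropy M (iterated_join M T (fibers M X) n) / real n = block_entropy X n / real n"
      by (cases "n = 0")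
         (simp_all add: iterated_join_fibers partition_entropy_fibers[OF simple_function_itinerary[OF X]])
  qed
  then show ?thesis by (simp add: entropy_wrt_partition_def entropy_rate_def)
qed

lemma measurable_partition_fibers:
  assumes X: "simple_function M X"
  shows "measurable_partition M (fibers M X)"
  unfolding measurable_partition_def
proof (intro conjI)
  show "finite (fibers M X)" using simple_functionD(1)[OF X] by (simp add: fibers_def)
  show "fibers M X \<subseteq> sets M" using simple_functionD(2)[OF X] by (auto simp: fibers_def)
  show "partition_on (space M) (fibers M X)"
    by (rule partition_onI) (auto simp: fibers_def disjnt_def)
qed

text \<open>
  Label every point with the atom that contains it.
\<close>

lemma measurable_partition_eq_fibers:
  assumes "measurable_partition M P"
  obtains X :: "'a \<Rightarrow> 'a set" where "simple_function M X" "P = fibers M X"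
proof -
  have P: "finite P" "P \<subseteq> sets M" "\<Union>P = space M" "disjoint P" "{} \<notin> P"
    using assms by (auto simp: measurable_partition_def partition_on_def)
  define X where "X t = (THE A. A \<in> P \<and> t \<in> A)" for t
  have X: "X t = A" if "A \<in> P" "t \<in> A" for A t
    unfolding X_def by (rule the_equality) (use that P(4) in \<open>auto simp: disjoint_def\<close>)
  have XA: "X -` {A} \<inter> space M = A" if A: "A \<in> P" for A
  proof (intro set_eqI iffI)
    fix t assume "t \<in> X -` {A} \<inter> space M"
    then obtain B where "B \<in> P" "t \<in> B" "X t = A" using P(3) by auto
    with X show "t \<in> A" by auto
  next
    fix t assume "t \<in> A"
    then show "t \<in> X -` {A} \<inter> space M" using X[OF A] P(3) A by auto
  qed
  have im: "X ` space M = P"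
  proof (intro set_eqI iffI)
    fix A assume "A \<in> X ` space M"
    then obtain t where "t \<in> \<Union>P" "A = X t" using P(3) by auto
    then obtain B where "B \<in> P" "t \<in> B" "A = X t" by auto
    with X show "A \<in> P" by auto
  next
    fix A assume "A \<in> P"
    moreover with P(5) obtain t where "t \<in> A" by fastforce
    ultimately show "A \<in> X ` space M" using X P(3) by force
  qed
  have "simple_function M X" unfolding simple_function_def im using P XA by auto
  moreover have "P = fibers M X" unfolding fibers_def im using XA by auto
  ultimately show ?thesis by (rule that)
qed

lemma entropy_rate_le_measure_entropy:
  assumes "simple_function M X"
  shows "ereal (entropy_rate X) \<le> measure_entropy M T"
  unfolding measure_entropy_def entropy_wrt_fibers[OF assms, symmetric]
  by (rule SUP_upper) (simp add: measurable_partition_fibers[OF assms])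

lemma measure_entropy_le:
  assumes "\<And>X :: 'a \<Rightarrow> 'a set. simple_function M X \<Longrightarrow> ereal (entropy_rate X) \<le> c"
  shows "measure_entropy M T \<le> c"
  unfolding measure_entropy_def
proof (rule SUP_least)
  fix P assume "P \<in> {P. measurable_partition M P}"
  then obtain X :: "'a \<Rightarrow> 'a set" where X: "simple_function M X" and P: "P = fibers M X"
    using measurable_partition_eq_fibers by blast
  show "ereal (entropy_wrt_partition M T P) \<le> c"
    unfolding P entropy_wrt_fibers[OF X] by (rule assms[OF X])
qed

text \<open>
  Every function with finitely many values agrees, off a set of small measure, with a function of
  a finite itinerary. The values are sets because atoms serve as labels of partitions.
\<close>

definition generating :: "('a \<Rightarrow> 'b) \<Rightarrow> bool" where
  "generating Y \<longleftrightarrow> (\<forall>X :: 'a \<Rightarrow> 'a set. simple_function M X \<longrightarrow>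
     (\<forall>\<eta>>0. \<exists>N \<phi>. prob {t\<in>space M. X t \<noteq> \<phi> (itinerary T Y N t)} \<le> \<eta>))"

text \<open>
  The symbols of the \<open>X\<close>-block are guessed one after the other from a slightly longer
  \<open>Y\<close>-block; each guess costs one error term of Fano's inequality.
\<close>

lemma generator_block_bound:
  assumes X: "simple_function M X" and Y: "simple_function M Y"
    and \<eta>: "0 < \<eta>" "\<eta> < 1" and err: "prob {t\<in>space M. X t \<noteq> \<phi> (itinerary T Y N t)} \<le> \<eta>"
  shows "block_entropy X n \<le> block_entropy Y (n + N)
     + n * (- ln (1 - \<eta>) + \<eta> * (ln (card (X ` space M)) - ln \<eta>))" (is "_ \<le> _ + _ * ?\<kappa>")
proof -
  note IX = simple_function_itinerary[OF X] and IY = simple_function_itinerary[OF Y]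
  let ?Z = "itinerary T Y (n + N)"
  have step: "label_entropy M (\<lambda>t. (itinerary T X k t, ?Z t)) \<le> label_entropy M ?Z + k * ?\<kappa>" if "k \<le> n" for k
    using that
  proof (induction k)
    case 0
    have "label_entropy M (\<lambda>t. (itinerary T X 0 t, ?Z t)) = label_entropy M ?Z"
      by (rule label_entropy_cong_atoms) (simp add: itinerary_0)
    then show ?case by simp
  next
    case (Suc k)
    let ?U = "\<lambda>t. (itinerary T X k t, ?Z t)" and ?X = "\<lambda>t. X ((T ^^ k) t)"
    let ?\<phi> = "\<lambda>(w, z). \<phi> (take N (drop k z))"
    have "{t\<in>space M. ?X t \<noteq> ?\<phi> (?U t)} = (T ^^ k) -` {t\<in>space M. X t \<noteq> \<phi> (itinerary T Y N t)} \<inter> space M"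
      using Suc.prems T_pow_space by (auto simp: take_drop_itinerary)
    moreover have "{t\<in>space M. X t \<noteq> \<phi> (itinerary T Y N t)} \<in> sets M"
    proof -
      have "simple_function M (\<lambda>t. X t \<noteq> \<phi> (itinerary T Y N t))"
        by (rule simple_function_compose2[OF X IY, of "\<lambda>a w. a \<noteq> \<phi> w"])
      from simple_functionD(2)[OF this, of "{True}"] show ?thesis by (simp add: vimage_def Int_def conj_commute)
    qed
    ultimately have err': "prob {t\<in>space M. ?X t \<noteq> ?\<phi> (?U t)} \<le> \<eta>"
      using err prob_T_pow by metis
    have L: "finite (X ` space M)" "?X ` space M \<subseteq> X ` space M"
      using simple_functionD(1)[OF X] T_pow_space by auto
    have "label_entropy M (\<lambda>t. (itinerary T X (Suc k) t, ?Z t)) = label_entropy M (\<lambda>t. (?X t, ?U t))"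
      by (rule label_entropy_cong_atoms) (auto simp: itinerary_snoc)
    also have "\<dots> \<le> label_entropy M ?U + ?\<kappa>"
      by (rule label_entropy_fano[OF simple_function_T_pow[OF X] simple_function_Pair[OF IX IY] \<eta> err' L])
    also have "\<dots> \<le> label_entropy M ?Z + Suc k * ?\<kappa>"
      using Suc.IH Suc.prems by (simp add: algebra_simps)
    finally show ?case .
  qed
  have "block_entropy X n \<le> label_entropy M (\<lambda>t. (itinerary T X n t, ?Z t))"
    by (rule label_entropy_mono[OF IX simple_function_Pair[OF IX IY]]) simp
  also have "\<dots> \<le> label_entropy M ?Z + n * ?\<kappa>" by (rule step) simp
  finally show ?thesis .
qed

lemma entropy_rate_le_generator:
  fixes X :: "'a \<Rightarrow> 'a set"
  assumes X: "simple_function M X" and Y: "simple_function M Y" and gen: "generating Y"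
  shows "entropy_rate X \<le> entropy_rate Y"
proof -
  let ?c = "ln (real (card (X ` space M)))"
  let ?\<kappa> = "\<lambda>\<eta>::real. - ln (1 - \<eta>) + \<eta> * (?c - ln \<eta>)"
  have bound: "entropy_rate X \<le> entropy_rate Y + ?\<kappa> \<eta>" if \<eta>: "0 < \<eta>" "\<eta> < 1" for \<eta>
  proof -
    obtain N \<phi> where err: "prob {t\<in>space M. X t \<noteq> \<phi> (itinerary T Y N t)} \<le> \<eta>"
      using gen X \<eta>(1) unfolding generating_def by blast
    have lim: "(\<lambda>n. block_entropy Y (n + N) / real (n + N) * ((real n + real N) / real n) + ?\<kappa> \<eta>)
       \<longlonglongrightarrow> entropy_rate Y * 1 + ?\<kappa> \<eta>"
    proof (intro tendsto_add tendsto_mult tendsto_const)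
      show "(\<lambda>n. block_entropy Y (n + N) / real (n + N)) \<longlonglongrightarrow> entropy_rate Y"
        using LIMSEQ_ignore_initial_segment[OF entropy_rate_tendsto[OF Y], of N] by simp
      show "(\<lambda>n. (real n + real N) / real n) \<longlonglongrightarrow> 1" by real_asymp
    qed
    have "entropy_rate X \<le> entropy_rate Y * 1 + ?\<kappa> \<eta>"
    proof (rule tendsto_le[OF _ lim entropy_rate_tendsto[OF X]])
      show "\<forall>\<^sub>F n in sequentially. block_entropy X n / real n
          \<le> block_entropy Y (n + N) / real (n + N) * ((real n + real N) / real n) + ?\<kappa> \<eta>"
        using eventually_gt_at_top[of 0]
      proof eventually_elim
        case (elim n)
        have "block_entropy X n / n \<le> (block_entropy Y (n + N) + n * ?\<kappa> \<eta>) / n"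
          by (intro divide_right_mono generator_block_bound[OF X Y \<eta> err]) simp
        also have "\<dots> = block_entropy Y (n + N) / real (n + N) * ((real n + real N) / real n) + ?\<kappa> \<eta>"
        proof -
          have "block_entropy Y (n + N) / real (n + N) * ((real n + real N) / real n) = block_entropy Y (n + N) / n"
            using elim by (simp add: divide_simps)
          then show ?thesis using elim by (simp add: add_divide_distrib)
        qed
        finally show ?case .
      qed
    qed simp
    then show ?thesis by simp
  qed
  have lim: "((\<lambda>\<eta>. entropy_rate Y + ?\<kappa> \<eta>) \<longlongrightarrow> entropy_rate Y) (at_right 0)"
    by (rule fano_error_tendsto)
  show ?thesis
    by (rule tendsto_lowerbound[OF lim])
       (use bound in \<open>auto simp: eventually_at_right[of 0 1] intro!: exI[of _ 1] simp del: minus_add_distrib\<close>)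
qed

lemma measure_entropy_generator:
  assumes Y: "simple_function M Y" and gen: "generating Y"
  shows "measure_entropy M T = ereal (entropy_rate Y)"
  by (intro antisym measure_entropy_le entropy_rate_le_measure_entropy[OF Y])
     (simp add: entropy_rate_le_generator[OF _ Y gen])

end

section \<open>Perron eigenvectors of an irreducible matrix\<close>

text \<open>
  Bolzano--Weierstrass for vectors indexed by \<open>{..<m}\<close>, one coordinate at a time.
\<close>

lemma bounded_coordinates_subseq:
  fixes w :: "nat \<Rightarrow> nat \<Rightarrow> real"
  assumes "\<And>n i. i < m \<Longrightarrow> \<bar>w n i\<bar> \<le> C"
  shows "\<exists>r l. strict_mono r \<and> (\<forall>i<m. (\<lambda>n. w (r n) i) \<longlonglongrightarrow> l i)"
  using assms
proof (induction m)
  case 0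
  then show ?case by (auto intro!: exI[of _ id] strict_mono_id)
next
  case (Suc m)
  then obtain r l where r: "strict_mono (r :: nat \<Rightarrow> nat)" "\<forall>i<m. (\<lambda>n. w (r n) i) \<longlonglongrightarrow> l i"
    by (metis less_SucI)
  have "bounded (range (\<lambda>n. w (r n) m))"
    using Suc.prems by (auto simp: bounded_iff intro!: exI[of _ C])
  then obtain l' r' where r': "strict_mono (r' :: nat \<Rightarrow> nat)" "((\<lambda>n. w (r n) m) \<circ> r') \<longlonglongrightarrow> l'"
    using bounded_imp_convergent_subsequence by blast
  have "(\<lambda>n. w ((r \<circ> r') n) i) \<longlonglongrightarrow> (l(m := l')) i" if "i < Suc m" for i
  proof (cases "i = m")
    case True
    then show ?thesis using r'(2) by (simp add: o_def)
  next
    case False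
    then have "(\<lambda>n. w (r n) i) \<longlonglongrightarrow> l i" using r(2) that by auto
    from LIMSEQ_subseq_LIMSEQ[OF this r'(1)] show ?thesis using False by (simp add: o_def)
  qed
  moreover have "strict_mono (r \<circ> r')" using r(1) r'(1) by (rule strict_mono_o)
  ultimately show ?case by blast
qed

lemma trancl_crossing:
  assumes "(i, j) \<in> E\<^sup>+" "i \<notin> S" "j \<in> S"
  shows "\<exists>k l. (k, l) \<in> E \<and> k \<notin> S \<and> l \<in> S"
  using assms by (induction rule: trancl_induct) blast+

definition irreducible_matrix :: "nat \<Rightarrow> (nat \<Rightarrow> nat \<Rightarrow> real) \<Rightarrow> bool" where
  "irreducible_matrix m a \<longleftrightarrow> (\<forall>i<m. \<forall>j<m. 0 \<le> a i j) \<and>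
     (\<forall>i<m. \<forall>j<m. (i, j) \<in> {(i, j). i < m \<and> j < m \<and> a i j > 0}\<^sup>+)"

text \<open>
  Some edge enters any set of indices that is neither empty nor full; irreducibility is mostly
  used in this form.
\<close>

lemma irreducible_crossing:
  assumes "irreducible_matrix m a" "i < m" "j < m" "i \<notin> S" "j \<in> S"
  obtains k l where "k < m" "l < m" "a k l > 0" "k \<notin> S" "l \<in> S"
proof -
  have "(i, j) \<in> {(i, j). i < m \<and> j < m \<and> a i j > 0}\<^sup>+"
    using assms by (auto simp: irreducible_matrix_def)
  from trancl_crossing[OF this assms(4,5)] show ?thesis using that by auto
qed

lemma irreducible_transpose:
  assumes "irreducible_matrix m a"
  shows "irreducible_matrix m (\<lambda>i j. a j i)"
proof -
  let ?E = "{(i, j). i < m \<and> j < m \<and> a i j > 0}"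
  have "{(i, j). i < m \<and> j < m \<and> a j i > 0} = ?E\<inverse>" by auto
  then show ?thesis using assms by (auto simp: irreducible_matrix_def trancl_converse)
qed

text \<open>
  The Collatz--Wielandt argument. Let \<open>r\<close> be the largest number such that \<open>r * w i\<close> is at most
  the \<open>i\<close>-th coordinate of the image of \<open>w\<close>, for some \<open>w \<ge> 0\<close> other than zero; it is attained by compactness. Among
  the extremal vectors take one with the largest number of strict coordinates. If all were strict,
  \<open>r\<close> could be increased. If some but not all were strict, slightly raising a strict coordinate \<open>s\<close>
  would make every index with an edge to \<open>s\<close> strict as well. So no coordinate is strict,
  which means that the vector is an eigenvector; irreducibility makes it positive.
\<close>

lemma perron_frobenius_right:
  assumes irr: "irreducible_matrix m a" and m: "0 < m"
  shows "\<exists>\<rho> v. \<rho> > 0 \<and> (\<forall>i<m. v i > 0) \<and> (\<forall>i<m. (\<Sum>j<m. a i j * v j) = \<rho> * v i)"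
proof -
  have a0: "0 \<le> a i j" if "i < m" "j < m" for i j using irr that by (auto simp: irreducible_matrix_def)
  define \<Lambda> where "\<Lambda> = {t :: real. \<exists>w. (\<forall>i<m. 0 \<le> w i) \<and> (\<Sum>i<m. w i) = 1 \<and>
    (\<forall>i<m. t * w i \<le> (\<Sum>j<m. a i j * w j))}"
  have w_le: "w i \<le> 1" if "\<forall>i<m. 0 \<le> w i" "(\<Sum>i<m. w i) = (1::real)" "i < m" for w i
    using member_le_sum[of i "{..<m}" w] that by auto
  have \<Lambda>0: "0 \<in> \<Lambda>" unfolding \<Lambda>_def
    using m a0 by (auto intro!: exI[of _ "\<lambda>_. 1 / real m"] sum_nonneg)
  have \<Lambda>_le: "t \<le> (\<Sum>i<m. \<Sum>j<m. a i j)" if "t \<in> \<Lambda>" for t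
  proof -
    obtain w where w: "\<forall>i<m. 0 \<le> w i" "(\<Sum>i<m. w i) = 1" "\<forall>i<m. t * w i \<le> (\<Sum>j<m. a i j * w j)"
      using \<open>t \<in> \<Lambda>\<close> unfolding \<Lambda>_def by blast
    have "t = (\<Sum>i<m. t * w i)" using w(2) by (simp add: sum_distrib_left[symmetric])
    also have "\<dots> \<le> (\<Sum>i<m. \<Sum>j<m. a i j * w j)" using w(3) by (intro sum_mono) auto
    also have "\<dots> \<le> (\<Sum>i<m. \<Sum>j<m. a i j * 1)"
      using w_le[OF w(1,2)] a0 by (intro sum_mono mult_left_mono) auto
    finally show ?thesis by simp
  qed
  then have bdd: "bdd_above \<Lambda>" by (rule bdd_aboveI)
  define r where "r = Sup \<Lambda>"
  have r0: "0 \<le> r" unfolding r_def by (rule cSup_upper[OF \<Lambda>0 bdd])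
  have "\<exists>t. t \<in> \<Lambda> \<and> r - 1 / Suc n < t" for n
    using less_cSup_iff[of \<Lambda> "r - 1 / Suc n"] \<Lambda>0 bdd unfolding r_def by auto
  then obtain t where t: "\<And>n. t n \<in> \<Lambda>" "\<And>n. r - 1 / Suc n < t n" by metis
  have "\<exists>w. (\<forall>i<m. 0 \<le> w i) \<and> (\<Sum>i<m. w i) = 1 \<and> (\<forall>i<m. t n * w i \<le> (\<Sum>j<m. a i j * w j))" for n
    using t(1)[of n] unfolding \<Lambda>_def by auto
  then obtain w where w: "\<And>n. \<forall>i<m. 0 \<le> w n i" "\<And>n. (\<Sum>i<m. w n i) = 1"
    "\<And>n. \<forall>i<m. t n * w n i \<le> (\<Sum>j<m. a i j * w n j)" by metis
  have "\<bar>w n i\<bar> \<le> 1" if "i < m" for n i using w_le[OF w(1,2) that] w(1)[of n] that by auto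
  then obtain s l where s: "strict_mono s" and l: "\<And>i. i < m \<Longrightarrow> (\<lambda>n. w (s n) i) \<longlonglongrightarrow> l i"
    using bounded_coordinates_subseq[of m w 1] by blast
  have "t \<longlonglongrightarrow> r"
  proof (rule tendsto_sandwich[of "\<lambda>n. r - 1 / Suc n" _ _ "\<lambda>_. r"])
    show "\<forall>\<^sub>F n in sequentially. r - 1 / Suc n \<le> t n" by (intro always_eventually allI less_imp_le t(2))
    show "\<forall>\<^sub>F n in sequentially. t n \<le> r" using t(1) cSup_upper[OF _ bdd] by (auto simp: r_def)
    show "(\<lambda>n. r - 1 / real (Suc n)) \<longlonglongrightarrow> r"
      using tendsto_diff[OF tendsto_const LIMSEQ_inverse_real_of_nat, of r] by (simp add: inverse_eq_divide)
  qed auto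
  then have ts: "(\<lambda>n. t (s n)) \<longlonglongrightarrow> r" using LIMSEQ_subseq_LIMSEQ[OF _ s] by (simp add: o_def)
  define good where "good w \<longleftrightarrow> (\<forall>i<m. 0 \<le> w i) \<and> (\<Sum>i<m. w i) > 0 \<and> (\<forall>i<m. r * w i \<le> (\<Sum>j<m. a i j * w j))" for w
  have "good l"
    unfolding good_def
  proof (intro conjI allI impI)
    show "0 \<le> l i" if "i < m" for i by (rule LIMSEQ_le_const[OF l[OF that]]) (use w(1) that in auto)
    have "(\<lambda>n. \<Sum>i<m. w (s n) i) \<longlonglongrightarrow> (\<Sum>i<m. l i)" by (intro tendsto_sum l) auto
    then have "(\<Sum>i<m. l i) = 1" unfolding w(2) by (simp add: LIMSEQ_const_iff)
    then show "(\<Sum>i<m. l i) > 0" by simp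
    show "r * l i \<le> (\<Sum>j<m. a i j * l j)" if "i < m" for i
      by (rule LIMSEQ_le[of "\<lambda>n. t (s n) * w (s n) i" _ "\<lambda>n. \<Sum>j<m. a i j * w (s n) j"])
         (use w(3) that in \<open>auto intro!: tendsto_mult ts l tendsto_sum\<close>)
  qed
  define str where "str w = {i. i < m \<and> r * w i < (\<Sum>j<m. a i j * w j)}" for w
  have "\<exists>w. good w \<and> (\<forall>w'. good w' \<longrightarrow> card (str w') \<le> card (str w))"
  proof (rule ex_has_greatest_nat[of good l "\<lambda>w. card (str w)" "Suc m"])
    show "\<forall>w. good w \<longrightarrow> card (str w) < Suc m"
    proof (intro allI impI)
      fix w
      have "card (str w) \<le> card {..<m}" by (rule card_mono) (auto simp: str_def)
      then show "card (str w) < Suc m" by simp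
    qed
  qed (rule \<open>good l\<close>)
  then obtain v where v: "good v" and vmax: "\<And>w. good w \<Longrightarrow> card (str w) \<le> card (str v)" by blast
  have vnn: "\<And>i. i < m \<Longrightarrow> 0 \<le> v i" and vs: "(\<Sum>i<m. v i) > 0"
    and vle: "\<And>i. i < m \<Longrightarrow> r * v i \<le> (\<Sum>j<m. a i j * v j)" using v by (auto simp: good_def)
  have "str v = {}"
  proof (rule ccontr)
    assume ne: "str v \<noteq> {}"
    show False
    proof (cases "str v = {..<m}")
      case True
      have "\<forall>\<^sub>F e in at_right 0. \<forall>i\<in>{..<m}. (r + e) * v i < (\<Sum>j<m. a i j * v j)"
      proof (intro eventually_ball_finite ballI)
        fix i assume "i \<in> {..<m}"
        then have "r * v i < (\<Sum>j<m. a i j * v j)" using True by (auto simp: str_def)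
        moreover have "((\<lambda>e. (r + e) * v i) \<longlongrightarrow> (r + 0) * v i) (at_right 0)" by (intro tendsto_intros)
        ultimately show "\<forall>\<^sub>F e in at_right 0. (r + e) * v i < (\<Sum>j<m. a i j * v j)"
          by (intro order_tendstoD(2)) auto
      qed auto
      then have "\<forall>\<^sub>F e in at_right 0. e > 0 \<and> (\<forall>i\<in>{..<m}. (r + e) * v i < (\<Sum>j<m. a i j * v j))"
        using eventually_at_right_less by eventually_elim auto
      then obtain e where e: "e > 0" "\<And>i. i < m \<Longrightarrow> (r + e) * v i < (\<Sum>j<m. a i j * v j)"
        using eventually_happens'[OF trivial_limit_at_right_real] by blast
      let ?V = "\<Sum>i<m. v i"
      have "r + e \<in> \<Lambda>"
        unfolding \<Lambda>_def
      proof (intro CollectI exI[of _ "\<lambda>i. v i / ?V"] conjI allI impI)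
        show "0 \<le> v i / ?V" if "i < m" for i using vnn[OF that] vs by simp
        show "(\<Sum>i<m. v i / ?V) = 1" using vs by (simp add: sum_divide_distrib[symmetric])
        show "(r + e) * (v i / ?V) \<le> (\<Sum>j<m. a i j * (v j / ?V))" if "i < m" for i
          using divide_right_mono[OF less_imp_le[OF e(2)[OF that]], of ?V] vs
          by (simp add: sum_divide_distrib)
      qed
      then have "r + e \<le> r" unfolding r_def by (rule cSup_upper[OF _ bdd])
      with e show False by simp
    next
      case False
      then obtain i0 where i0: "i0 < m" "i0 \<notin> str v" by (auto simp: str_def)
      obtain s0 where s0: "s0 < m" "s0 \<in> str v" using ne by (auto simp: str_def)
      from irreducible_crossing[OF irr i0(1) s0(1) i0(2) s0(2)]
      obtain k s where ks: "k < m" "s < m" "a k s > 0" "k \<notin> str v" "s \<in> str v" by blast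
      \<comment> \<open>the vector with the strict coordinate \<open>s\<close> raised by \<open>e\<close>; small \<open>e\<close> keeps strict coordinates strict and makes \<open>k\<close> strict\<close>
      define w where "w e j = v j + (if j = s then e else 0)" for e j
      have sumw: "(\<Sum>j<m. a i j * w e j) = (\<Sum>j<m. a i j * v j) + e * a i s" for i e
      proof -
        have "(\<Sum>j<m. a i j * w e j) = (\<Sum>j<m. a i j * v j) + (\<Sum>j<m. if j = s then e * a i j else 0)"
          unfolding w_def sum.distrib[symmetric] by (intro sum.cong) (auto simp: algebra_simps)
        then show ?thesis using ks(2) by simp
      qed
      have "\<forall>\<^sub>F e in at_right 0. \<forall>i\<in>str v. r * w e i < (\<Sum>j<m. a i j * w e j)"
      proof (intro eventually_ball_finite ballI)
        fix i assume "i \<in> str v"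
        then have pos: "(\<Sum>j<m. a i j * v j) - r * v i > 0" by (auto simp: str_def)
        have lim: "((\<lambda>e. if i = s then e else 0) \<longlongrightarrow> (if i = s then 0 else 0 :: real)) (at_right 0)"
          by (cases "i = s") (simp_all add: tendsto_ident_at)
        have "((\<lambda>e. (\<Sum>j<m. a i j * v j) + e * a i s - r * (v i + (if i = s then e else 0)))
           \<longlongrightarrow> (\<Sum>j<m. a i j * v j) + 0 * a i s - r * (v i + (if i = s then 0 else 0))) (at_right 0)"
          by (intro tendsto_add tendsto_diff tendsto_mult tendsto_const tendsto_ident_at lim)
        then have "\<forall>\<^sub>F e in at_right 0. 0 < (\<Sum>j<m. a i j * v j) + e * a i s - r * (v i + (if i = s then e else 0))"
          using pos by (intro order_tendstoD(1)) auto
        then show "\<forall>\<^sub>F e in at_right 0. r * w e i < (\<Sum>j<m. a i j * w e j)"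
          unfolding sumw by eventually_elim (simp add: w_def)
      qed (auto simp: str_def)
      then have "\<forall>\<^sub>F e in at_right 0. e > 0 \<and> (\<forall>i\<in>str v. r * w e i < (\<Sum>j<m. a i j * w e j))"
        using eventually_at_right_less by eventually_elim auto
      then obtain e where e: "e > 0" "\<And>i. i \<in> str v \<Longrightarrow> r * w e i < (\<Sum>j<m. a i j * w e j)"
        using eventually_happens'[OF trivial_limit_at_right_real] by blast
      have ge: "r * w e i \<le> (\<Sum>j<m. a i j * w e j)" if "i < m" for i
      proof (cases "i \<in> str v")
        case False
        then have "w e i = v i" using ks(5) by (auto simp: w_def)
        then show ?thesis unfolding sumw using vle[OF that] a0[OF that ks(2)] e(1)
          by (smt (verit) mult_nonneg_nonneg)
      qed (use e(2) in \<open>auto intro: less_imp_le\<close>)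
      have "(\<Sum>i<m. v i) \<le> (\<Sum>i<m. w e i)" using e(1) by (intro sum_mono) (auto simp: w_def)
      then have "good (w e)"
        unfolding good_def using vnn e(1) vs ge by (auto simp: w_def)
      moreover have "insert k (str v) \<subseteq> str (w e)"
      proof -
        have "w e k = v k" using ks by (auto simp: w_def)
        moreover have "e * a k s > 0" using e(1) ks(3) by simp
        ultimately have "k \<in> str (w e)"
          unfolding str_def sumw using vle[OF ks(1)] ks(1) by simp
        moreover have "str v \<subseteq> str (w e)" using e(2) by (auto simp: str_def)
        ultimately show ?thesis by simp
      qed
      then have "card (insert k (str v)) \<le> card (str (w e))"
        by (intro card_mono) (auto simp: str_def)
      then have "card (str v) < card (str (w e))" using ks(4) by (simp add: str_def)
      ultimately show False using vmax[of "w e"] by simp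
    qed
  qed
  then have eq: "(\<Sum>j<m. a i j * v j) = r * v i" if "i < m" for i
    using vle[OF that] that by (force simp: str_def)
  obtain i0 where i0: "i0 < m" "v i0 > 0"
    using vs vnn by (metis lessThan_iff less_le not_less sum_nonpos)
  have ge: "a i j * v j \<le> r * v i" if "i < m" "j < m" for i j
    unfolding eq[OF that(1), symmetric] using that a0 vnn
    by (intro member_le_sum[of j "{..<m}" "\<lambda>j. a i j * v j"]) auto
  have pos: "v i > 0" if im: "i < m" for i
  proof (rule ccontr)
    assume n: "\<not> v i > 0"
    obtain k l where "k < m" "l < m" "a k l > 0" "k \<notin> {i. v i > 0}" "l \<in> {i. v i > 0}"
      by (rule irreducible_crossing[OF irr im i0(1), of "{i. v i > 0}"]) (use n i0 in auto)
    moreover from this have "v k = 0" using vnn[of k] by auto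
    ultimately show False using ge[of k l] by (simp add: mult_le_0_iff)
  qed
  have "r > 0"
  proof -
    have "(0, 0) \<in> {(i, j). i < m \<and> j < m \<and> a i j > 0}\<^sup>+" using irr m by (auto simp: irreducible_matrix_def)
    then obtain j where j: "j < m" "a 0 j > 0" by (auto dest: tranclD)
    then have "0 < a 0 j * v j" using pos by simp
    also have "\<dots> \<le> r * v 0" using ge j m by simp
    finally show ?thesis using pos[OF m] by (simp add: zero_less_mult_iff)
  qed
  then show ?thesis using pos eq by blast
qed

text \<open>
  A matrix and its transpose have the same Perron eigenvalue, since the pairing of the left and
  the right eigenvector through the matrix can be evaluated in two ways.
\<close>

lemma perron_frobenius:
  assumes irr: "irreducible_matrix m a" and m: "0 < m"
  shows "\<exists>\<rho> u v. \<rho> > 0 \<and> (\<forall>i<m. u i > 0 \<and> v i > 0) \<and> (\<Sum>i<m. u i * v i) = 1 \<and>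
    (\<forall>i<m. (\<Sum>j<m. a i j * v j) = \<rho> * v i) \<and> (\<forall>j<m. (\<Sum>i<m. u i * a i j) = \<rho> * u j)"
proof -
  obtain \<rho> v where v: "\<rho> > 0" "\<forall>i<m. v i > 0" "\<forall>i<m. (\<Sum>j<m. a i j * v j) = \<rho> * v i"
    using perron_frobenius_right[OF irr m] by blast
  obtain \<sigma> u where u: "\<sigma> > 0" "\<forall>i<m. u i > 0" "\<forall>i<m. (\<Sum>j<m. a j i * u j) = \<sigma> * u i"
    using perron_frobenius_right[OF irreducible_transpose[OF irr] m] by blast
  let ?s = "\<Sum>i<m. u i * v i"
  have s: "?s > 0" using u(2) v(2) m by (intro sum_pos) auto
  have "\<rho> * ?s = (\<Sum>i<m. u i * (\<Sum>j<m. a i j * v j))"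
    unfolding sum_distrib_left[of \<rho>] using v(3) by (intro sum.cong) (auto simp: algebra_simps)
  also have "\<dots> = (\<Sum>j<m. (\<Sum>i<m. a i j * u i) * v j)"
    unfolding sum_distrib_left sum_distrib_right by (subst sum.swap) (simp add: algebra_simps)
  also have "\<dots> = \<sigma> * ?s"
    unfolding sum_distrib_left[of \<sigma>] using u(3) by (intro sum.cong) (auto simp: algebra_simps)
  finally have eq: "\<sigma> = \<rho>" using s by simp
  show ?thesis
  proof (rule exI[of _ \<rho>], rule exI[of _ "\<lambda>i. u i / ?s"], rule exI[of _ v], intro conjI allI impI)
    show "(\<Sum>i<m. u i / ?s * v i) = 1" using s by (simp add: sum_divide_distrib[symmetric])
    show "(\<Sum>i<m. u i / ?s * a i j) = \<rho> * (u j / ?s)" if "j < m" for j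
      using u(3) that unfolding eq by (simp add: sum_divide_distrib[symmetric] mult.commute)
  qed (use s u v in auto)
qed

text \<open>
  Subtract from \<open>u'\<close> the largest multiple of \<open>u\<close> that stays below it. The difference is a
  non-negative eigenvector with a zero coordinate, and irreducibility spreads the zero.
\<close>

lemma left_eigenvector_unique:
  assumes irr: "irreducible_matrix m a" and m: "0 < m"
    and u: "\<And>i. i < m \<Longrightarrow> 0 < u i" "\<And>j. j < m \<Longrightarrow> (\<Sum>i<m. u i * a i j) = \<rho> * u j"
    and u': "\<And>j. j < m \<Longrightarrow> (\<Sum>i<m. u' i * a i j) = \<rho> * u' j"
  shows "\<exists>t. \<forall>i<m. u' i = t * u i"
proof -
  define t where "t = Min ((\<lambda>i. u' i / u i) ` {..<m})"
  have "t \<in> (\<lambda>i. u' i / u i) ` {..<m}" unfolding t_def using m by (intro Min_in) auto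
  then obtain i0 where i0: "i0 < m" "u' i0 = t * u i0" using u(1) by fastforce
  define d where "d i = u' i - t * u i" for i
  have d0: "d i \<ge> 0" if "i < m" for i
  proof -
    have "t \<le> u' i / u i" unfolding t_def using that by (intro Min_le) auto
    then show ?thesis using u(1)[OF that] by (simp add: d_def field_simps)
  qed
  have d: "(\<Sum>i<m. d i * a i j) = \<rho> * d j" if "j < m" for j
    using u(2)[OF that] u'[OF that]
    by (simp add: d_def left_diff_distrib sum_subtractf right_diff_distrib mult.assoc sum_distrib_left[symmetric] mult.left_commute)
  have "d i = 0" if im: "i < m" for i
  proof (rule ccontr)
    assume n: "d i \<noteq> 0"
    obtain k l where kl: "k < m" "l < m" "a k l > 0" "k \<notin> {i. d i = 0}" "l \<in> {i. d i = 0}"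
      by (rule irreducible_crossing[OF irr im i0(1), of "{i. d i = 0}"]) (use n i0 in \<open>auto simp: d_def\<close>)
    then have "0 < d k * a k l" using d0[of k] by (auto simp: zero_less_mult_iff)
    also have "\<dots> \<le> (\<Sum>i<m. d i * a i l)"
      by (rule member_le_sum[of k "{..<m}" "\<lambda>i. d i * a i l"])
         (use kl d0 irr in \<open>auto simp: irreducible_matrix_def\<close>)
    also have "\<dots> = 0" using d kl by simp
    finally show False by simp
  qed
  then show ?thesis by (auto simp: d_def)
qed

section \<open>Branches of an expanding Markov map\<close>

locale interval_partition =
  fixes m :: nat and x :: "nat \<Rightarrow> real"
  assumes m_pos: "0 < m" and x_0: "x 0 = 0" and x_m: "x m = 1"
    and x_less_Suc: "\<And>i. i < m \<Longrightarrow> x i < x (Suc i)"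
begin

lemma x_less: "i < j \<Longrightarrow> j \<le> m \<Longrightarrow> x i < x j"
proof (induction j)
  case (Suc j)
  then show ?case using x_less_Suc[of j] by (cases "i = j") (auto intro: less_trans)
qed simp

lemma x_le: "i \<le> j \<Longrightarrow> j \<le> m \<Longrightarrow> x i \<le> x j"
  using x_less[of i j] by (cases "i = j") auto

lemma x_less_iff: "i \<le> m \<Longrightarrow> j \<le> m \<Longrightarrow> x i < x j \<longleftrightarrow> i < j"
  by (metis x_le x_less not_less)

lemma x_le_iff: "i \<le> m \<Longrightarrow> j \<le> m \<Longrightarrow> x i \<le> x j \<longleftrightarrow> i \<le> j"
  by (metis x_less_iff not_less)

lemma x_eq_iff: "i \<le> m \<Longrightarrow> j \<le> m \<Longrightarrow> x i = x j \<longleftrightarrow> i = j"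
  by (metis x_less_iff linorder_neq_iff)

lemma x_mem: "i \<le> m \<Longrightarrow> x i \<in> {0..1}"
  using x_le[of 0 i] x_le[of i m] by (simp add: x_0 x_m)

lemma interval_exists:
  assumes "t \<in> {0..1}"
  obtains i where "i < m" "x i \<le> t" "t \<le> x (Suc i)"
proof (cases "t = 1")
  case True
  then show ?thesis using that[of "m - 1"] m_pos x_less_Suc[of "m - 1"] by (simp add: x_m)
next
  case False
  define k where "k = (LEAST k. t < x k)"
  have "t < x m" using False assms by (simp add: x_m)
  then have k: "t < x k" "k \<le> m" unfolding k_def by (auto intro: LeastI Least_le)
  have "k \<noteq> 0" using k assms x_0 by (cases k) auto
  then obtain i where i: "k = Suc i" by (cases k) auto
  then have "\<not> t < x i" using not_less_Least[of i "\<lambda>k. t < x k"] by (simp add: k_def)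
  then show ?thesis using that[of i] k i by auto
qed

abbreviation pts :: "real set" where "pts \<equiv> x ` {..m}"

abbreviation opn :: "nat \<Rightarrow> real set" where "opn i \<equiv> {x i<..<x (Suc i)}"

abbreviation cls :: "nat \<Rightarrow> real set" where "cls i \<equiv> {x i..x (Suc i)}"

abbreviation clamp :: "nat \<Rightarrow> nat \<Rightarrow> real \<Rightarrow> real" where
  "clamp k l t \<equiv> max (x k) (min (x l) t)"

lemma opn_exists:
  assumes "t \<in> {0..1}" "t \<notin> pts"
  obtains i where "i < m" "t \<in> opn i"
proof -
  obtain i where "i < m" "x i \<le> t" "t \<le> x (Suc i)" by (rule interval_exists[OF assms(1)])
  moreover from this assms(2) have "t \<noteq> x i" "t \<noteq> x (Suc i)" by auto
  ultimately show ?thesis using that[of i] by auto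
qed

lemma cls_subset: "i < m \<Longrightarrow> cls i \<subseteq> {0..1}"
  using x_mem[of i] x_mem[of "Suc i"] by auto

lemma opn_not_pts: "i < m \<Longrightarrow> t \<in> opn i \<Longrightarrow> t \<notin> pts"
  by (auto simp: x_less_iff)

lemma opn_Icc_index:
  assumes "j < m" "t \<in> opn j" "t \<in> {x k..x l}" "k \<le> m" "l \<le> m"
  shows "k \<le> j" "j < l"
proof -
  have "x k < x (Suc j)" "x j < x l" using assms by auto
  then show "k \<le> j" "j < l" using assms by (auto simp: x_less_iff)
qed

lemma branch_range:
  assumes "t \<in> cls i"
    and "mono_on (cls i) h \<and> h (x i) = x k \<and> h (x (Suc i)) = x l \<or>
      antimono_on (cls i) h \<and> h (x i) = x l \<and> h (x (Suc i)) = x k"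
  shows "h t \<in> {x k..x l}"
  using assms monotone_onD[of "cls i" _ _ h "x i" t] monotone_onD[of "cls i" _ _ h t "x (Suc i)"] by auto

lemma opn_unique: "i < m \<Longrightarrow> j < m \<Longrightarrow> t \<in> opn i \<Longrightarrow> t \<in> opn j \<Longrightarrow> i = j"
  using opn_Icc_index[of j t i "Suc i"] by auto

lemma pts_subset: "pts \<subseteq> {0..1}"
  using x_mem by auto

end

abbreviation branch_matrix :: "(nat \<Rightarrow> nat) \<Rightarrow> (nat \<Rightarrow> nat) \<Rightarrow> nat \<Rightarrow> nat \<Rightarrow> real" where
  "branch_matrix p q \<equiv> \<lambda>i j. if p i \<le> j \<and> j < q i then 1 else 0"

text \<open>
  The function \<open>g i\<close> extends the branch on the \<open>i\<close>-th interval continuously to the end points. Its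
  image is the union of the intervals with index in \<open>{p i..<q i}\<close>.
\<close>

locale expanding_markov = interval_partition m x for m x +
  fixes f :: "real \<Rightarrow> real" and g :: "nat \<Rightarrow> real \<Rightarrow> real" and p q :: "nat \<Rightarrow> nat" and c :: real
  assumes f_maps: "\<And>t. t \<in> {0..1} \<Longrightarrow> f t \<in> {0..1}"
    and f_pts: "\<And>t. t \<in> pts \<Longrightarrow> f t \<in> pts"
    and p_less_q: "\<And>i. i < m \<Longrightarrow> p i < q i" and q_le: "\<And>i. i < m \<Longrightarrow> q i \<le> m"
    and g_cont: "\<And>i. i < m \<Longrightarrow> continuous_on (cls i) (g i)"
    and f_eq_g: "\<And>i t. i < m \<Longrightarrow> t \<in> opn i \<Longrightarrow> f t = g i t"
    and c_gt_1: "c > 1"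
    and g_expand: "\<And>i s t. i < m \<Longrightarrow> s \<in> cls i \<Longrightarrow> t \<in> cls i \<Longrightarrow> c * \<bar>s - t\<bar> \<le> \<bar>g i s - g i t\<bar>"
    and g_branch: "\<And>i. i < m \<Longrightarrow>
       mono_on (cls i) (g i) \<and> g i (x i) = x (p i) \<and> g i (x (Suc i)) = x (q i) \<or>
       antimono_on (cls i) (g i) \<and> g i (x i) = x (q i) \<and> g i (x (Suc i)) = x (p i)"
    and irreducible: "irreducible_matrix m (branch_matrix p q)"

text \<open>
  The image is a closed interval and at the same time a union of partition intervals; hence its ends
  are the left end of the first and the right end of the last of them.
\<close>

lemma (in interval_partition) branch_endpoints:
  assumes i: "i < m" and V: "V \<subseteq> {..<m}" and cont: "continuous_on (cls i) g"
    and mono: "mono_on (cls i) g \<or> antimono_on (cls i) g"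
    and im: "g ` cls i = (\<Union>j\<in>V. cls j)"
  shows "\<exists>p q. p < q \<and> q \<le> m \<and> (mono_on (cls i) g \<and> g (x i) = x p \<and> g (x (Suc i)) = x q \<or>
     antimono_on (cls i) g \<and> g (x i) = x q \<and> g (x (Suc i)) = x p)"
proof -
  have le: "x i \<le> x (Suc i)" using x_less_Suc[OF i] by simp
  obtain a b where ab: "g ` cls i = {a..b}" "a \<le> b"
    using continuous_image_closed_interval[OF le cont] by blast
  have "V \<noteq> {}" using im le by auto
  have fin: "finite V" using V finite_subset by blast
  define p q where "p = Min V" and "q = Suc (Max V)"
  have pV: "p \<in> V" "\<And>j. j \<in> V \<Longrightarrow> p \<le> j" using fin \<open>V \<noteq> {}\<close> by (auto simp: p_def)
  have qV: "Max V \<in> V" "\<And>j. j \<in> V \<Longrightarrow> Suc j \<le> q" using fin \<open>V \<noteq> {}\<close> by (auto simp: q_def)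
  have V_m: "\<And>j. j \<in> V \<Longrightarrow> j < m" using V by auto
  have q_m: "q \<le> m" using V_m[OF qV(1)] by (simp add: q_def)
  have pq: "p < q" using qV(2)[OF pV(1)] by simp
  have a: "a = x p"
  proof (rule antisym)
    have "x p \<in> cls p" using x_less_Suc[OF V_m[OF pV(1)]] by simp
    then have "x p \<in> {a..b}" unfolding ab(1)[symmetric] im using pV(1) by blast
    then show "a \<le> x p" by simp
    have "a \<in> (\<Union>j\<in>V. cls j)" unfolding im[symmetric] ab(1) using ab(2) by simp
    then obtain j where "j \<in> V" "x j \<le> a" by auto
    then show "x p \<le> a" using x_le[OF pV(2), of j] V_m[of j] by simp
  qed
  have b: "b = x q"
  proof (rule antisym)
    have "x q \<in> cls (Max V)" using x_less_Suc[OF V_m[OF qV(1)]] by (simp add: q_def)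
    then have "x q \<in> {a..b}" unfolding ab(1)[symmetric] im using qV(1) by blast
    then show "x q \<le> b" by simp
    have "b \<in> (\<Union>j\<in>V. cls j)" unfolding im[symmetric] ab(1) using ab(2) by simp
    then obtain j where "j \<in> V" "b \<le> x (Suc j)" by auto
    then show "b \<le> x q" using x_le[OF qV(2), of j] q_m by simp
  qed
  have ends: "x i \<in> cls i" "x (Suc i) \<in> cls i" using le by auto
  then have e1: "g (x i) \<in> {a..b}" "g (x (Suc i)) \<in> {a..b}" using ab(1) by blast+
  obtain s where s: "s \<in> cls i" "g s = a" using ab by (metis atLeastAtMost_iff imageE order_refl)
  obtain t where t: "t \<in> cls i" "g t = b" using ab by (metis atLeastAtMost_iff imageE order_refl)
  from mono show ?thesis
  proof
    assume mo: "mono_on (cls i) g"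
    have "g (x i) \<le> a" "b \<le> g (x (Suc i))"
      using mono_onD[OF mo ends(1) s(1)] mono_onD[OF mo t(1) ends(2)] s t by auto
    then show ?thesis using e1 a b mo pq q_m by (intro exI[of _ p] exI[of _ q]) auto
  next
    assume mo: "antimono_on (cls i) g"
    have "g (x (Suc i)) \<le> a" "b \<le> g (x i)"
      using monotone_onD[OF mo s(1) ends(2)] monotone_onD[OF mo ends(1) t(1)] s t by auto
    then show ?thesis using e1 a b mo pq q_m by (intro exI[of _ p] exI[of _ q]) auto
  qed
qed

text \<open>
  The mean value theorem provides an interior point, where \<open>f\<close> and \<open>g\<close> have the same derivative.
\<close>

lemma expansion_of_derivative_bound:
  fixes f g :: "real \<Rightarrow> real"
  assumes cont: "continuous_on {a..b} g" and eq: "\<And>t. t \<in> {a<..<b} \<Longrightarrow> f t = g t"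
    and C1: "f C1_differentiable_on {a<..<b}" and c: "\<And>t. t \<in> {a<..<b} \<Longrightarrow> c \<le> \<bar>deriv f t\<bar>"
    and st: "s \<in> {a..b}" "t \<in> {a..b}"
  shows "c * \<bar>s - t\<bar> \<le> \<bar>g s - g t\<bar>"
proof -
  have *: "c * \<bar>s - t\<bar> \<le> \<bar>g s - g t\<bar>" if st: "s \<in> {a..b}" "t \<in> {a..b}" "s < t" for s t
  proof -
    have D: "DERIV g z :> deriv f z" if "z \<in> {a<..<b}" for z
    proof -
      have "f differentiable (at z)" using C1 that by (auto simp: C1_differentiable_on_eq)
      then obtain D where D: "DERIV f z :> D" by (auto simp: real_differentiable_def)
      then have "DERIV g z :> D"
        by (rule has_field_derivative_transform_within_open[where S="{a<..<b}"]) (use that eq in auto)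
      with D show ?thesis by (simp add: DERIV_imp_deriv)
    qed
    have "\<exists>l z. s < z \<and> z < t \<and> DERIV g z :> l \<and> g t - g s = (t - s) * l"
    proof (rule MVT[OF st(3)])
      show "continuous_on {s..t} g" by (rule continuous_on_subset[OF cont]) (use st in auto)
      show "g differentiable (at z)" if "s < z" "z < t" for z
        using D[of z] st that by (auto simp: real_differentiable_def)
    qed
    then obtain l z where z: "s < z" "z < t" "DERIV g z :> l" "g t - g s = (t - s) * l" by blast
    have "z \<in> {a<..<b}" using st z by auto
    then have "c \<le> \<bar>l\<bar>" using c D z(3) DERIV_unique by metis
    moreover have "\<bar>g s - g t\<bar> = (t - s) * \<bar>l\<bar>"
      using z(4) st(3) by (metis abs_minus_commute abs_mult abs_of_pos diff_gt_0_iff_gt)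
    ultimately show ?thesis using st(3) by (simp add: mult.commute mult_left_mono)
  qed
  show ?thesis
  proof (cases s t rule: linorder_cases)
    case greater
    then show ?thesis using *[of t s] st by (simp add: abs_minus_commute)
  qed (use * st in auto)
qed

text \<open>
  Each partition point is mapped to a one-sided limit of a branch, which is a partition point
  again. So partition points never leave their set, an orbit that ends in an open interval has visited
  only open intervals before, and its path shows that transitivity gives irreducibility.
\<close>

lemma expanding_markov_of_map:
  assumes emm: "expanding_markov_map 0 1 f m x" and tr: "transitive_markov f m x"
  shows "\<exists>g p q c. expanding_markov m x f g p q c"
proof -
  have part: "interval_partition m x"
    using emm by (auto simp: expanding_markov_map_def interval_partition_def)
  interpret interval_partition m x by (rule part)
  have f_maps: "\<And>t. t \<in> {0..1} \<Longrightarrow> f t \<in> {0..1}" using emm by (auto simp: expanding_markov_map_def)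
  from emm have "\<exists>c>1. \<forall>i<m. f C1_differentiable_on opn i \<and> (\<forall>t\<in>opn i. c \<le> \<bar>deriv f t\<bar>)"
    unfolding expanding_markov_map_def by (elim conjE) assumption
  then obtain c where c: "c > 1" "\<And>i. i < m \<Longrightarrow> f C1_differentiable_on opn i"
    "\<And>i t. i < m \<Longrightarrow> t \<in> opn i \<Longrightarrow> c \<le> \<bar>deriv f t\<bar>"
    by meson
  define R where "R i g p q \<longleftrightarrow> continuous_on (cls i) g \<and> (\<forall>t\<in>opn i. f t = g t) \<and> p < q \<and> q \<le> m \<and>
     (mono_on (cls i) g \<and> g (x i) = x p \<and> g (x (Suc i)) = x q \<or>
      antimono_on (cls i) g \<and> g (x i) = x q \<and> g (x (Suc i)) = x p)" for i g p q
  have "\<exists>g p q. R i g p q" if i: "i < m" for i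
  proof -
    from emm have "\<forall>i<m. \<exists>g V. continuous_on (cls i) g \<and> (mono_on (cls i) g \<or> antimono_on (cls i) g) \<and>
        g \<in> cls i \<rightarrow> {0..1} \<and> (\<forall>t\<in>opn i. f t = g t) \<and> V \<subseteq> {..<m} \<and> g ` cls i = (\<Union>j\<in>V. cls j)"
      unfolding expanding_markov_map_def by (elim conjE) assumption
    with i obtain g V where gV: "continuous_on (cls i) g" "mono_on (cls i) g \<or> antimono_on (cls i) g"
        "\<forall>t\<in>opn i. f t = g t" "V \<subseteq> {..<m}" "g ` cls i = (\<Union>j\<in>V. cls j)"
      by meson
    from branch_endpoints[OF i gV(4,1,2,5)] obtain p q where "p < q \<and> q \<le> m \<and>
      (mono_on (cls i) g \<and> g (x i) = x p \<and> g (x (Suc i)) = x q \<or>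
       antimono_on (cls i) g \<and> g (x i) = x q \<and> g (x (Suc i)) = x p)" by (elim exE)
    then have "R i g p q" unfolding R_def using gV(1,3) by (intro conjI) simp_all
    then show ?thesis by (intro exI)
  qed
  then obtain g p q where "\<And>i. i < m \<Longrightarrow> R i (g i) (p i) (q i)" by metis
  note gpq = this[unfolded R_def]
  have g_ends: "g i (x i) \<in> pts" "g i (x (Suc i)) \<in> pts" if "i < m" for i
    using gpq[OF that] by (auto intro: less_imp_le less_le_trans)
  have f_pts: "f (x i) \<in> pts" if i: "i \<le> m" for i
  proof -
    consider "i < m" "(f \<longlongrightarrow> f (x i)) (at_right (x i))" | "0 < i" "(f \<longlongrightarrow> f (x i)) (at_left (x i))"
    proof -
      from emm have "\<forall>i\<le>m. (i < m \<and> (f \<longlongrightarrow> f (x i)) (at_right (x i))) \<or> (0 < i \<and> (f \<longlongrightarrow> f (x i)) (at_left (x i)))"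
        unfolding expanding_markov_map_def by (elim conjE) assumption
      with i that show thesis by meson
    qed
    then show ?thesis
    proof cases
      case 1
      then have l: "x i < x (Suc i)" by (intro x_less_Suc)
      have "(g i \<longlongrightarrow> g i (x i)) (at (x i) within cls i)"
        using gpq[OF 1(1)] l by (auto simp: continuous_on)
      then have "(g i \<longlongrightarrow> g i (x i)) (at_right (x i))" using l by (simp add: at_within_Icc_at_right)
      moreover have "\<forall>\<^sub>F t in at_right (x i). g i t = f t"
        using eventually_at_right_real[OF l] by eventually_elim (use gpq[OF 1(1)] in auto)
      ultimately have "(f \<longlongrightarrow> g i (x i)) (at_right (x i))" by (rule Lim_transform_eventually)
      with 1(2) have "f (x i) = g i (x i)" by (intro tendsto_unique[OF trivial_limit_at_right_real])
      then show ?thesis using g_ends[OF 1(1)] by simp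
    next
      case 2
      then obtain k where k: "i = Suc k" "k < m" using i by (cases i) auto
      then have l: "x k < x i" by (simp add: x_less_Suc)
      have "(g k \<longlongrightarrow> g k (x i)) (at (x i) within {x k..x i})"
        using gpq[OF k(2)] l by (auto simp: continuous_on k)
      then have "(g k \<longlongrightarrow> g k (x i)) (at_left (x i))" using l by (simp add: at_within_Icc_at_left)
      moreover have "\<forall>\<^sub>F t in at_left (x i). g k t = f t"
        using eventually_at_left_real[OF l] by eventually_elim (use gpq[OF k(2)] in \<open>auto simp: k\<close>)
      ultimately have "(f \<longlongrightarrow> g k (x i)) (at_left (x i))" by (rule Lim_transform_eventually)
      with 2(2) have "f (x i) = g k (x i)" by (intro tendsto_unique[OF trivial_limit_at_left_real])
      then show ?thesis using g_ends[OF k(2)] k by simp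
    qed
  qed
  define a where "a i j = branch_matrix p q i j" for i j
  let ?E = "{(i, j). i < m \<and> j < m \<and> a i j > 0}"
  have expand: "c * \<bar>s - t\<bar> \<le> \<bar>g i s - g i t\<bar>" if "i < m" "s \<in> cls i" "t \<in> cls i" for i s t
    by (rule expansion_of_derivative_bound[of _ _ _ f]) (use gpq[OF that(1)] c(2,3)[OF that(1)] that in auto)
  have g_range: "g i t \<in> {x (p i)..x (q i)}" if "i < m" "t \<in> cls i" for i t
    using branch_range[OF that(2)] gpq[OF that(1)] by (elim conjE)
  have edge: "(i, k) \<in> ?E" if "i < m" "k < m" "t \<in> opn i" "f t \<in> opn k" for i k t
  proof -
    have "f t \<in> {x (p i)..x (q i)}" using g_range[OF that(1), of t] gpq[OF that(1)] that(3) by auto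
    from opn_Icc_index[OF that(2,4) this] gpq[OF that(1)] that show ?thesis by (auto simp: a_def)
  qed
  have path: "(i, j) \<in> ?E\<^sup>+" if "i < m" "j < m" "t \<in> opn i" "(f ^^ Suc n) t \<in> opn j" for n i j t
    using that
  proof (induction n arbitrary: i t)
    case 0
    then show ?case using edge[of i j t] by auto
  next
    case (Suc n)
    have fn: "(f ^^ Suc n) (f t) \<in> opn j" using Suc.prems(4) by (simp only: funpow_Suc_right o_apply)
    have B: "(f ^^ k) s \<in> pts" if "s \<in> pts" for k s using that by (induction k) (use f_pts in auto)
    have "f t \<notin> pts" using B[of "f t" "Suc n"] fn opn_not_pts[OF Suc.prems(2)] by blast
    moreover have "f t \<in> {0..1}" using f_maps cls_subset[OF Suc.prems(1)] Suc.prems(3) by auto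
    ultimately obtain k where k: "k < m" "f t \<in> opn k" using opn_exists by blast
    have "(i, k) \<in> ?E" by (rule edge[OF Suc.prems(1) k(1) Suc.prems(3) k(2)])
    moreover have "(k, j) \<in> ?E\<^sup>+" by (rule Suc.IH[OF k(1) Suc.prems(2) k(2) fn])
    ultimately show ?case by (rule trancl_into_trancl2)
  qed
  have irr: "irreducible_matrix m a"
    unfolding irreducible_matrix_def
  proof (intro conjI allI impI)
    fix i j assume ij: "i < m" "j < m"
    then obtain n t where n: "n \<ge> 1" and t: "(f ^^ n) t \<in> opn j" "t \<in> cls i"
      using tr unfolding transitive_markov_def by blast
    have B: "(f ^^ k) s \<in> pts" if "s \<in> pts" for k s using that by (induction k) (use f_pts in auto)
    have "t \<notin> pts" using B[of t n] t(1) opn_not_pts[OF ij(2)] by blast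
    then have "t \<noteq> x i" "t \<noteq> x (Suc i)" using ij by auto
    then have "t \<in> opn i" using t(2) by auto
    then show "(i, j) \<in> ?E\<^sup>+" using path[OF ij, of t "n - 1"] n t(1) by simp
  qed (simp add: a_def)
  have "expanding_markov m x f g p q c"
    by unfold_locales (use f_maps f_pts gpq c(1) expand irr[unfolded a_def] in blast)+
  then show ?thesis by blast
qed

section \<open>The conformal distribution function\<close>

locale parry_data = expanding_markov +
  fixes \<rho> :: real and u v :: "nat \<Rightarrow> real"
  assumes rho_pos: "\<rho> > 0"
    and u_pos: "\<And>i. i < m \<Longrightarrow> u i > 0" and v_pos: "\<And>i. i < m \<Longrightarrow> v i > 0"
    and uv: "(\<Sum>i<m. u i * v i) = 1"
    and v_eigen': "\<And>i. i < m \<Longrightarrow> (\<Sum>j<m. branch_matrix p q i j * v j) = \<rho> * v i"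
    and u_eigen: "\<And>j. j < m \<Longrightarrow> (\<Sum>i<m. u i * branch_matrix p q i j) = \<rho> * u j"
begin

lemma transition_sum:
  assumes "i < m"
  shows "(\<Sum>j<m. branch_matrix p q i j * h j) = (\<Sum>j=p i..<q i. h j :: real)"
proof -
  have "(\<Sum>j<m. branch_matrix p q i j * h j) = (\<Sum>j\<in>{..<m} \<inter> {j. p i \<le> j \<and> j < q i}. h j)"
    by (simp add: sum.If_cases if_distrib[of "\<lambda>a. a * _"] cong: if_cong)
  also have "{..<m} \<inter> {j. p i \<le> j \<and> j < q i} = {p i..<q i}" using q_le[OF assms] by auto
  finally show ?thesis .
qed

lemma v_eigen: "i < m \<Longrightarrow> (\<Sum>j=p i..<q i. v j) = \<rho> * v i"
  using v_eigen'[of i] transition_sum[of i v] by simp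

lemma telescope: "k \<le> l \<Longrightarrow> (\<Sum>j=k..<l. h (Suc j) - h j) = h l - (h k :: real)"
  by (rule sum_Suc_diff')

lemma g_ends: 
  assumes "i < m" shows "\<bar>h (g i (x (Suc i))) - h (g i (x i))\<bar> = \<bar>h (x (q i)) - h (x (p i)) :: real\<bar>"
  using g_branch[OF assms] by (auto simp: abs_minus_commute)

text \<open>
  The lengths \<open>l\<close> of the intervals satisfy \<open>A l \<ge> c * l\<close> by expansion; pairing this with the left
  eigenvector gives \<open>\<rho> \<ge> c\<close>.
\<close>

lemma rho_gt_1: "\<rho> > 1"
proof -
  define l where "l j = x (Suc j) - x j" for j
  have l: "l j > 0" if "j < m" for j using x_less_Suc[OF that] by (simp add: l_def)
  have ge: "c * l i \<le> (\<Sum>j<m. branch_matrix p q i j * l j)" if i: "i < m" for i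
  proof -
    have "c * l i = c * \<bar>x (Suc i) - x i\<bar>" using l[OF i] by (simp add: l_def)
    also have "\<dots> \<le> \<bar>g i (x (Suc i)) - g i (x i)\<bar>" using x_less_Suc[OF i] by (intro g_expand[OF i]) auto
    also have "\<dots> = \<bar>x (q i) - x (p i)\<bar>" by (rule g_ends[OF i, of id, unfolded id_apply])
    also have "\<dots> = x (q i) - x (p i)" using x_less[OF p_less_q[OF i] q_le[OF i]] by simp
    also have "\<dots> = (\<Sum>j=p i..<q i. l j)" unfolding l_def using p_less_q[OF i] by (simp add: telescope)
    finally show ?thesis using transition_sum[OF i] by simp
  qed
  have S: "(\<Sum>j<m. u j * l j) > 0" using m_pos u_pos l by (intro sum_pos) auto
  have "c * (\<Sum>i<m. u i * l i) = (\<Sum>i<m. u i * (c * l i))" by (simp add: sum_distrib_left algebra_simps)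
  also have "\<dots> \<le> (\<Sum>i<m. u i * (\<Sum>j<m. branch_matrix p q i j * l j))"
    using ge u_pos by (intro sum_mono mult_left_mono) (auto intro: less_imp_le)
  also have "\<dots> = (\<Sum>j<m. (\<Sum>i<m. u i * branch_matrix p q i j) * l j)"
    unfolding sum_distrib_left sum_distrib_right by (subst sum.swap) (simp add: mult.assoc)
  also have "\<dots> = (\<Sum>j<m. \<rho> * u j * l j)" using u_eigen by (intro sum.cong) auto
  also have "\<dots> = \<rho> * (\<Sum>j<m. u j * l j)" by (simp add: sum_distrib_left algebra_simps)
  finally show ?thesis using S c_gt_1 by simp
qed

text \<open>
  The conformal mass to the left of the \<open>k\<close>-th partition point.
\<close>

definition vsum :: "nat \<Rightarrow> real" where "vsum k = (\<Sum>j<k. v j)"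

lemma vsum_Suc: "vsum (Suc k) = vsum k + v k" by (simp add: vsum_def)

lemma vsum_less: "i < j \<Longrightarrow> j \<le> m \<Longrightarrow> vsum i < vsum j"
proof (induction j)
  case (Suc j)
  then show ?case using v_pos[of j] by (cases "i = j") (auto simp: vsum_Suc intro: less_trans)
qed simp

lemma vsum_le: "i \<le> j \<Longrightarrow> j \<le> m \<Longrightarrow> vsum i \<le> vsum j"
  using vsum_less[of i j] by (cases "i = j") auto

lemma vsum_branch: 
  assumes "i < m" shows "vsum (q i) - vsum (p i) = \<rho> * v i"
  using telescope[of "p i" "q i" vsum] p_less_q[OF assms] v_eigen[OF assms] by (simp add: vsum_Suc)

lemma g_range: "i < m \<Longrightarrow> t \<in> cls i \<Longrightarrow> g i t \<in> {x (p i)..x (q i)}"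
  by (rule branch_range[OF _ g_branch])

lemma g_range01: "i < m \<Longrightarrow> t \<in> cls i \<Longrightarrow> g i t \<in> {0..1}"
  using g_range[of i t] x_mem[of "p i"] x_mem[of "q i"] p_less_q[of i] q_le[of i] by fastforce

text \<open>
  Candidates for the conformal distribution function. Their values at the partition points are
  prescribed; this makes the pieces of the contraction below fit together.
\<close>

definition cdf_class :: "(real \<Rightarrow> real) \<Rightarrow> bool" where
  "cdf_class F \<longleftrightarrow> continuous_on {0..1} F \<and> mono_on {0..1} F \<and> (\<forall>k\<le>m. F (x k) = vsum k)"

text \<open>
  On each interval the increments of \<open>F\<close> are pulled back along the branch and divided by \<open>\<rho>\<close>; the
  absolute value takes care of decreasing branches. At a partition point the two adjacent
  intervals give the same value for candidates (\<open>cdf_step_cls\<close>).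
\<close>

definition cdf_step :: "(real \<Rightarrow> real) \<Rightarrow> real \<Rightarrow> real" where
  "cdf_step F t = (let i = (LEAST i. t \<le> x (Suc i)) in vsum i + \<bar>F (g i t) - F (g i (x i))\<bar> / \<rho>)"

text \<open>
  The right eigenvector equation: the image of the \<open>i\<close>-th interval has mass \<open>\<rho> * v i\<close>.
\<close>

lemma cdf_class_ends:
  assumes F: "cdf_class F" and i: "i < m"
  shows "\<bar>F (g i (x (Suc i))) - F (g i (x i))\<bar> / \<rho> = v i"
proof -
  have "\<bar>F (g i (x (Suc i))) - F (g i (x i))\<bar> = \<bar>F (x (q i)) - F (x (p i))\<bar>" by (rule g_ends[OF i])
  also have "\<dots> = \<rho> * v i"
    using F p_less_q[OF i] q_le[OF i] vsum_branch[OF i] rho_pos v_pos[OF i] by (simp add: cdf_class_def)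
  finally show ?thesis using rho_pos by simp
qed

lemma cdf_step_cls:
  assumes F: "cdf_class F" and i: "i < m" and t: "t \<in> cls i"
  shows "cdf_step F t = vsum i + \<bar>F (g i t) - F (g i (x i))\<bar> / \<rho>"
proof -
  have L: "(LEAST k. t \<le> x (Suc k)) = j" if "j < m" "x j < t \<or> j = 0" "t \<le> x (Suc j)" for j
  proof (rule Least_equality)
    show "t \<le> x (Suc j)" by (rule that(3))
    fix k assume k: "t \<le> x (Suc k)"
    show "j \<le> k"
    proof (rule ccontr)
      assume "\<not> j \<le> k"
      then have "x (Suc k) \<le> x j" using that by (intro x_le) auto
      then show False using that k \<open>\<not> j \<le> k\<close> by auto
    qed
  qed
  show ?thesis
  proof (cases "x i < t \<or> i = 0")
    case True
    then show ?thesis using L[of i] i t by (simp add: cdf_step_def)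
  next
    case False
    then obtain k where k: "i = Suc k" "t = x i" using t by (cases i) auto
    then have "(LEAST k. t \<le> x (Suc k)) = k" using L[of k] i x_less_Suc[of k] by simp
    then have "cdf_step F t = vsum k + v k"
      using cdf_class_ends[OF F, of k] i k by (simp add: cdf_step_def)
    then show ?thesis using k by (simp add: vsum_Suc)
  qed
qed

lemma cover: "{0..1} = (\<Union>i<m. cls i)"
proof
  show "{0..1} \<subseteq> (\<Union>i<m. cls i)"
  proof
    fix t :: real assume "t \<in> {0..1}"
    then obtain i where "i < m" "x i \<le> t" "t \<le> x (Suc i)" by (rule interval_exists)
    then show "t \<in> (\<Union>i<m. cls i)" by auto
  qed
  show "(\<Union>i<m. cls i) \<subseteq> {0..1}" using cls_subset by blast
qed

lemma cdf_step_mono_cls: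
  fixes F :: "real \<Rightarrow> real"
  assumes F: "mono_on {0..1} F" and i: "i < m" and s: "s \<in> cls i" and t: "t \<in> cls i" and st: "s \<le> t"
  shows "\<bar>F (g i s) - F (g i (x i))\<bar> \<le> \<bar>F (g i t) - F (g i (x i))\<bar>"
proof -
  have e: "x i \<in> cls i" "x i \<le> s" using s by auto
  note r = g_range01[OF i s] g_range01[OF i t] g_range01[OF i e(1)]
  from g_branch[OF i] show ?thesis
  proof (elim conjE disjE)
    assume mo: "mono_on (cls i) (g i)"
    have "g i (x i) \<le> g i s" "g i s \<le> g i t" using mono_onD[OF mo] e s t st by auto
    then have "F (g i (x i)) \<le> F (g i s)" "F (g i s) \<le> F (g i t)" using mono_onD[OF F] r by auto
    then show ?thesis by linarith
  next
    assume mo: "antimono_on (cls i) (g i)"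
    have "g i (x i) \<ge> g i s" "g i s \<ge> g i t" using monotone_onD[OF mo] e s t st by auto
    then have "F (g i (x i)) \<ge> F (g i s)" "F (g i s) \<ge> F (g i t)" using mono_onD[OF F] r by auto
    then show ?thesis by linarith
  qed
qed

lemma cdf_class_step:
  assumes F: "cdf_class F"
  shows "cdf_class (cdf_step F)"
proof -
  have Fm: "mono_on {0..1} F" and Fc: "continuous_on {0..1} F" using F by (auto simp: cdf_class_def)
  note cl = cdf_step_cls[OF F]
  have pt: "cdf_step F (x k) = vsum k" if "k \<le> m" for k
  proof (cases "k < m")
    case True
    then show ?thesis using cl[of k "x k"] x_less_Suc[of k] by simp
  next
    case False
    then have "k = m" using that by simp
    then obtain l where "k = Suc l" "l < m" using m_pos gr0_conv_Suc by auto
    then show ?thesis using cl[of l "x k"] x_less_Suc[of l] cdf_class_ends[OF F, of l] by (simp add: vsum_Suc)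
  qed
  have mcl: "cdf_step F s \<le> cdf_step F t" if "i < m" "s \<in> cls i" "t \<in> cls i" "s \<le> t" for i s t
    unfolding cl[OF that(1,2)] cl[OF that(1,3)]
    using cdf_step_mono_cls[OF Fm that] rho_pos by (simp add: divide_right_mono)
  have "cdf_step F s \<le> cdf_step F t" if "s \<in> {0..1}" "t \<in> {0..1}" "s \<le> t" for s t
  proof -
    from that cover obtain i j where i: "i < m" "s \<in> cls i" and j: "j < m" "t \<in> cls j" by blast
    show ?thesis
    proof (cases i j rule: linorder_cases)
      case less
      have "cdf_step F s \<le> cdf_step F (x (Suc i))" using i by (intro mcl[of i]) auto
      also have "\<dots> = vsum (Suc i)" using i by (intro pt) auto
      also have "\<dots> \<le> vsum j" using less j by (intro vsum_le) auto
      also have "\<dots> = cdf_step F (x j)" using j by (intro pt[symmetric]) auto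
      also have "\<dots> \<le> cdf_step F t" using j by (intro mcl[of j]) auto
      finally show ?thesis .
    next
      case equal
      then show ?thesis using mcl[of i s t] i j that by simp
    next
      case greater
      have "x (Suc j) \<le> x i" using greater i by (intro x_le) auto
      then have "s = t" using i j that by auto
      then show ?thesis by simp
    qed
  qed
  then have mono: "mono_on {0..1} (cdf_step F)" by (rule mono_onI)
  have "continuous_on (\<Union>i<m. cls i) (cdf_step F)"
  proof (rule continuous_on_closed_Union)
    fix i assume "i \<in> {..<m}"
    then have i: "i < m" by simp
    have "continuous_on (cls i) (\<lambda>t. vsum i + \<bar>F (g i t) - F (g i (x i))\<bar> / \<rho>)"
      using rho_pos
      by (intro continuous_intros continuous_on_compose2[OF Fc g_cont[OF i]])
         (use g_range01[OF i] in auto)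
    then show "continuous_on (cls i) (cdf_step F)"
      by (rule continuous_on_cong[THEN iffD1, rotated 2]) (simp_all add: cl[OF i])
  qed auto
  then show ?thesis unfolding cdf_class_def cover[symmetric] using mono pt by auto
qed

definition cdf_start :: "real \<Rightarrow> real" where
  "cdf_start t = (\<Sum>k<m. v k * max 0 (min 1 ((t - x k) / (x (Suc k) - x k))))"

lemma cdf_class_start: "cdf_class cdf_start"
  unfolding cdf_class_def
proof (intro conjI allI impI)
  show "continuous_on {0..1} cdf_start" unfolding cdf_start_def[abs_def]
    by (intro continuous_intros) (use x_less_Suc in force)
  show "mono_on {0..1} cdf_start"
  proof (rule mono_onI)
    fix s t :: real assume "s \<le> t"
    then have "(s - x k) / (x (Suc k) - x k) \<le> (t - x k) / (x (Suc k) - x k)" if "k < m" for k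
      using x_less_Suc[OF that] by (intro divide_right_mono) auto
    then show "cdf_start s \<le> cdf_start t" unfolding cdf_start_def
      using v_pos by (intro sum_mono mult_left_mono max.mono min.mono) (auto intro: less_imp_le)
  qed
next
  fix k assume k: "k \<le> m"
  have "cdf_start (x k) = (\<Sum>j<m. if j < k then v j else 0)"
    unfolding cdf_start_def
  proof (intro sum.cong refl)
    fix j assume "j \<in> {..<m}"
    then have j: "j < m" by simp
    show "v j * max 0 (min 1 ((x k - x j) / (x (Suc j) - x j))) = (if j < k then v j else 0)"
    proof (cases "j < k")
      case True
      then have "x (Suc j) \<le> x k" using k by (intro x_le) auto
      then have "1 \<le> (x k - x j) / (x (Suc j) - x j)" using x_less_Suc[OF j] by simp
      then show ?thesis using True by simp
    next
      case False
      then have "x k \<le> x j" using j by (intro x_le) auto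
      then have "(x k - x j) / (x (Suc j) - x j) \<le> 0" using x_less_Suc[OF j] by (simp add: divide_le_0_iff)
      then show ?thesis using False by simp
    qed
  qed
  also have "\<dots> = (\<Sum>j\<in>{..<m} \<inter> {j. j < k}. v j)" by (simp add: sum.If_cases)
  also have "{..<m} \<inter> {j. j < k} = {..<k}" using k by auto
  finally show "cdf_start (x k) = vsum k" by (simp add: vsum_def)
qed

lemma cdf_class_range:
  assumes "cdf_class F" "t \<in> {0..1}"
  shows "F t \<in> {0..vsum m}"
proof -
  have F: "mono_on {0..1} F" "F 0 = 0" "F 1 = vsum m"
    using assms(1) unfolding cdf_class_def by (auto simp: x_0[symmetric] x_m[symmetric] vsum_def simp del: x_0 x_m)
  show ?thesis using mono_onD[OF F(1), of 0 t] mono_onD[OF F(1), of t 1] assms(2) F by auto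
qed

text \<open>
  Two candidates agree at the image of a partition point, so of the two values of \<open>F\<close> in an
  increment only one changes; no factor 2 is lost against \<open>1 / \<rho>\<close>.
\<close>

lemma cdf_step_contract:
  assumes F: "cdf_class F" and G: "cdf_class G"
    and d: "\<And>t. t \<in> {0..1} \<Longrightarrow> \<bar>F t - G t\<bar> \<le> d" and t: "t \<in> {0..1}"
  shows "\<bar>cdf_step F t - cdf_step G t\<bar> \<le> d / \<rho>"
proof -
  obtain i where i: "i < m" "t \<in> cls i" using t cover by blast
  have e: "F (g i (x i)) = G (g i (x i))"
    using g_branch[OF i(1)] F G p_less_q[OF i(1)] q_le[OF i(1)] by (auto simp: cdf_class_def)
  have "\<bar>cdf_step F t - cdf_step G t\<bar> = \<bar>\<bar>F (g i t) - F (g i (x i))\<bar> - \<bar>G (g i t) - F (g i (x i))\<bar>\<bar> / \<rho>"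
    unfolding cdf_step_cls[OF F i] cdf_step_cls[OF G i] e using rho_pos
    by (simp add: diff_divide_distrib[symmetric])
  also have "\<dots> \<le> \<bar>F (g i t) - G (g i t)\<bar> / \<rho>" using rho_pos by (intro divide_right_mono) auto
  also have "\<dots> \<le> d / \<rho>" using rho_pos by (intro divide_right_mono d g_range01[OF i]) auto
  finally show ?thesis .
qed

text \<open>
  The iterates of the contraction converge uniformly, by comparison with a geometric series.
\<close>

lemma conformal_cdf_exists:
  "\<exists>F. cdf_class F \<and> (\<forall>i<m. \<forall>t\<in>cls i. F t = vsum i + \<bar>F (g i t) - F (g i (x i))\<bar> / \<rho>)"
proof -
  define Fn where "Fn n = (cdf_step ^^ n) cdf_start" for n
  have K: "cdf_class (Fn n)" for n
    unfolding Fn_def by (induction n) (simp_all add: cdf_class_start cdf_class_step)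
  have d: "\<bar>Fn (Suc n) t - Fn n t\<bar> \<le> vsum m * (1 / \<rho>) ^ n" if "t \<in> {0..1}" for n t
    using that
  proof (induction n arbitrary: t)
    case 0
    then show ?case using cdf_class_range[OF K[of 0]] cdf_class_range[OF K[of 1]] by fastforce
  next
    case (Suc n)
    have "\<bar>cdf_step (Fn (Suc n)) t - cdf_step (Fn n) t\<bar> \<le> vsum m * (1 / \<rho>) ^ n / \<rho>"
      by (rule cdf_step_contract[OF K K Suc.IH Suc.prems])
    then show ?case by (simp add: Fn_def field_simps)
  qed
  have sm: "summable (\<lambda>n. vsum m * (1 / \<rho>) ^ n)"
    using rho_gt_1 by (intro summable_mult summable_geometric) simp
  define F where "F t = cdf_start t + (\<Sum>n. Fn (Suc n) t - Fn n t)" for t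
  have "uniform_limit {0..1} (\<lambda>n t. \<Sum>k<n. Fn (Suc k) t - Fn k t) (\<lambda>t. \<Sum>k. Fn (Suc k) t - Fn k t) sequentially"
    by (rule Weierstrass_m_test[OF _ sm]) (use d in auto)
  then have "uniform_limit {0..1} (\<lambda>n t. cdf_start t + (\<Sum>k<n. Fn (Suc k) t - Fn k t)) F sequentially"
    unfolding F_def[abs_def] by (intro uniform_limit_add uniform_limit_const)
  moreover have "cdf_start t + (\<Sum>k<n. Fn (Suc k) t - Fn k t) = Fn n t" for n t
    by (subst sum_lessThan_telescope) (simp add: Fn_def)
  ultimately have ul: "uniform_limit {0..1} Fn F sequentially" by simp
  have lim: "(\<lambda>n. Fn n t) \<longlonglongrightarrow> F t" if "t \<in> {0..1}" for t
    using tendsto_uniform_limitI[OF ul that] .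
  have cont: "continuous_on {0..1} F"
    by (rule uniform_limit_theorem[OF _ ul]) (use K in \<open>auto simp: cdf_class_def\<close>)
  have mono: "mono_on {0..1} F"
  proof (rule mono_onI)
    fix s t :: real assume st: "s \<in> {0..1}" "t \<in> {0..1}" "s \<le> t"
    have "Fn n s \<le> Fn n t" for n
      using K[of n] mono_onD[of "{0..1}" "Fn n" s t] st by (simp add: cdf_class_def)
    then show "F s \<le> F t" by (intro LIMSEQ_le[OF lim[OF st(1)] lim[OF st(2)]]) auto
  qed
  have pts: "F (x k) = vsum k" if "k \<le> m" for k
    using lim[OF x_mem[OF that]] K that by (simp add: cdf_class_def LIMSEQ_const_iff)
  have "F t = vsum i + \<bar>F (g i t) - F (g i (x i))\<bar> / \<rho>" if i: "i < m" and t: "t \<in> cls i" for i t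
  proof -
    have t01: "t \<in> {0..1}" using cls_subset[OF i] t by blast
    have xi: "x i \<in> cls i" using x_less_Suc[OF i] by simp
    have "(\<lambda>n. vsum i + \<bar>Fn n (g i t) - Fn n (g i (x i))\<bar> / \<rho>) \<longlonglongrightarrow> vsum i + \<bar>F (g i t) - F (g i (x i))\<bar> / \<rho>"
      using rho_pos by (intro tendsto_intros lim g_range01[OF i] t xi) auto
    moreover have "vsum i + \<bar>Fn n (g i t) - Fn n (g i (x i))\<bar> / \<rho> = Fn (Suc n) t" for n
      using cdf_step_cls[OF K i t] by (simp add: Fn_def)
    ultimately have "(\<lambda>n. Fn (Suc n) t) \<longlonglongrightarrow> vsum i + \<bar>F (g i t) - F (g i (x i))\<bar> / \<rho>" by simp
    moreover have "(\<lambda>n. Fn (Suc n) t) \<longlonglongrightarrow> F t" using lim[OF t01] by (rule LIMSEQ_Suc)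
    ultimately show ?thesis by (rule LIMSEQ_unique[symmetric])
  qed
  then show ?thesis using cont mono pts by (auto simp: cdf_class_def)
qed

definition F :: "real \<Rightarrow> real" where
  "F = (SOME F. cdf_class F \<and> (\<forall>i<m. \<forall>t\<in>cls i. F t = vsum i + \<bar>F (g i t) - F (g i (x i))\<bar> / \<rho>))"

lemma F: "cdf_class F" "\<And>i t. i < m \<Longrightarrow> t \<in> cls i \<Longrightarrow> F t = vsum i + \<bar>F (g i t) - F (g i (x i))\<bar> / \<rho>"
  using someI_ex[OF conformal_cdf_exists] unfolding F_def by auto

lemma F_cont: "continuous_on {0..1} F" and F_mono: "mono_on {0..1} F"
  and F_pts: "k \<le> m \<Longrightarrow> F (x k) = vsum k"
  using F(1) by (auto simp: cdf_class_def)

lemma F_0: "F 0 = 0" using F_pts[of 0] by (simp add: x_0 vsum_def)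

lemma F_conformal:
  assumes i: "i < m" and s: "s \<in> cls i" and t: "t \<in> cls i"
  shows "\<bar>F t - F s\<bar> = \<bar>F (g i t) - F (g i s)\<bar> / \<rho>"
proof -
  have xi: "x i \<in> cls i" using x_less_Suc[OF i] by simp
  note r = g_range01[OF i s] g_range01[OF i t] g_range01[OF i xi]
  have d: "F t - F s = (\<bar>F (g i t) - F (g i (x i))\<bar> - \<bar>F (g i s) - F (g i (x i))\<bar>) / \<rho>"
    unfolding F(2)[OF i s] F(2)[OF i t] by (simp add: diff_divide_distrib)
  from g_branch[OF i] have "(F (g i t) \<ge> F (g i (x i)) \<and> F (g i s) \<ge> F (g i (x i))) \<or>
    (F (g i t) \<le> F (g i (x i)) \<and> F (g i s) \<le> F (g i (x i)))"
  proof (elim conjE disjE)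
    assume mo: "mono_on (cls i) (g i)"
    have "g i (x i) \<le> g i s" "g i (x i) \<le> g i t" using mono_onD[OF mo xi] s t by auto
    then show ?thesis using mono_onD[OF F_mono] r by auto
  next
    assume mo: "antimono_on (cls i) (g i)"
    have "g i (x i) \<ge> g i s" "g i (x i) \<ge> g i t" using monotone_onD[OF mo xi] s t by auto
    then show ?thesis using mono_onD[OF F_mono] r by auto
  qed
  then show ?thesis unfolding d using rho_pos by (auto simp: abs_minus_commute)
qed

end

section \<open>The Parry measure\<close>

text \<open>
  The function \<open>clamp k l\<close> moves a point to the nearest point of \<open>{x k..x l}\<close>. An increment up to
  the clamped point is the sum of its contributions from the single partition intervals.
\<close>

lemma (in interval_partition) telescope_clamp:
  assumes "k \<le> l" "l \<le> m"
  shows "(\<Sum>j=k..<l. h (clamp j (Suc j) t) - h (x j)) = h (clamp k l t) - (h (x k) :: real)"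
proof -
  let ?k = "\<lambda>j. h (clamp k j t)"
  have "(\<Sum>j=k..<l. h (clamp j (Suc j) t) - h (x j)) = (\<Sum>j=k..<l. ?k (Suc j) - ?k j)"
  proof (rule sum.cong[OF refl])
    fix j assume "j \<in> {k..<l}"
    then have "x k \<le> x j" "x j < x (Suc j)" using assms by (auto intro!: x_le x_less_Suc)
    then show "h (clamp j (Suc j) t) - h (x j) = ?k (Suc j) - ?k j"
      by (cases "t \<le> x j"; cases "t \<le> x (Suc j)") (auto simp: max_def min_def)
  qed
  also have "\<dots> = ?k l - ?k k" by (rule sum_Suc_diff'[OF assms(1)])
  also have "?k k = h (x k)" by (simp add: max_def min_def)
  finally show ?thesis .
qed

context expanding_markov
begin

text \<open>
  The map on the unit interval, extended by \<open>0\<close> to a Borel function on the line.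
\<close>

definition f_ext :: "real \<Rightarrow> real" where
  "f_ext t = (\<Sum>i<m. indicator (opn i) t *\<^sub>R g i t) + (\<Sum>k\<le>m. indicator {x k} t *\<^sub>R f (x k))"

lemma f_ext_measurable [measurable]: "f_ext \<in> borel_measurable borel"
  unfolding f_ext_def[abs_def]
proof (intro borel_measurable_add borel_measurable_sum)
  fix i assume "i \<in> {..<m}"
  then show "(\<lambda>t. indicator (opn i) t *\<^sub>R g i t) \<in> borel_measurable borel"
    by (intro borel_measurable_continuous_on_indicator continuous_on_subset[OF g_cont]) auto
qed auto

lemma f_ext_eq: 
  assumes "t \<in> {0..1}" shows "f_ext t = f t"
proof (cases "t \<in> pts")
  case True
  then obtain k where k: "k \<le> m" "t = x k" by auto
  have "indicator (opn i) t *\<^sub>R g i t = 0" if "i < m" for i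
    using opn_not_pts[OF that, of t] True by (auto simp: indicator_def)
  then have "(\<Sum>i<m. indicator (opn i) t *\<^sub>R g i t) = 0" by (intro sum.neutral) simp
  moreover have "(\<Sum>l\<le>m. indicator {x l} t *\<^sub>R f (x l)) = (\<Sum>l\<le>m. if l = k then f (x k) else 0)"
    using k by (intro sum.cong) (auto simp: indicator_def x_eq_iff)
  ultimately show ?thesis using k by (simp add: f_ext_def)
next
  case False
  then obtain k where k: "k < m" "t \<in> opn k" using opn_exists[OF assms] by blast
  have "(\<Sum>l\<le>m. indicator {x l} t *\<^sub>R f (x l)) = 0" using False by (intro sum.neutral) (auto simp: indicator_def)
  moreover have "(\<Sum>i<m. indicator (opn i) t *\<^sub>R g i t) = (\<Sum>i<m. if i = k then g k t else 0)"
  proof (rule sum.cong[OF refl])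
    fix i assume "i \<in> {..<m}"
    then show "indicator (opn i) t *\<^sub>R g i t = (if i = k then g k t else 0)"
      using k opn_unique[of i k t] by (cases "t \<in> opn i") (auto simp del: greaterThanLessThan_iff)
  qed
  ultimately show ?thesis using k f_eq_g[OF k] by (simp add: f_ext_def)
qed

lemma g_image:
  assumes i: "i < m" and t: "x (p i) \<le> t" "t \<le> x (q i)"
  obtains s where "s \<in> cls i" "g i s = t"
proof -
  have le: "x i \<le> x (Suc i)" using x_less_Suc[OF i] by simp
  from g_branch[OF i] show ?thesis
  proof (elim conjE disjE)
    assume "g i (x i) = x (p i)" "g i (x (Suc i)) = x (q i)"
    then show ?thesis using IVT'[of "g i" "x i" t "x (Suc i)"] t le g_cont[OF i] that by auto
  next
    assume "g i (x i) = x (q i)" "g i (x (Suc i)) = x (p i)"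
    then show ?thesis using IVT2'[of "g i" "x (Suc i)" t "x i"] t le g_cont[OF i] that by auto
  qed
qed

lemma g_inj: 
  assumes "i < m" "s \<in> cls i" "t \<in> cls i" "g i s = g i t" shows "s = t"
  using g_expand[OF assms(1-3)] assms(4) c_gt_1 by (simp add: mult_le_0_iff)

text \<open>
  Up to its end points, the part of a branch below a level is an interval; one end is mapped to the bottom
  of the image of the branch, the other to the level clamped to the image.
\<close>

lemma branch_sublevel:
  assumes i: "i < m"
  obtains a b where "a \<le> b" "{a<..<b} \<subseteq> opn i \<inter> {s. g i s \<le> t}" "opn i \<inter> {s. g i s \<le> t} \<subseteq> {a..b}"
    "a \<in> cls i" "b \<in> cls i" "{g i a, g i b} = {x (p i), clamp (p i) (q i) t}"
proof -
  let ?t = "clamp (p i) (q i) t"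
  have pq: "x (p i) < x (q i)" using p_less_q[OF i] q_le[OF i] by (rule x_less)
  obtain s where s: "s \<in> cls i" "g i s = ?t" using g_image[OF i, of ?t] pq by auto
  have e: "x i \<in> cls i" "x (Suc i) \<in> cls i" using x_less_Suc[OF i] by auto
  have xi: "x i \<le> s" "s \<le> x (Suc i)" using s by auto
  from g_branch[OF i] show ?thesis
  proof (elim conjE disjE)
    assume mo: "mono_on (cls i) (g i)" and g: "g i (x i) = x (p i)" "g i (x (Suc i)) = x (q i)"
    have lt: "g i y < g i z" if "y \<in> cls i" "z \<in> cls i" "y < z" for y z
      using mono_onD[OF mo that(1,2)] that g_inj[OF i that(1,2)] by force
    have iff: "g i y \<le> t \<longleftrightarrow> y \<le> s" if y: "y \<in> opn i" for y
    proof -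
      have "x (p i) < g i y" "g i y < x (q i)" using lt[of "x i" y] lt[of y "x (Suc i)"] g y e by auto
      then have "g i y \<le> t \<longleftrightarrow> g i y \<le> g i s" unfolding s(2) by auto
      also have "\<dots> \<longleftrightarrow> y \<le> s" using lt[of y s] lt[of s y] s(1) y by (cases y s rule: linorder_cases) auto
      finally show ?thesis .
    qed
    show ?thesis
    proof (rule that[of "x i" s])
      show "{x i<..<s} \<subseteq> opn i \<inter> {s. g i s \<le> t}" using xi iff by fastforce
      show "opn i \<inter> {s. g i s \<le> t} \<subseteq> {x i..s}" using iff by fastforce
    qed (use xi s g e in auto)
  next
    assume mo: "antimono_on (cls i) (g i)" and g: "g i (x i) = x (q i)" "g i (x (Suc i)) = x (p i)"
    have lt: "g i z < g i y" if "y \<in> cls i" "z \<in> cls i" "y < z" for y z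
      using monotone_onD[OF mo that(1,2)] that g_inj[OF i that(1,2)] by force
    have iff: "g i y \<le> t \<longleftrightarrow> s \<le> y" if y: "y \<in> opn i" for y
    proof -
      have "x (p i) < g i y" "g i y < x (q i)" using lt[of "x i" y] lt[of y "x (Suc i)"] g y e by auto
      then have "g i y \<le> t \<longleftrightarrow> g i y \<le> g i s" unfolding s(2) by auto
      also have "\<dots> \<longleftrightarrow> s \<le> y" using lt[of y s] lt[of s y] s(1) y by (cases y s rule: linorder_cases) auto
      finally show ?thesis .
    qed
    show ?thesis
    proof (rule that[of s "x (Suc i)"])
      show "{s<..<x (Suc i)} \<subseteq> opn i \<inter> {s. g i s \<le> t}" using xi iff by fastforce
      show "opn i \<inter> {s. g i s \<le> t} \<subseteq> {s..x (Suc i)}" using iff by fastforce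
    qed (use xi s g e in auto)
  qed
qed

end

context parry_data
begin

text \<open>
  The distribution function of the measure with density \<open>u i\<close> on the \<open>i\<close>-th interval with respect to
  the conformal measure.
\<close>

definition parry_cdf :: "real \<Rightarrow> real" where
  "parry_cdf t = (\<Sum>i<m. u i * (F (clamp i (Suc i) t) - F (x i)))"

definition parry_real :: "real measure" where "parry_real = interval_measure parry_cdf"

definition parry :: "real measure" where "parry = restrict_space parry_real {0..1}"

lemma clamp_mem: "i < m \<Longrightarrow> clamp i (Suc i) t \<in> {0..1}"
  using x_less_Suc[of i] x_mem[of i] x_mem[of "Suc i"] by (auto simp: max_def min_def)

lemma parry_cdf_mono: "s \<le> t \<Longrightarrow> parry_cdf s \<le> parry_cdf t"
  unfolding parry_cdf_def
  using u_pos clamp_mem by (intro sum_mono mult_left_mono diff_right_mono mono_onD[OF F_mono]) (auto intro: less_imp_le)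

lemma parry_cdf_cont: "continuous_on UNIV parry_cdf"
  unfolding parry_cdf_def[abs_def]
  by (intro continuous_intros continuous_on_compose2[OF F_cont]) (use clamp_mem in auto)

lemma parry_cdf_isCont: "isCont parry_cdf t"
  using parry_cdf_cont by (simp add: continuous_on_eq_continuous_at)

lemma parry_cdf_le_0: "t \<le> 0 \<Longrightarrow> parry_cdf t = 0"
proof -
  assume t: "t \<le> 0"
  have "clamp i (Suc i) t = x i" if "i < m" for i
    using x_mem[of i] that x_less_Suc[OF that] t by (auto simp: max_def min_def)
  then show ?thesis by (simp add: parry_cdf_def)
qed

lemma parry_cdf_ge_1: "t \<ge> 1 \<Longrightarrow> parry_cdf t = 1"
proof -
  assume t: "t \<ge> 1"
  have "u i * (F (clamp i (Suc i) t) - F (x i)) = u i * v i" if "i < m" for i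
  proof -
    have "clamp i (Suc i) t = x (Suc i)"
      using x_mem[of "Suc i"] that x_less_Suc[OF that] t by (auto simp: max_def min_def)
    then show ?thesis using that by (simp add: F_pts vsum_Suc)
  qed
  then have "parry_cdf t = (\<Sum>i<m. u i * v i)" unfolding parry_cdf_def by (intro sum.cong) auto
  then show ?thesis by (simp add: uv)
qed

lemma parry_cdf_diff:
  assumes i: "i < m" and a: "a \<in> cls i" and b: "b \<in> cls i"
  shows "parry_cdf b - parry_cdf a = u i * (F b - F a)"
proof -
  have o: "clamp j (Suc j) b = clamp j (Suc j) a" if "j < m" "j \<noteq> i" for j
  proof (cases "j < i")
    case True
    then have "x (Suc j) \<le> x i" using i by (intro x_le) auto
    then show ?thesis using a b by (auto simp: min_def)
  next
    case False
    then have "x (Suc i) \<le> x j" using that by (intro x_le) auto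
    then show ?thesis using a b x_less_Suc[OF that(1)] by (auto simp: max_def min_def)
  qed
  have s: "clamp i (Suc i) b = b" "clamp i (Suc i) a = a" using a b by auto
  have "parry_cdf b - parry_cdf a = (\<Sum>j<m. u j * (F (clamp j (Suc j) b) - F (clamp j (Suc j) a)))"
    unfolding parry_cdf_def sum_subtractf[symmetric] by (simp add: algebra_simps)
  also have "\<dots> = (\<Sum>j<m. if j = i then u i * (F b - F a) else 0)"
    using o s by (intro sum.cong) auto
  finally show ?thesis using i by simp
qed

sublocale pr: real_distribution parry_real
  unfolding parry_real_def
proof (rule real_distribution_interval_measure)
  show "continuous (at_right a) parry_cdf" for a
    using parry_cdf_isCont by (rule continuous_at_imp_continuous_at_within)
  show "(parry_cdf \<longlongrightarrow> 0) at_bot"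
    by (rule tendsto_eventually) (auto simp: eventually_at_bot_linorder intro!: exI[of _ 0] parry_cdf_le_0)
  show "(parry_cdf \<longlongrightarrow> 1) at_top"
    by (rule tendsto_eventually) (auto simp: eventually_at_top_linorder intro!: exI[of _ 1] parry_cdf_ge_1)
qed (rule parry_cdf_mono)

lemma cdf_parry_real: "cdf parry_real = parry_cdf"
  unfolding parry_real_def
proof (rule cdf_interval_measure)
  show "continuous (at_right a) parry_cdf" for a
    using parry_cdf_isCont by (rule continuous_at_imp_continuous_at_within)
  show "(parry_cdf \<longlongrightarrow> 0) at_bot"
    by (rule tendsto_eventually) (auto simp: eventually_at_bot_linorder intro!: exI[of _ 0] parry_cdf_le_0)
qed (rule parry_cdf_mono)

lemma parry_real_singleton: "measure parry_real {t} = 0"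
  using pr.isCont_cdf[of t] parry_cdf_isCont by (simp add: cdf_parry_real)

lemma sets_parry_real [simp, measurable_cong]: "sets parry_real = sets borel"
  by (simp add: parry_real_def)

lemma parry_real_Ioc: "a \<le> b \<Longrightarrow> measure parry_real {a<..b} = parry_cdf b - parry_cdf a"
  using pr.cdf_diff_eq[of a b] by (cases "a = b") (auto simp: cdf_parry_real)

lemma parry_real_between:
  assumes ab: "a \<le> b" and S: "{a<..<b} \<subseteq> S" "S \<subseteq> {a..b}" and Sm: "S \<in> sets borel"
  shows "measure parry_real S = parry_cdf b - parry_cdf a"
proof -
  have "measure parry_real {a..b} \<le> measure parry_real ({a} \<union> {a<..b})"
    using ab by (intro pr.finite_measure_mono) auto
  also have "\<dots> \<le> measure parry_real {a} + measure parry_real {a<..b}"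
    by (rule measure_Un_le) auto
  finally have 1: "measure parry_real {a..b} \<le> parry_cdf b - parry_cdf a"
    using parry_real_Ioc[OF ab] by (simp add: parry_real_singleton)
  have "measure parry_real {a<..b} \<le> measure parry_real ({a<..<b} \<union> {b})"
    using ab by (intro pr.finite_measure_mono) auto
  also have "\<dots> \<le> measure parry_real {a<..<b} + measure parry_real {b}"
    by (rule measure_Un_le) auto
  finally have 2: "parry_cdf b - parry_cdf a \<le> measure parry_real {a<..<b}"
    using parry_real_Ioc[OF ab] by (simp add: parry_real_singleton)
  have "measure parry_real {a<..<b} \<le> measure parry_real S" "measure parry_real S \<le> measure parry_real {a..b}"
    using S Sm by (auto intro!: pr.finite_measure_mono)
  with 1 2 show ?thesis by linarith
qed

lemma parry_real_01: "measure parry_real {0..1} = 1"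
  by (subst parry_real_between[of 0 1]) (auto simp: parry_cdf_le_0 parry_cdf_ge_1)

lemma parry_real_pts: "measure parry_real pts = 0"
proof -
  have "measure parry_real pts \<le> (\<Sum>k\<le>m. measure parry_real {x k})"
    using pr.finite_measure_subadditive_finite[of "{..m}" "\<lambda>k. {x k}"] by (simp add: image_subset_iff UNION_singleton_eq_range)
  then show ?thesis using measure_nonneg[of parry_real pts] by (simp add: parry_real_singleton)
qed

text \<open>
  The preimage of a half-line consists of one interval in each branch, of conformal mass \<open>1 / \<rho>\<close> times
  the mass of its image. Splitting the images into partition intervals and exchanging the sums, the
  left eigenvector equation restores the density \<open>u\<close>.
\<close>

lemma parry_real_f_ext_le: "measure parry_real {s. f_ext s \<le> t} = parry_cdf t"
proof -
  have g_m: "opn i \<inter> {s. g i s \<le> t} \<in> sets borel" if "i < m" for i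
  proof -
    have "opn i \<inter> {s. g i s \<le> t} = opn i \<inter> {s. f_ext s \<le> t}"
      using f_ext_eq f_eq_g[OF that] cls_subset[OF that] by (auto simp: subset_iff)
    moreover have "{s. f_ext s \<le> t} \<in> sets borel"
      using borel_measurable_le[OF f_ext_measurable borel_measurable_const[of t]] by simp
    ultimately show ?thesis by simp
  qed
  have e: "measure parry_real {s. f_ext s \<le> t} = measure parry_real (\<Union>i<m. opn i \<inter> {s. g i s \<le> t})"
  proof (rule pr.finite_measure_eq_AE)
    have "AE s in parry_real. s \<in> {0..1}"
      using pr.AE_in_set_eq_1[of "{0..1}"] parry_real_01 by simp
    moreover have "pts \<in> null_sets parry_real"
      using parry_real_pts by (auto simp: null_sets_def pr.emeasure_eq_measure finite_imp_closed intro!: borel_closed)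
    then have "AE s in parry_real. s \<notin> pts" by (rule AE_not_in)
    ultimately show "AE s in parry_real. (s \<in> {s. f_ext s \<le> t}) = (s \<in> (\<Union>i<m. opn i \<inter> {s. g i s \<le> t}))"
    proof eventually_elim
      case (elim s)
      then obtain i where i: "i < m" "s \<in> opn i" using opn_exists by blast
      have fe: "f_ext s = g j s" if "j < m" "s \<in> opn j" for j
        using f_ext_eq[OF elim(1)] f_eq_g[OF that] by simp
      show ?case
      proof
        assume "s \<in> {s. f_ext s \<le> t}"
        then show "s \<in> (\<Union>i<m. opn i \<inter> {s. g i s \<le> t})" using i fe[OF i] by auto
      next
        assume "s \<in> (\<Union>i<m. opn i \<inter> {s. g i s \<le> t})"
        then obtain j where "j < m" "s \<in> opn j" "g j s \<le> t" by blast
        then show "s \<in> {s. f_ext s \<le> t}" using fe[of j] by simp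
      qed
    qed
  qed (use g_m borel_measurable_le[OF f_ext_measurable borel_measurable_const[of t]] in auto)
  also have "\<dots> = (\<Sum>i<m. measure parry_real (opn i \<inter> {s. g i s \<le> t}))"
    by (rule pr.finite_measure_finite_Union)
       (use g_m opn_unique in \<open>auto simp: disjoint_family_on_def simp del: greaterThanLessThan_iff\<close>)
  also have "\<dots> = (\<Sum>i<m. u i * ((F (clamp (p i) (q i) t) - F (x (p i))) / \<rho>))"
  proof (rule sum.cong[OF refl])
    fix i assume "i \<in> {..<m}"
    then have i: "i < m" by simp
    obtain a b where ab: "a \<le> b" "{a<..<b} \<subseteq> opn i \<inter> {s. g i s \<le> t}" "opn i \<inter> {s. g i s \<le> t} \<subseteq> {a..b}"
      "a \<in> cls i" "b \<in> cls i" "{g i a, g i b} = {x (p i), clamp (p i) (q i) t}"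
      by (rule branch_sublevel[OF i])
    have pq: "x (p i) \<le> x (q i)" using p_less_q[OF i] q_le[OF i] by (intro x_le) auto
    have t01: "clamp (p i) (q i) t \<in> {0..1}" "x (p i) \<in> {0..1}"
      using pq x_mem[of "p i"] x_mem[OF q_le[OF i]] p_less_q[OF i] q_le[OF i] by (auto simp: max_def min_def)
    have "F a \<le> F b" using ab cls_subset[OF i] by (intro mono_onD[OF F_mono]) auto
    then have "F b - F a = \<bar>F b - F a\<bar>" by simp
    also have "\<dots> = \<bar>F (g i b) - F (g i a)\<bar> / \<rho>" by (rule F_conformal[OF i ab(4,5)])
    also have "\<bar>F (g i b) - F (g i a)\<bar> = \<bar>F (clamp (p i) (q i) t) - F (x (p i))\<bar>"
      using ab(6) by (auto simp: doubleton_eq_iff)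
    also have "\<dots> = F (clamp (p i) (q i) t) - F (x (p i))"
      using mono_onD[OF F_mono t01(2,1)] by simp
    finally show "measure parry_real (opn i \<inter> {s. g i s \<le> t}) = u i * ((F (clamp (p i) (q i) t) - F (x (p i))) / \<rho>)"
      using parry_real_between[OF ab(1,2,3) g_m[OF i]] parry_cdf_diff[OF i ab(4,5)] by simp
  qed
  also have "\<dots> = (\<Sum>i<m. u i * (\<Sum>j<m. branch_matrix p q i j * (F (clamp j (Suc j) t) - F (x j)))) / \<rho>"
    unfolding sum_divide_distrib
  proof (rule sum.cong[OF refl])
    fix i assume "i \<in> {..<m}"
    then have i: "i < m" by simp
    show "u i * ((F (clamp (p i) (q i) t) - F (x (p i))) / \<rho>) =
      u i * (\<Sum>j<m. branch_matrix p q i j * (F (clamp j (Suc j) t) - F (x j))) / \<rho>"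
      unfolding transition_sum[OF i] using telescope_clamp[OF less_imp_le[OF p_less_q[OF i]] q_le[OF i], of F t] by simp
  qed
  also have "\<dots> = (\<Sum>j<m. (\<Sum>i<m. u i * branch_matrix p q i j) * (F (clamp j (Suc j) t) - F (x j))) / \<rho>"
    unfolding sum_distrib_left sum_distrib_right by (subst sum.swap) (simp add: mult.assoc)
  also have "\<dots> = (\<Sum>j<m. \<rho> * u j * (F (clamp j (Suc j) t) - F (x j))) / \<rho>"
    using u_eigen by (intro arg_cong[where f="\<lambda>s. s / \<rho>"] sum.cong) auto
  also have "\<dots> = parry_cdf t"
    unfolding parry_cdf_def using rho_pos by (simp add: mult.assoc sum_distrib_left[symmetric])
  finally show ?thesis .
qed

lemma distr_parry_real: "distr parry_real borel f_ext = parry_real"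
proof (rule cdf_unique)
  have f: "f_ext \<in> measurable parry_real borel"
    unfolding measurable_cong_sets[OF sets_parry_real refl] by (rule f_ext_measurable)
  show "real_distribution (distr parry_real borel f_ext)"
    using f by (rule pr.real_distribution_distr)
  show "cdf (distr parry_real borel f_ext) = cdf parry_real"
    unfolding cdf_parry_real
  proof
    fix t
    have "cdf (distr parry_real borel f_ext) t = measure parry_real {s. f_ext s \<le> t}"
      unfolding cdf_def by (subst measure_distr[OF f]) (auto simp: vimage_def)
    then show "cdf (distr parry_real borel f_ext) t = parry_cdf t"
      using parry_real_f_ext_le by simp
  qed
qed (rule pr.real_distribution_axioms)

lemma sets_parry: "sets parry = sets (restrict_space borel {0..1})"
  unfolding parry_def by (rule sets_restrict_space_cong) simp

lemma space_parry: "space parry = {0..1}"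
  by (simp add: parry_def space_restrict_space)

lemma emeasure_parry: "A \<subseteq> {0..1} \<Longrightarrow> emeasure parry A = emeasure parry_real A"
  unfolding parry_def by (rule emeasure_restrict_space) auto

lemma f_measurable: "f \<in> measurable (restrict_space borel {0..1}) (restrict_space borel {0..1})"
proof (rule measurable_restrict_space2)
  show "f \<in> space (restrict_space borel {0..1}) \<rightarrow> {0..1}"
    using f_maps by (auto simp: space_restrict_space)
  have "f_ext \<in> measurable (restrict_space borel {0..1}) borel"
    by (rule measurable_restrict_space1) simp
  then show "f \<in> measurable (restrict_space borel {0..1}) borel"
    by (rule measurable_cong[THEN iffD1, rotated]) (simp add: space_restrict_space f_ext_eq)
qed

lemma invariant_parry: "invariant_borel_prob 0 1 f parry"
  unfolding invariant_borel_prob_def invariant_prob_def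
proof (intro conjI ballI)
  show "sets parry = sets (restrict_space borel {0..1})" by (rule sets_parry)
  show "prob_space parry"
    by (rule prob_spaceI) (simp add: space_parry emeasure_parry pr.emeasure_eq_measure parry_real_01)
  show "f \<in> measurable parry parry"
    using f_measurable by (simp cong: measurable_cong_sets add: sets_parry)
  fix A assume "A \<in> sets parry"
  then have A: "A \<subseteq> {0..1}" "A \<in> sets borel" by (auto simp: sets_parry sets_restrict_space)
  have "emeasure parry (f -` A \<inter> space parry) = emeasure parry_real (f -` A \<inter> {0..1})"
    by (simp add: space_parry emeasure_parry)
  also have "f -` A \<inter> {0..1} = f_ext -` A \<inter> {0..1}" using f_ext_eq by auto
  also have "emeasure parry_real (f_ext -` A \<inter> {0..1}) = emeasure parry_real (f_ext -` A)"
  proof (rule emeasure_eq_AE)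
    have "AE s in parry_real. s \<in> {0..1}" using pr.AE_in_set_eq_1[of "{0..1}"] parry_real_01 by simp
    then show "AE s in parry_real. (s \<in> f_ext -` A \<inter> {0..1}) = (s \<in> f_ext -` A)" by eventually_elim simp
  qed (use A measurable_sets[OF f_ext_measurable, of A] in auto)
  also have "\<dots> = emeasure (distr parry_real borel f_ext) A" by (subst emeasure_distr) (use A in auto)
  also have "\<dots> = emeasure parry A" unfolding distr_parry_real using A by (simp add: emeasure_parry)
  finally show "emeasure parry (f -` A \<inter> space parry) = emeasure parry A" .
qed

end

section \<open>Symbolic coding\<close>

context expanding_markov
begin

text \<open>
  The first component is the index of the partition interval, or of the partition point, that
  contains \<open>t\<close>; the second distinguishes the two cases.
\<close>

definition symb :: "real \<Rightarrow> nat \<times> bool" where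
  "symb t = (card {k \<in> {1..m}. x k \<le> t}, t \<in> pts)"

lemma symb_opn:
  assumes "i < m" "t \<in> opn i"
  shows "symb t = (i, False)"
proof -
  have "{k \<in> {1..m}. x k \<le> t} = {1..i}"
  proof (intro set_eqI iffI)
    fix k assume "k \<in> {k \<in> {1..m}. x k \<le> t}"
    then have k: "1 \<le> k" "k \<le> m" "x k < x (Suc i)" using assms(2) by auto
    then have "k < Suc i" using x_less_iff[of k "Suc i"] assms(1) by simp
    then show "k \<in> {1..i}" using k by simp
  next
    fix k assume k: "k \<in> {1..i}"
    then have "x k \<le> x i" using assms(1) by (intro x_le) auto
    then show "k \<in> {k \<in> {1..m}. x k \<le> t}" using k assms by auto
  qed
  then show ?thesis using opn_not_pts[OF assms] by (simp add: symb_def)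
qed

lemma symb_pt:
  assumes "k \<le> m" shows "symb (x k) = (k, True)"
proof -
  have "{l \<in> {1..m}. x l \<le> x k} = {1..k}" using x_le_iff[OF _ assms] assms by auto
  then show ?thesis using assms by (simp add: symb_def)
qed

lemma symb_cases:
  assumes "t \<in> {0..1}"
  obtains i where "i < m" "t \<in> opn i" "symb t = (i, False)" | k where "k \<le> m" "t = x k" "symb t = (k, True)"
proof (cases "t \<in> pts")
  case True
  then show ?thesis using that(2) symb_pt by auto
next
  case False
  then show ?thesis using that(1) symb_opn opn_exists[OF assms] by metis
qed

definition symbols :: "(nat \<times> bool) set" where
  "symbols = {..<m} \<times> {False} \<union> {..m} \<times> {True}"

lemma finite_symbols: "finite symbols" by (simp add: symbols_def)

lemma symb_symbols: "t \<in> {0..1} \<Longrightarrow> symb t \<in> symbols"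
  by (erule symb_cases) (auto simp: symbols_def)

lemma sum_symbols: "(\<Sum>s\<in>symbols. h s) = (\<Sum>i<m. h (i, False)) + (\<Sum>k\<le>m. h (k, True) :: real)"
proof -
  have "(\<Sum>s\<in>symbols. h s) = (\<Sum>s\<in>{..<m} \<times> {False}. h s) + (\<Sum>s\<in>{..m} \<times> {True}. h s)"
    unfolding symbols_def by (rule sum.union_disjoint) auto
  moreover have "(\<Sum>s\<in>J \<times> {b}. h s) = (\<Sum>i\<in>J. h (i, b))" for J b
    by (rule sum.reindex_bij_witness[of _ "\<lambda>i. (i, b)" fst]) auto
  ultimately show ?thesis by simp
qed

lemma symb_eqD:
  assumes "s \<in> {0..1}" "t \<in> {0..1}" "symb s = symb t"
  shows "s = t \<or> (\<exists>i<m. s \<in> opn i \<and> t \<in> opn i)"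
  using assms(3) by (cases rule: symb_cases[OF assms(1)]; cases rule: symb_cases[OF assms(2)]) auto

lemma f_pow_maps: "t \<in> {0..1} \<Longrightarrow> (f ^^ n) t \<in> {0..1}"
  by (induction n) (use f_maps in auto)

text \<open>
  Used with \<open>d\<close> the distance and \<open>r = c\<close>, and with \<open>d\<close> the conformal mass between two points and
  \<open>r = \<rho>\<close>.
\<close>

lemma itinerary_contraction:
  fixes d :: "real \<Rightarrow> real \<Rightarrow> real"
  assumes s: "s \<in> {0..1}" and t: "t \<in> {0..1}" and it: "itinerary f symb n s = itinerary f symb n t"
    and d0: "\<And>s. d s s = 0" and d1: "\<And>s t. s \<in> {0..1} \<Longrightarrow> t \<in> {0..1} \<Longrightarrow> d s t \<le> D" and D: "0 \<le> D"
    and step: "\<And>i s t. i < m \<Longrightarrow> s \<in> opn i \<Longrightarrow> t \<in> opn i \<Longrightarrow> r * d s t \<le> d (f s) (f t)"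
    and r: "r > 0"
  shows "r ^ n * d s t \<le> D"
  using s t it
proof (induction n arbitrary: s t)
  case 0
  then show ?case using d1 by simp
next
  case (Suc n)
  then have it: "symb s = symb t" "itinerary f symb n (f s) = itinerary f symb n (f t)"
    by (auto simp: itinerary_Cons)
  from symb_eqD[OF Suc.prems(1,2) it(1)] show ?case
  proof
    assume "s = t" then show ?thesis using D d0 by simp
  next
    assume "\<exists>i<m. s \<in> opn i \<and> t \<in> opn i"
    then have "r ^ n * (r * d s t) \<le> r ^ n * d (f s) (f t)"
      using step r by (intro mult_left_mono) auto
    also have "\<dots> \<le> D" using Suc.prems f_maps by (intro Suc.IH it) auto
    finally show ?thesis by (simp add: algebra_simps)
  qed
qed

lemma itinerary_diameter:
  assumes "s \<in> {0..1}" "t \<in> {0..1}" "itinerary f symb n s = itinerary f symb n t"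
  shows "c ^ n * \<bar>s - t\<bar> \<le> 1"
proof (rule itinerary_contraction[OF assms])
  fix i s t assume i: "i < m" "s \<in> opn i" "t \<in> opn i"
  then show "c * \<bar>s - t\<bar> \<le> \<bar>f s - f t\<bar>" using g_expand[OF i(1), of s t] f_eq_g[OF i(1)] by auto
qed (use c_gt_1 in auto)

end

locale invariant_measure = expanding_markov +
  fixes M :: "real measure"
  assumes inv: "invariant_borel_prob 0 1 f M"
begin

lemma sets_M: "sets M = sets (restrict_space borel {0..1})"
  using inv by (simp add: invariant_borel_prob_def)

lemma space_M: "space M = {0..1}"
  using sets_eq_imp_space_eq[OF sets_M] by (simp add: space_restrict_space)

lemma in_sets_M: "A \<in> sets M \<longleftrightarrow> A \<in> sets borel \<and> A \<subseteq> {0..1}"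
  by (auto simp: sets_M sets_restrict_space_iff)

sublocale inv_map M f
  using inv unfolding invariant_borel_prob_def invariant_prob_def
  by (intro inv_map.intro inv_map_axioms.intro) auto

lemma simple_symb: "simple_function M symb"
  unfolding simple_function_def
proof (intro conjI ballI)
  show "finite (symb ` space M)"
    using symb_symbols by (intro finite_subset[OF _ finite_symbols]) (auto simp: space_M)
  fix a assume "a \<in> symb ` space M"
  then obtain t where t: "t \<in> {0..1}" and a: "a = symb t" by (auto simp: space_M)
  have "symb -` {a} \<inter> {0..1} \<in> sets borel"
    using t
  proof (cases rule: symb_cases)
    case (1 i)
    have "symb -` {a} \<inter> {0..1} = opn i"
    proof (intro set_eqI iffI)
      fix s assume "s \<in> symb -` {a} \<inter> {0..1}"
      then have s: "s \<in> {0..1}" "symb s = (i, False)" using 1 a by auto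
      from s(1) show "s \<in> opn i" by (cases rule: symb_cases) (use s in auto)
    next
      fix s assume "s \<in> opn i"
      then show "s \<in> symb -` {a} \<inter> {0..1}" using symb_opn[OF 1(1)] 1(3) a cls_subset[OF 1(1)] by auto
    qed
    then show ?thesis by simp
  next
    case (2 k)
    have "symb -` {a} \<inter> {0..1} = {t}"
    proof (intro set_eqI iffI)
      fix s assume "s \<in> symb -` {a} \<inter> {0..1}"
      then have s: "s \<in> {0..1}" "symb s = (k, True)" using 2 a by auto
      from s(1) show "s \<in> {t}" by (cases rule: symb_cases) (use s 2 in auto)
    qed (use a t in auto)
    then show ?thesis by simp
  qed
  then show "symb -` {a} \<inter> space M \<in> sets M" by (simp add: in_sets_M space_M)
qed

lemma id_measurable: "(\<lambda>t. t) \<in> measurable M borel"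
  unfolding measurable_cong_sets[OF sets_M refl] by (rule measurable_restrict_space1) simp

lemma inner_regular_M:
  assumes A: "A \<in> sets M" and e: "e > 0"
  shows "\<exists>K. compact K \<and> K \<subseteq> A \<and> prob (A - K) \<le> e"
proof (rule ccontr)
  assume n: "\<not> ?thesis"
  have Ab: "A \<in> sets borel" "A \<subseteq> {0..1}" using A by (auto simp: in_sets_M)
  have KM: "K \<in> sets M" if "compact K" "K \<subseteq> A" for K
    using that Ab by (auto simp: in_sets_M borel_compact)
  let ?N = "distr M borel (\<lambda>t. t)"
  have N: "emeasure ?N B = emeasure M B" if "B \<in> sets borel" "B \<subseteq> A" for B
    using that Ab by (subst emeasure_distr[OF id_measurable]) (auto simp: space_M intro!: arg_cong[where f="emeasure M"])
  have bound: "emeasure ?N K \<le> ennreal (prob A - e)" and "prob A > e" if K: "K \<in> {K. K \<subseteq> A \<and> compact K}" for K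
  proof -
    have "\<not> prob (A - K) \<le> e" using n K by blast
    then have "e < prob (A - K)" by simp
    moreover have "prob (A - K) = prob A - prob K" using K A KM by (intro finite_measure_Diff) auto
    ultimately have "prob K \<le> prob A - e" "prob A > e" using measure_nonneg[of M K] by linarith+
    then show "emeasure ?N K \<le> ennreal (prob A - e)" "prob A > e"
      using N[of K] K by (auto simp: borel_compact emeasure_eq_measure intro: ennreal_leI)
  qed
  have "emeasure ?N A = (SUP K \<in> {K. K \<subseteq> A \<and> compact K}. emeasure ?N K)"
  proof (rule inner_regular)
    show "emeasure ?N (space ?N) \<noteq> \<infinity>"
      using emeasure_distr[OF id_measurable, of UNIV] by (simp add: emeasure_eq_measure)
  qed (use Ab in auto)
  also have "\<dots> \<le> ennreal (prob A - e)" by (rule SUP_least) (rule bound)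
  finally have "prob A \<le> prob A - e"
    using N[OF Ab(1)] \<open>\<And>K. K \<in> {K. K \<subseteq> A \<and> compact K} \<Longrightarrow> prob A > e\<close>[of "{}"]
    by (simp add: emeasure_eq_measure ennreal_le_iff)
  with e show False by simp
qed

lemma finite_compact_separation:
  fixes K :: "'c \<Rightarrow> real set"
  assumes "finite L" "\<And>a. a \<in> L \<Longrightarrow> compact (K a)" "\<And>a b. a \<in> L \<Longrightarrow> b \<in> L \<Longrightarrow> a \<noteq> b \<Longrightarrow> K a \<inter> K b = {}"
  obtains d where "d > 0" "\<And>a b s t. a \<in> L \<Longrightarrow> b \<in> L \<Longrightarrow> a \<noteq> b \<Longrightarrow> s \<in> K a \<Longrightarrow> t \<in> K b \<Longrightarrow> d \<le> \<bar>s - t\<bar>"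
proof -
  let ?P = "{(a, b) \<in> L \<times> L. a \<noteq> b}"
  have "\<exists>d. d > 0 \<and> (\<forall>s\<in>K (fst z). \<forall>t\<in>K (snd z). d \<le> dist s t)" if "z \<in> ?P" for z
  proof -
    have z: "fst z \<in> L" "snd z \<in> L" "fst z \<noteq> snd z" using that by auto
    have "\<exists>d>0. \<forall>s\<in>K (fst z). \<forall>t\<in>K (snd z). d \<le> dist s t"
      by (intro separate_compact_closed compact_imp_closed assms z)
    then show ?thesis by blast
  qed
  then have "\<forall>z\<in>?P. \<exists>d. d > 0 \<and> (\<forall>s\<in>K (fst z). \<forall>t\<in>K (snd z). d \<le> dist s t)" by (rule ballI)
  from bchoice[OF this] obtain D
    where D: "\<forall>z\<in>?P. D z > 0 \<and> (\<forall>s\<in>K (fst z). \<forall>t\<in>K (snd z). D z \<le> dist s t)" ..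
  have fin: "finite (insert 1 (D ` ?P))"
    using assms(1) by (intro finite.insertI finite_imageI finite_subset[of ?P "L \<times> L"]) auto
  show ?thesis
  proof (rule that[of "Min (insert 1 (D ` ?P))"])
    show "Min (insert 1 (D ` ?P)) > 0" using fin D by (subst Min_gr_iff) auto
    fix a b s t assume ab: "a \<in> L" "b \<in> L" "a \<noteq> b" "s \<in> K a" "t \<in> K b"
    then have z: "(a, b) \<in> ?P" by auto
    have "Min (insert 1 (D ` ?P)) \<le> D (a, b)" using fin z by (intro Min_le) auto
    also have "\<dots> \<le> dist s t" using bspec[OF D z] ab by auto
    finally show "Min (insert 1 (D ` ?P)) \<le> \<bar>s - t\<bar>" by (simp add: dist_real_def)
  qed
qed

text \<open>
  Up to small measure the fibres of \<open>X\<close> are disjoint compact sets. These have positive distance, so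
  long itineraries, whose cylinders have small diameter, tell them apart.
\<close>

lemma generating_symb: "generating symb"
  unfolding generating_def
proof (intro allI impI)
  fix X :: "real \<Rightarrow> real set" and \<eta> :: real
  assume X: "simple_function M X" and \<eta>: "0 < \<eta>"
  define L where "L = X ` space M"
  have L: "finite L" "L \<noteq> {}" using simple_functionD(1)[OF X] by (auto simp: L_def space_M)
  then have cL: "real (card L) > 0" by (simp add: card_gt_0_iff)
  have "\<exists>K. compact K \<and> K \<subseteq> X -` {a} \<inter> space M \<and> prob (X -` {a} \<inter> space M - K) \<le> \<eta> / card L" for a
    using \<eta> cL by (intro inner_regular_M simple_functionD(2)[OF X]) simp
  then obtain K where K: "\<And>a. compact (K a)" "\<And>a. K a \<subseteq> X -` {a} \<inter> space M"
    "\<And>a. prob (X -` {a} \<inter> space M - K a) \<le> \<eta> / card L" by metis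
  obtain d where d: "d > 0" "\<And>a b s t. a \<in> L \<Longrightarrow> b \<in> L \<Longrightarrow> a \<noteq> b \<Longrightarrow> s \<in> K a \<Longrightarrow> t \<in> K b \<Longrightarrow> d \<le> \<bar>s - t\<bar>"
    by (rule finite_compact_separation[of L K]) (use L K in blast)+
  obtain N where N: "1 / d < c ^ N" using real_arch_pow[OF c_gt_1] by blast
  have close: "\<bar>s - t\<bar> < d" if "s \<in> {0..1}" "t \<in> {0..1}" "itinerary f symb N s = itinerary f symb N t" for s t
  proof (rule ccontr)
    assume "\<not> \<bar>s - t\<bar> < d"
    then have "c ^ N * d \<le> c ^ N * \<bar>s - t\<bar>" using c_gt_1 by (intro mult_left_mono) auto
    also have "\<dots> \<le> 1" by (rule itinerary_diameter[OF that])
    finally show False using N d(1) by (simp add: divide_less_eq)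
  qed
  define \<phi> where "\<phi> w = (SOME a. a \<in> L \<and> (\<exists>t\<in>K a. itinerary f symb N t = w))" for w
  have \<phi>: "\<phi> (itinerary f symb N \<omega>) = a" if a: "a \<in> L" "\<omega> \<in> K a" for a \<omega>
  proof -
    let ?b = "\<phi> (itinerary f symb N \<omega>)"
    have "?b \<in> L \<and> (\<exists>t\<in>K ?b. itinerary f symb N t = itinerary f symb N \<omega>)"
      unfolding \<phi>_def by (rule someI[of _ a]) (use a in auto)
    then obtain t where t: "?b \<in> L" "t \<in> K ?b" "itinerary f symb N t = itinerary f symb N \<omega>" by blast
    have "t \<in> {0..1}" "\<omega> \<in> {0..1}"
      using subsetD[OF K(2) t(2)] subsetD[OF K(2) a(2)] by (simp_all add: space_M)
    from close[OF this t(3)] d(2)[OF t(1) a(1) _ t(2) a(2)] show ?thesis by force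
  qed
  have "prob {\<omega>\<in>space M. X \<omega> \<noteq> \<phi> (itinerary f symb N \<omega>)} \<le> prob (\<Union>a\<in>L. X -` {a} \<inter> space M - K a)"
  proof (rule finite_measure_mono)
    show "{\<omega>\<in>space M. X \<omega> \<noteq> \<phi> (itinerary f symb N \<omega>)} \<subseteq> (\<Union>a\<in>L. X -` {a} \<inter> space M - K a)"
    proof
      fix \<omega> assume "\<omega> \<in> {\<omega>\<in>space M. X \<omega> \<noteq> \<phi> (itinerary f symb N \<omega>)}"
      then show "\<omega> \<in> (\<Union>a\<in>L. X -` {a} \<inter> space M - K a)"
        using \<phi>[of "X \<omega>" \<omega>] by (intro UN_I[of "X \<omega>"]) (auto simp: L_def)
    qed
    have "K a \<in> sets M" for a using K(1,2) by (auto simp: in_sets_M borel_compact space_M)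
    then show "(\<Union>a\<in>L. X -` {a} \<inter> space M - K a) \<in> sets M"
      using L(1) by (intro sets.finite_UN sets.Diff simple_functionD(2)[OF X]) auto
  qed
  also have "\<dots> \<le> (\<Sum>a\<in>L. prob (X -` {a} \<inter> space M - K a))"
  proof (rule finite_measure_subadditive_finite[OF L(1)])
    have "K a \<in> sets M" for a using K(1,2) by (auto simp: in_sets_M borel_compact space_M)
    then show "(\<lambda>a. X -` {a} \<inter> space M - K a) ` L \<subseteq> sets M"
      by (intro image_subsetI sets.Diff simple_functionD(2)[OF X])
  qed
  also have "\<dots> \<le> (\<Sum>a\<in>L. \<eta> / card L)" by (intro sum_mono K(3))
  also have "\<dots> = \<eta>" using cL by simp
  finally show "\<exists>N \<phi>. prob {\<omega>\<in>space M. X \<omega> \<noteq> \<phi> (itinerary f symb N \<omega>)} \<le> \<eta>" by blast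
qed

lemma measure_entropy_symb: "measure_entropy M f = ereal (entropy_rate symb)"
  by (rule measure_entropy_generator[OF simple_symb generating_symb])

definition cyl :: "nat \<Rightarrow> (nat \<times> bool) list \<Rightarrow> real" where
  "cyl n w = atom_prob M (itinerary f symb n) w"

text \<open>
  The union of the cylinders of length \<open>n\<close> that meet a compact set decreases to that set. Hence an
  invariant measure is determined by its values on cylinders.
\<close>

lemma prob_compact_limit:
  assumes K: "compact K" "K \<subseteq> {0..1}"
  shows "(\<lambda>n. \<Sum>w\<in>itinerary f symb n ` K. cyl n w) \<longlonglongrightarrow> prob K"
proof -
  let ?I = "itinerary f symb"
  define A where "A n = (?I n) -` (?I n ` K) \<inter> space M" for n
  note I = simple_function_itinerary[OF simple_symb]
  have A: "A n \<in> sets M" for n unfolding A_def by (rule simple_functionD(2)[OF I])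
  have dec: "decseq A"
  proof (unfold decseq_Suc_iff, intro allI subsetI)
    fix n t assume "t \<in> A (Suc n)"
    then obtain s where s: "s \<in> K" "?I (Suc n) t = ?I (Suc n) s" and t: "t \<in> space M" by (auto simp: A_def)
    then have "?I n t = ?I n s" by (auto simp: itinerary_snoc)
    then show "t \<in> A n" using s t by (auto simp: A_def)
  qed
  have "(\<Inter>n. A n) = K"
  proof
    show "K \<subseteq> (\<Inter>n. A n)" using K by (auto simp: A_def space_M)
    show "(\<Inter>n. A n) \<subseteq> K"
    proof
      fix t assume t: "t \<in> (\<Inter>n. A n)"
      have "t \<in> closure K"
        unfolding closure_approachable
      proof (intro allI impI)
        fix e :: real assume e: "e > 0"
        obtain N where N: "1 / e < c ^ N" using real_arch_pow[OF c_gt_1] by blast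
        obtain s where s: "s \<in> K" "?I N t = ?I N s" "t \<in> space M" using t by (auto simp: A_def)
        have "c ^ N * \<bar>t - s\<bar> \<le> 1" using s K by (intro itinerary_diameter) (auto simp: space_M)
        also have "1 < c ^ N * e" using N e by (simp add: divide_less_eq)
        finally have "\<bar>t - s\<bar> < e" using c_gt_1 by simp
        then show "\<exists>y\<in>K. dist y t < e" using s(1) by (intro bexI[of _ s]) (auto simp: dist_real_def)
      qed
      then show "t \<in> K" using K(1) by (simp add: compact_imp_closed closure_closed)
    qed
  qed
  moreover have "(\<lambda>n. prob (A n)) \<longlonglongrightarrow> prob (\<Inter>n. A n)"
    by (rule finite_Lim_measure_decseq) (use A dec in auto)
  moreover have "prob (A n) = (\<Sum>w\<in>?I n ` K. cyl n w)" for n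
  proof -
    have fin: "finite (?I n ` K)"
      using K by (intro finite_subset[OF _ simple_functionD(1)[OF I[of n]]]) (auto simp: space_M)
    have "A n = (\<Union>w\<in>?I n ` K. ?I n -` {w} \<inter> space M)" by (auto simp: A_def)
    then show ?thesis unfolding cyl_def atom_prob_def
      by (simp only:, intro finite_measure_finite_Union[OF fin])
         (use simple_functionD(2)[OF I] in \<open>auto simp: disjoint_family_on_def\<close>)
  qed
  ultimately show ?thesis by simp
qed

end

lemma invariant_measure_eqI:
  assumes "invariant_measure m x f g p q c M" "invariant_measure m x f g p q c M'"
    and cyl: "\<And>n w. n \<ge> 1 \<Longrightarrow> invariant_measure.cyl m x f M n w = invariant_measure.cyl m x f M' n w"
  shows "M = M'"
proof -
  interpret M: invariant_measure m x f g p q c M by fact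
  interpret M': invariant_measure m x f g p q c M' by fact
  have K: "measure M K = measure M' K" if "compact K" "K \<subseteq> {0..1}" for K
  proof (rule LIMSEQ_unique[OF M.prob_compact_limit[OF that]])
    show "(\<lambda>n. \<Sum>w\<in>itinerary f M.symb n ` K. M.cyl n w) \<longlonglongrightarrow> measure M' K"
      by (rule Lim_transform_eventually[OF M'.prob_compact_limit[OF that]])
         (auto simp: cyl eventually_sequentially intro!: exI[of _ 1])
  qed
  let ?N = "distr M borel (\<lambda>t. t)" and ?N' = "distr M' borel (\<lambda>t. t)"
  have "?N = ?N'"
  proof (rule cdf_unique)
    show "real_distribution ?N" by (rule M.real_distribution_distr) (rule M.id_measurable)
    show "real_distribution ?N'" by (rule M'.real_distribution_distr) (rule M'.id_measurable)
    show "cdf ?N = cdf ?N'"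
    proof
      fix t :: real
      have e: "{..t} \<inter> {0..1} = {0..min t 1}" by auto
      show "cdf ?N t = cdf ?N' t"
        unfolding cdf_def using K[of "{0..min t 1}"]
        by (simp add: measure_distr[OF M.id_measurable] measure_distr[OF M'.id_measurable] M.space_M M'.space_M e)
    qed
  qed
  show ?thesis
  proof (rule measure_eqI)
    show "sets M = sets M'" by (simp add: M.sets_M M'.sets_M)
    fix A assume "A \<in> sets M"
    then have A: "A \<in> sets borel" "A \<inter> {0..1} = A" by (auto simp: M.in_sets_M)
    have "emeasure M A = emeasure ?N A" using A by (simp add: emeasure_distr[OF M.id_measurable] M.space_M)
    also have "\<dots> = emeasure M' A" unfolding \<open>?N = ?N'\<close> using A by (simp add: emeasure_distr[OF M'.id_measurable] M'.space_M)
    finally show "emeasure M A = emeasure M' A" .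
  qed
qed

section \<open>The entropy bound and its equality case\<close>

context parry_data
begin

text \<open>
  The Markov kernel of the Parry measure on the open intervals, completed by the deterministic
  dynamics of the partition points.
\<close>

definition trans_prob :: "nat \<times> bool \<Rightarrow> nat \<times> bool \<Rightarrow> real" where
  "trans_prob s s' = (case (s, s') of ((i, b), (j, b')) \<Rightarrow>
     if \<not> b \<and> \<not> b' then branch_matrix p q i j * v j / (\<rho> * v i)
     else if b \<and> b' \<and> x j = f (x i) then 1 else 0)"

definition log_v :: "nat \<times> bool \<Rightarrow> real" where
  "log_v s = (if snd s then 0 else ln (v (fst s)))"

lemma trans_prob_nonneg: "s \<in> symbols \<Longrightarrow> s' \<in> symbols \<Longrightarrow> 0 \<le> trans_prob s s'"
  using v_pos rho_pos by (auto simp: trans_prob_def symbols_def split: prod.splits intro!: divide_nonneg_nonneg mult_nonneg_nonneg less_imp_le)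

lemma sum_trans_prob:
  assumes "s \<in> symbols"
  shows "(\<Sum>s'\<in>symbols. trans_prob s s') \<le> 1"
proof (cases "snd s")
  case False
  then obtain i where s: "s = (i, False)" "i < m" using assms by (auto simp: symbols_def)
  have "(\<Sum>s'\<in>symbols. trans_prob s s') = (\<Sum>j<m. branch_matrix p q i j * v j / (\<rho> * v i))"
    by (simp add: sum_symbols trans_prob_def s)
  also have "\<dots> = 1"
    unfolding sum_divide_distrib[symmetric] v_eigen'[OF s(2)] using rho_pos v_pos[OF s(2)] by simp
  finally show ?thesis by simp
next
  case True
  then obtain k where s: "s = (k, True)" "k \<le> m" using assms by (auto simp: symbols_def)
  obtain l where l: "l \<le> m" "f (x k) = x l" using f_pts[of "x k"] s by auto
  have "(\<Sum>s'\<in>symbols. trans_prob s s') = (\<Sum>j\<le>m. if j = l then 1 else 0)"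
    unfolding sum_symbols using l by (auto simp: trans_prob_def s x_eq_iff intro!: sum.cong)
  then show ?thesis using l by simp
qed

lemma trans_prob_pt:
  assumes "t \<in> pts" shows "trans_prob (symb t) (symb (f t)) = 1"
proof -
  obtain k where k: "k \<le> m" "t = x k" using assms by auto
  obtain l where l: "l \<le> m" "f t = x l" using f_pts[OF assms] by auto
  show ?thesis using k l by (simp add: symb_pt trans_prob_def)
qed

lemma trans_prob_opn:
  assumes t: "t \<in> {0..1}" "t \<notin> pts" "f t \<notin> pts"
  shows "trans_prob (symb t) (symb (f t)) > 0"
    "- ln (trans_prob (symb t) (symb (f t))) = ln \<rho> + log_v (symb t) - log_v (symb (f t))"
proof -
  obtain i where i: "i < m" "t \<in> opn i" using opn_exists[OF t(1,2)] by blast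
  obtain j where j: "j < m" "f t \<in> opn j" using opn_exists[OF f_maps[OF t(1)] t(3)] by blast
  have "f t \<in> {x (p i)..x (q i)}" using g_range[OF i(1), of t] f_eq_g[OF i] i(2) by auto
  from opn_Icc_index[OF j this] p_less_q[OF i(1)] q_le[OF i(1)] have "p i \<le> j" "j < q i" by auto
  then have e: "trans_prob (symb t) (symb (f t)) = v j / (\<rho> * v i)"
    by (simp add: symb_opn[OF i] symb_opn[OF j] trans_prob_def)
  show "trans_prob (symb t) (symb (f t)) > 0" unfolding e using v_pos i j rho_pos by simp
  show "- ln (trans_prob (symb t) (symb (f t))) = ln \<rho> + log_v (symb t) - log_v (symb (f t))"
    unfolding e using v_pos[OF i(1)] v_pos[OF j(1)] rho_pos
    by (simp add: log_v_def symb_opn[OF i] symb_opn[OF j] ln_div ln_mult)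
qed

end

locale parry_measure = parry_data + invariant_measure
begin

lemma pts_sets: "pts \<in> sets M"
  using pts_subset by (auto simp: in_sets_M finite_imp_closed intro!: borel_closed)

text \<open>
  The set of partition points is contained in its preimage, which has the same measure.
\<close>

lemma AE_pts_absorbing: "AE t in M. t \<in> pts \<or> f t \<notin> pts"
proof -
  have S: "f -` pts \<inter> space M \<in> sets M" using pts_sets by measurable
  have "prob (f -` pts \<inter> space M - pts) = prob (f -` pts \<inter> space M) - prob pts"
    by (rule finite_measure_Diff[OF S pts_sets]) (use f_pts pts_subset in \<open>auto simp: space_M\<close>)
  also have "\<dots> = 0" using prob_T_pow[OF pts_sets, of 1] by simp
  finally have "f -` pts \<inter> space M - pts \<in> null_sets M"
    using S pts_sets by (auto simp: null_sets_def emeasure_eq_measure)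
  then have "AE t in M. t \<notin> f -` pts \<inter> space M - pts" by (rule AE_not_in)
  with AE_space show ?thesis by eventually_elim auto
qed

lemma AE_trans_prob:
  "AE t in M. trans_prob (symb t) (symb (f t)) > 0 \<and>
     - ln (trans_prob (symb t) (symb (f t))) = ln \<rho> * indicator (space M - pts) t + log_v (symb t) - log_v (symb (f t))"
  using AE_pts_absorbing AE_space
proof eventually_elim
  case (elim t)
  then have t: "t \<in> {0..1}" by (simp add: space_M)
  show ?case
  proof (cases "t \<in> pts")
    case True
    have "log_v (symb s) = 0" if "s \<in> pts" for s using that by (auto simp: log_v_def symb_pt)
    with True f_pts[OF True] show ?thesis by (simp add: trans_prob_pt)
  next
    case False
    then show ?thesis using elim trans_prob_opn[OF t False] by auto
  qed
qed

lemma simple_symb_pair: "simple_function M (\<lambda>t. (symb t, symb (f t)))"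
  using simple_function_Pair[OF simple_symb simple_function_T_pow[OF simple_symb, of 1]] by simp

text \<open>
  The eigenvector enters as \<open>log_v (symb t) - log_v (symb (f t))\<close>, which has zero expectation by
  invariance; what remains is \<open>ln \<rho>\<close> off the partition points.
\<close>

lemma expectation_trans_prob:
  "expectation (\<lambda>t. - ln (trans_prob (symb t) (symb (f t)))) = ln \<rho> * (1 - prob pts)"
proof -
  have i: "integrable M (\<lambda>t. indicator (space M - pts) t :: real)"
    using pts_sets by (intro integrable_real_indicator) (auto simp: emeasure_eq_measure)
  have l: "integrable M (\<lambda>t. log_v (symb t))" by (rule integrable_simple[OF simple_symb])
  have l': "integrable M (\<lambda>t. log_v (symb (f t)))"
    using integrable_simple[OF simple_function_T_pow[OF simple_symb, of 1], of log_v] by simp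
  have "expectation (\<lambda>t. - ln (trans_prob (symb t) (symb (f t)))) =
    expectation (\<lambda>t. ln \<rho> * indicator (space M - pts) t + log_v (symb t) - log_v (symb (f t)))"
  proof (rule integral_cong_AE)
    show "(\<lambda>t. - ln (trans_prob (symb t) (symb (f t)))) \<in> borel_measurable M"
      using integrable_simple[OF simple_symb_pair, of "\<lambda>z. - ln (trans_prob (fst z) (snd z))"]
      by (intro borel_measurable_integrable) simp
    show "(\<lambda>t. ln \<rho> * indicator (space M - pts) t + log_v (symb t) - log_v (symb (f t))) \<in> borel_measurable M"
      using i l l' by (intro borel_measurable_diff borel_measurable_add borel_measurable_times borel_measurable_const borel_measurable_integrable)
    show "AE t in M. - ln (trans_prob (symb t) (symb (f t))) = ln \<rho> * indicator (space M - pts) t + log_v (symb t) - log_v (symb (f t))"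
      using AE_trans_prob by eventually_elim simp
  qed
  also have "\<dots> = ln \<rho> * prob (space M - pts) + expectation (\<lambda>t. log_v (symb t)) - expectation (\<lambda>t. log_v (symb (f t)))"
    using i l l' pts_sets by (simp add: Bochner_Integration.integral_diff Bochner_Integration.integral_add)
  also have "expectation (\<lambda>t. log_v (symb (f t))) = expectation (\<lambda>t. log_v (symb t))"
    using expectation_T_pow[OF borel_measurable_integrable[OF l], of 1] by simp
  finally show ?thesis using pts_sets by (simp add: prob_compl)
qed

abbreviation "block \<equiv> itinerary f symb"

lemmas simple_block = simple_function_itinerary[OF simple_symb]

lemma
  shows block_increment_le: "block_entropy symb (Suc (Suc n)) \<le> block_entropy symb (Suc n) + ln \<rho> * (1 - prob pts)"
    and block_increment_eq: "block_entropy symb (Suc (Suc n)) = block_entropy symb (Suc n) + ln \<rho> * (1 - prob pts)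
      \<Longrightarrow> s \<in> symbols \<Longrightarrow> w \<noteq> [] \<Longrightarrow> cyl (Suc (Suc n)) (w @ [s]) = cyl (Suc n) w * trans_prob (last w) s"
proof -
  \<comment> \<open>Gibbs' inequality for a block followed by one more symbol, drawn from the Markov kernel\<close>
  let ?B = "block (Suc n)" and ?N = "\<lambda>t. symb ((f ^^ Suc n) t)"
  let ?X = "\<lambda>t. (?B t, ?N t)"
  let ?S = "?B ` space M \<times> symbols"
  note N = simple_function_T_pow[OF simple_symb, of "Suc n"]
  note X = simple_function_Pair[OF simple_block[of "Suc n"] N]
  define q where "q = (\<lambda>(w, s). cyl (Suc n) w * trans_prob (last w) s)"
  have last: "last (?B t) = symb ((f ^^ n) t)" for t by (simp add: itinerary_snoc)
  have lastS: "last w \<in> symbols" if "w \<in> ?B ` space M" for w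
    using that symb_symbols[OF f_pow_maps] by (auto simp: last space_M)
  have S: "finite ?S" "?X ` space M \<subseteq> ?S"
    using simple_functionD(1)[OF simple_block] finite_symbols symb_symbols[OF f_pow_maps[of _ "Suc n"]]
    by (auto simp: space_M simp del: funpow.simps)
  have q0: "0 \<le> q a" if aS: "a \<in> ?S" for a
  proof -
    obtain w s where a: "a = (w, s)" "w \<in> ?B ` space M" "s \<in> symbols" using aS by (cases a) auto
    then show ?thesis
      using trans_prob_nonneg[OF lastS[OF a(2)] a(3)] by (simp add: q_def cyl_def atom_prob_nonneg)
  qed
  have "sum q ?S = (\<Sum>w\<in>?B ` space M. cyl (Suc n) w * (\<Sum>s\<in>symbols. trans_prob (last w) s))"
    unfolding q_def by (simp add: sum.cartesian_product[symmetric] sum_distrib_left)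
  also have "\<dots> \<le> (\<Sum>w\<in>?B ` space M. cyl (Suc n) w * 1)"
    by (intro sum_mono mult_left_mono sum_trans_prob lastS) (auto simp: cyl_def atom_prob_nonneg)
  also have "\<dots> = 1"
    using sum_atom_prob[OF simple_block simple_functionD(1)[OF simple_block], of "Suc n" "Suc n"] by (simp add: cyl_def)
  finally have q1: "sum q ?S \<le> 1" .
  have fS: "(f ^^ Suc n) t = f ((f ^^ n) t)" for t by simp
  have ae: "AE t in M. cyl (Suc n) (?B t) > 0 \<and> trans_prob (symb ((f ^^ n) t)) (?N t) > 0"
    using AE_T_pow[OF AE_trans_prob, of n] AE_atom_prob_pos[OF simple_block[of "Suc n"]]
    by eventually_elim (simp add: cyl_def)
  then have qp: "AE t in M. q (?X t) > 0"
    by eventually_elim (auto simp: q_def last simp del: funpow.simps)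
  have E: "expectation (\<lambda>t. - ln (q (?X t))) = block_entropy symb (Suc n) + ln \<rho> * (1 - prob pts)"
  proof -
    let ?h = "\<lambda>t. - ln (trans_prob (symb t) (symb (f t)))"
    have hi: "integrable M ?h"
      using integrable_simple[OF simple_symb_pair, of "\<lambda>z. - ln (trans_prob (fst z) (snd z))"] by simp
    have hi': "integrable M (\<lambda>t. ?h ((f ^^ n) t))"
      using integrable_simple[OF simple_function_T_pow[OF simple_symb_pair, of n], of "\<lambda>z. - ln (trans_prob (fst z) (snd z))"] by simp
    have bi: "integrable M (\<lambda>t. - ln (cyl (Suc n) (?B t)))" by (rule integrable_simple[OF simple_block])
    have "expectation (\<lambda>t. - ln (q (?X t))) = expectation (\<lambda>t. - ln (cyl (Suc n) (?B t)) + ?h ((f ^^ n) t))"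
    proof (rule integral_cong_AE)
      show "(\<lambda>t. - ln (q (?X t))) \<in> borel_measurable M"
        by (rule borel_measurable_integrable[OF integrable_simple[OF X]])
      show "(\<lambda>t. - ln (cyl (Suc n) (?B t)) + ?h ((f ^^ n) t)) \<in> borel_measurable M"
        using bi hi' by (intro borel_measurable_integrable Bochner_Integration.integrable_add)
      show "AE t in M. - ln (q (?X t)) = - ln (cyl (Suc n) (?B t)) + ?h ((f ^^ n) t)"
        using ae by eventually_elim (simp add: q_def last ln_mult)
    qed
    also have "\<dots> = expectation (\<lambda>t. - ln (cyl (Suc n) (?B t))) + expectation (\<lambda>t. ?h ((f ^^ n) t))"
      by (rule Bochner_Integration.integral_add[OF bi hi'])
    also have "expectation (\<lambda>t. ?h ((f ^^ n) t)) = expectation ?h"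
      by (rule expectation_T_pow) (rule borel_measurable_integrable[OF hi])
    finally show ?thesis unfolding expectation_trans_prob label_entropy_def cyl_def .
  qed
  have HX: "label_entropy M ?X = block_entropy symb (Suc (Suc n))"
    by (rule label_entropy_cong_atoms) (auto simp: itinerary_snoc[of _ _ "Suc n"] simp del: funpow.simps)
  show "block_entropy symb (Suc (Suc n)) \<le> block_entropy symb (Suc n) + ln \<rho> * (1 - prob pts)"
    using gibbs_le[OF X S q0 q1 qp] unfolding HX E .
  assume eq: "block_entropy symb (Suc (Suc n)) = block_entropy symb (Suc n) + ln \<rho> * (1 - prob pts)"
    and s: "s \<in> symbols" and w: "w \<noteq> []"
  have aX: "cyl (Suc (Suc n)) (w @ [s]) = atom_prob M ?X (w, s)"
  proof -
    have "block (Suc (Suc n)) -` {w @ [s]} \<inter> space M = ?X -` {(w, s)} \<inter> space M"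
      by (auto simp: itinerary_snoc[of _ _ "Suc n"] simp del: funpow.simps)
    then show ?thesis by (simp only: cyl_def atom_prob_def)
  qed
  show "cyl (Suc (Suc n)) (w @ [s]) = cyl (Suc n) w * trans_prob (last w) s"
  proof (cases "w \<in> ?B ` space M")
    case True
    then have "q (w, s) = atom_prob M ?X (w, s)"
    proof (intro gibbs_eq[OF X S q0 q1 qp])
      show "label_entropy M ?X = expectation (\<lambda>t. - ln (q (?X t)))" unfolding HX E by (rule eq)
    qed (use s in auto)
    then show ?thesis unfolding aX by (simp add: q_def)
  next
    case False
    then have "cyl (Suc n) w = 0" unfolding cyl_def by (rule atom_prob_outside)
    moreover have "atom_prob M ?X (w, s) = 0" by (rule atom_prob_outside) (use False in auto)
    ultimately show ?thesis unfolding aX by simp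
  qed
qed

lemma entropy_rate_le: "entropy_rate symb \<le> ln \<rho> * (1 - prob pts)"
  using entropy_rate_le_increment[OF simple_symb, of "Suc 0"] block_increment_le[of 0] by simp

lemma measure_entropy_le_rho: "measure_entropy M f \<le> ereal (ln \<rho>)"
proof -
  have "ln \<rho> * (1 - prob pts) \<le> ln \<rho> * 1" using rho_gt_1 by (intro mult_left_mono) auto
  then show ?thesis unfolding measure_entropy_symb using entropy_rate_le by simp
qed

context
  assumes max: "measure_entropy M f = ereal (ln \<rho>)"
begin

lemma max_pts_null: "prob pts = 0"
proof -
  have "ln \<rho> \<le> ln \<rho> * (1 - prob pts)" using max entropy_rate_le by (simp add: measure_entropy_symb)
  then have "ln \<rho> * prob pts \<le> 0" by (simp add: algebra_simps)
  then show ?thesis using rho_gt_1 measure_nonneg[of M pts] by (simp add: mult_le_0_iff)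
qed

lemma max_cyl_snoc:
  assumes "s \<in> symbols" "w \<noteq> []"
  shows "cyl (Suc (Suc n)) (w @ [s]) = cyl (Suc n) w * trans_prob (last w) s"
proof (rule block_increment_eq[OF _ assms])
  have "ln \<rho> \<le> block_entropy symb (Suc (Suc n)) - block_entropy symb (Suc n)"
    using entropy_rate_le_increment[OF simple_symb, of "Suc n"] max by (simp add: measure_entropy_symb)
  then show "block_entropy symb (Suc (Suc n)) = block_entropy symb (Suc n) + ln \<rho> * (1 - prob pts)"
    using block_increment_le[of n] max_pts_null by simp
qed

lemma cyl_1: "cyl (Suc 0) [s] = atom_prob M symb s"
proof -
  have "block (Suc 0) -` {[s]} = symb -` {s}" by (auto simp: itinerary_def)
  then show ?thesis by (simp add: cyl_def atom_prob_def)
qed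

lemma max_symbol_pt: "k \<le> m \<Longrightarrow> atom_prob M symb (k, True) = 0"
proof -
  have "atom_prob M symb (k, True) \<le> prob pts"
    unfolding atom_prob_def by (rule finite_measure_mono[OF _ pts_sets]) (auto simp: symb_def)
  then show ?thesis using max_pts_null atom_prob_nonneg[of symb "(k, True)"] by simp
qed

text \<open>
  Equality in Gibbs' inequality turns stationarity of the one-symbol law \<open>\<pi>\<close> into the left
  eigenvector equation for \<open>\<pi> i / v i\<close>, whose solution is unique up to a factor.
\<close>

lemma max_symbol_opn:
  assumes "j < m"
  shows "atom_prob M symb (j, False) = u j * v j"
proof -
  define \<pi> where "\<pi> i = atom_prob M symb (i, False)" for i
  have S: "finite symbols" "symb ` space M \<subseteq> symbols" using finite_symbols symb_symbols by (auto simp: space_M)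
  have st: "\<pi> j = (\<Sum>i<m. \<pi> i * (branch_matrix p q i j * v j / (\<rho> * v i)))" if j: "j < m" for j
  proof -
    let ?s = "(j, False)"
    have s: "?s \<in> symbols" using j by (simp add: symbols_def)
    have "\<pi> j = atom_prob M (\<lambda>t. symb (f t)) ?s"
      using atom_prob_T_pow[OF simple_symb, of 1 ?s] by (simp add: \<pi>_def)
    also have "\<dots> = (\<Sum>a\<in>symb ` space M. atom_prob M (\<lambda>t. (symb t, symb (f t))) (a, ?s))"
      using atom_prob_marginal[OF simple_symb simple_function_T_pow[OF simple_symb, of 1], of ?s] by simp
    also have "\<dots> = (\<Sum>a\<in>symbols. atom_prob M (\<lambda>t. (symb t, symb (f t))) (a, ?s))"
      by (rule sum.mono_neutral_left[OF S]) (auto intro!: atom_prob_outside)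
    also have "\<dots> = (\<Sum>a\<in>symbols. atom_prob M symb a * trans_prob a ?s)"
    proof (rule sum.cong[OF refl])
      fix a
      have "block (Suc (Suc 0)) -` {[a] @ [?s]} = (\<lambda>t. (symb t, symb (f t))) -` {(a, ?s)}"
        by (auto simp: itinerary_def)
      then have "atom_prob M (\<lambda>t. (symb t, symb (f t))) (a, ?s) = cyl (Suc (Suc 0)) ([a] @ [?s])"
        by (simp only: cyl_def atom_prob_def)
      also have "\<dots> = cyl (Suc 0) [a] * trans_prob (last [a]) ?s" by (rule max_cyl_snoc[OF s]) simp
      finally show "atom_prob M (\<lambda>t. (symb t, symb (f t))) (a, ?s) = atom_prob M symb a * trans_prob a ?s"
        by (simp add: cyl_1)
    qed
    also have "\<dots> = (\<Sum>i<m. \<pi> i * (branch_matrix p q i j * v j / (\<rho> * v i)))"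
      unfolding sum_symbols by (simp add: max_symbol_pt \<pi>_def trans_prob_def)
    finally show ?thesis .
  qed
  have tot: "(\<Sum>i<m. \<pi> i) = 1"
    using sum_atom_prob[OF simple_symb S] by (simp add: sum_symbols max_symbol_pt \<pi>_def)
  have "\<exists>t. \<forall>i<m. \<pi> i / v i = t * u i"
  proof (rule left_eigenvector_unique[OF irreducible m_pos u_pos])
    fix j assume j: "j < m"
    show "(\<Sum>i<m. u i * branch_matrix p q i j) = \<rho> * u j" by (rule u_eigen[OF j])
    have "\<rho> * (\<pi> j / v j) = (\<Sum>i<m. \<rho> * (\<pi> i * (branch_matrix p q i j * v j / (\<rho> * v i)) / v j))"
      by (subst st[OF j]) (simp add: sum_distrib_left sum_divide_distrib)
    also have "\<dots> = (\<Sum>i<m. \<pi> i / v i * branch_matrix p q i j)"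
      using rho_pos v_pos[OF j] by (intro sum.cong) auto
    finally show "(\<Sum>i<m. \<pi> i / v i * branch_matrix p q i j) = \<rho> * (\<pi> j / v j)" ..
  qed
  then obtain t where t: "\<And>i. i < m \<Longrightarrow> \<pi> i / v i = t * u i" by blast
  then have pi: "\<pi> i = t * (u i * v i)" if "i < m" for i
    using t[OF that] v_pos[OF that] by (simp add: field_simps)
  have "1 = t * (\<Sum>i<m. u i * v i)" unfolding tot[symmetric] sum_distrib_left using pi by (intro sum.cong) auto
  then have "t = 1" by (simp add: uv)
  then show ?thesis using pi[OF assms] by (simp add: \<pi>_def)
qed

end

end

text \<open>
  Both measures give a single symbol the same probability and extend words by the same kernel, so
  they agree on all cylinders.
\<close>

lemma (in parry_data) max_entropy_unique:
  assumes M: "parry_measure m x f g p q c \<rho> u v M" "measure_entropy M f = ereal (ln \<rho>)"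
    and M': "parry_measure m x f g p q c \<rho> u v M'" "measure_entropy M' f = ereal (ln \<rho>)"
  shows "M = M'"
proof -
  interpret M: parry_measure m x f g p q c \<rho> u v M by fact
  interpret M': parry_measure m x f g p q c \<rho> u v M' by fact
  have out: "M.cyl n w = 0" "M'.cyl n w = 0" if "\<not> (length w = n \<and> set w \<subseteq> symbols)" for n w
  proof -
    have "itinerary f symb n t \<noteq> w" if "t \<in> {0..1}" for t
    proof
      assume "itinerary f symb n t = w"
      then have "length w = n \<and> set w \<subseteq> symbols"
        using symb_symbols[OF f_pow_maps[OF that]] by (auto simp: itinerary_def)
      with \<open>\<not> (length w = n \<and> set w \<subseteq> symbols)\<close> show False by simp
    qed
    then have w: "w \<notin> itinerary f symb n ` {0..1}" by blast
    show "M.cyl n w = 0" unfolding M.cyl_def by (rule M.atom_prob_outside) (use w in \<open>simp only: M.space_M not_False_eq_True\<close>)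
    show "M'.cyl n w = 0" unfolding M'.cyl_def by (rule M'.atom_prob_outside) (use w in \<open>simp only: M'.space_M not_False_eq_True\<close>)
  qed
  have one: "M.cyl (Suc 0) [s] = M'.cyl (Suc 0) [s]" if "s \<in> symbols" for s
    using that unfolding M.cyl_1[OF M(2)] M'.cyl_1[OF M'(2)] symbols_def
    by (auto simp: M.max_symbol_pt[OF M(2)] M'.max_symbol_pt[OF M'(2)] M.max_symbol_opn[OF M(2)] M'.max_symbol_opn[OF M'(2)])
  have cyl: "M.cyl (Suc n) w = M'.cyl (Suc n) w" for n w
  proof (induction n arbitrary: w)
    case 0
    show ?case
    proof (cases "length w = Suc 0 \<and> set w \<subseteq> symbols")
      case True
      then obtain s where "w = [s]" by (auto simp: length_Suc_conv)
      then show ?thesis using one True by simp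
    qed (use out in auto)
  next
    case (Suc n)
    show ?case
    proof (cases "length w = Suc (Suc n) \<and> set w \<subseteq> symbols")
      case True
      then obtain w' s where w: "w = w' @ [s]" by (metis append_butlast_last_id length_0_conv nat.simps(3))
      then have "s \<in> symbols" "w' \<noteq> []" using True by auto
      then show ?thesis unfolding w M.max_cyl_snoc[OF M(2) \<open>s \<in> symbols\<close> \<open>w' \<noteq> []\<close>]
        M'.max_cyl_snoc[OF M'(2) \<open>s \<in> symbols\<close> \<open>w' \<noteq> []\<close>] Suc.IH by simp
    qed (use out in auto)
  qed
  show ?thesis
  proof (rule invariant_measure_eqI[OF M.invariant_measure_axioms M'.invariant_measure_axioms])
    show "M.cyl n w = M'.cyl n w" if "n \<ge> 1" for n w
      using cyl[of "n - 1"] that by simp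
  qed
qed

section \<open>Maximal entropy of the Parry measure\<close>

context parry_data
begin

lemma parry_measureI: "invariant_borel_prob 0 1 f M \<Longrightarrow> parry_measure m x f g p q c \<rho> u v M"
  by (intro parry_measure.intro parry_data_axioms invariant_measure.intro expanding_markov_axioms
      invariant_measure_axioms.intro)

lemma vsum_nonneg: "0 \<le> vsum m"
  unfolding vsum_def by (rule sum_nonneg) (use v_pos in \<open>auto intro: less_imp_le\<close>)

lemma sum_u_nonneg: "0 \<le> (\<Sum>i<m. u i)"
  by (rule sum_nonneg) (use u_pos in \<open>auto intro: less_imp_le\<close>)

lemma itinerary_F_close:
  assumes "s \<in> {0..1}" "t \<in> {0..1}" "itinerary f symb n s = itinerary f symb n t"
  shows "\<rho> ^ n * \<bar>F s - F t\<bar> \<le> vsum m"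
proof (rule itinerary_contraction[OF assms])
  show "\<bar>F s - F t\<bar> \<le> vsum m" if "s \<in> {0..1}" "t \<in> {0..1}" for s t
    using cdf_class_range[OF F(1) that(1)] cdf_class_range[OF F(1) that(2)] by auto
  show "0 \<le> vsum m" by (rule vsum_nonneg)
  fix i s t assume i: "i < m" "s \<in> opn i" "t \<in> opn i"
  then have "\<bar>F t - F s\<bar> = \<bar>F (g i t) - F (g i s)\<bar> / \<rho>" by (intro F_conformal) auto
  then show "\<rho> * \<bar>F s - F t\<bar> \<le> \<bar>F (f s) - F (f t)\<bar>"
    using i f_eq_g[OF i(1)] rho_pos by (simp add: abs_minus_commute)
qed (use rho_pos in auto)

lemma parry_cdf_lipschitz:
  assumes ab: "a \<in> {0..1}" "b \<in> {0..1}" "a \<le> b"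
  shows "parry_cdf b - parry_cdf a \<le> (\<Sum>i<m. u i) * (F b - F a)"
proof -
  let ?cl = "\<lambda>i t. clamp i (Suc i) t"
  have U: "u i \<le> (\<Sum>i<m. u i)" if "i < m" for i
    using member_le_sum[of i "{..<m}" u] that u_pos by (auto intro: less_imp_le)
  have tel: "(\<Sum>i<m. F (?cl i t) - F (x i)) = F t" if "t \<in> {0..1}" for t
    using telescope_clamp[of 0 m F t] that by (simp add: x_0 x_m F_0 atLeast0LessThan)
  have "parry_cdf b - parry_cdf a = (\<Sum>i<m. u i * (F (?cl i b) - F (?cl i a)))"
    unfolding parry_cdf_def sum_subtractf[symmetric] by (simp add: algebra_simps)
  also have "\<dots> \<le> (\<Sum>i<m. (\<Sum>i<m. u i) * (F (?cl i b) - F (?cl i a)))"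
  proof (rule sum_mono)
    fix i assume "i \<in> {..<m}"
    then have i: "i < m" by simp
    have "F (?cl i a) \<le> F (?cl i b)" using clamp_mem[OF i] ab by (intro mono_onD[OF F_mono]) auto
    then show "u i * (F (?cl i b) - F (?cl i a)) \<le> (\<Sum>i<m. u i) * (F (?cl i b) - F (?cl i a))"
      using U[OF i] by (intro mult_right_mono) auto
  qed
  also have "\<dots> = (\<Sum>i<m. u i) * (\<Sum>i<m. (F (?cl i b) - F (x i)) - (F (?cl i a) - F (x i)))"
    by (simp add: sum_distrib_left)
  also have "(\<Sum>i<m. (F (?cl i b) - F (x i)) - (F (?cl i a) - F (x i))) = F b - F a"
    by (subst sum_subtractf) (simp only: tel[OF ab(1)] tel[OF ab(2)])
  finally show ?thesis .
qed

text \<open>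
  The set lies between its infimum and its supremum, and by continuity \<open>F\<close> oscillates between these
  two points no more than on the set.
\<close>

lemma parry_small_oscillation:
  assumes C: "C \<in> sets borel" "C \<subseteq> {0..1}" and k: "0 \<le> k"
    and osc: "\<And>s t. s \<in> C \<Longrightarrow> t \<in> C \<Longrightarrow> \<bar>F s - F t\<bar> \<le> k"
  shows "measure parry_real C \<le> (\<Sum>i<m. u i) * k"
proof (cases "C = {}")
  case True
  then show ?thesis using k sum_u_nonneg by simp
next
  case False
  have cl01: "closure C \<subseteq> {0..1}" using C(2) by (rule closure_minimal) simp
  have osc1: "F t - F s \<le> k" if "s \<in> closure C" "t \<in> C" for s t
  proof -
    have "closed {s \<in> {0..1}. F t - F s \<le> k}"
      by (intro continuous_on_closed_Collect_le continuous_intros F_cont)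
    moreover have "C \<subseteq> {s \<in> {0..1}. F t - F s \<le> k}"
      using C(2) osc[OF that(2)] by (auto simp: abs_le_iff)
    ultimately show ?thesis using closure_minimal that(1) by blast
  qed
  have osc2: "F t - F s \<le> k" if "s \<in> closure C" "t \<in> closure C" for s t
  proof -
    have "closed {t \<in> {0..1}. F t - F s \<le> k}"
      by (intro continuous_on_closed_Collect_le continuous_intros F_cont)
    moreover have "C \<subseteq> {t \<in> {0..1}. F t - F s \<le> k}" using C(2) osc1[OF that(1)] by auto
    ultimately show ?thesis using closure_minimal that(2) by blast
  qed
  have below: "bdd_below C" by (rule bdd_belowI[of _ 0]) (use C(2) in auto)
  have above: "bdd_above C" by (rule bdd_aboveI[of _ 1]) (use C(2) in auto)
  let ?a = "Inf C" and ?b = "Sup C"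
  have e: "?a \<in> closure C" "?b \<in> closure C"
    using closure_contains_Inf[OF False below] closure_contains_Sup[OF False above] by auto
  have ab: "?a \<le> ?b" by (rule cInf_le_cSup[OF False above below])
  have "measure parry_real C \<le> measure parry_real {?a..?b}"
    by (rule pr.finite_measure_mono) (use cInf_lower[OF _ below] cSup_upper[OF _ above] in auto)
  also have "\<dots> = parry_cdf ?b - parry_cdf ?a" by (rule parry_real_between[OF ab]) auto
  also have "\<dots> \<le> (\<Sum>i<m. u i) * (F ?b - F ?a)" using e cl01 ab by (intro parry_cdf_lipschitz) auto
  also have "\<dots> \<le> (\<Sum>i<m. u i) * k"
    using osc2[OF e] u_pos by (intro mult_left_mono sum_nonneg) (auto intro: less_imp_le)
  finally show ?thesis .
qed

lemma measure_parry: "A \<subseteq> {0..1} \<Longrightarrow> measure parry A = measure parry_real A"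
  by (simp add: measure_def emeasure_parry)

text \<open>
  The conformal mass between two points with the same itinerary of length \<open>n\<close> is at most
  \<open>vsum m / \<rho> ^ n\<close>. So the information of each cylinder is at least \<open>n * ln \<rho>\<close> up to a constant.
\<close>

lemma measure_entropy_parry: "measure_entropy parry f = ereal (ln \<rho>)"
proof (rule antisym)
  interpret P: parry_measure m x f g p q c \<rho> u v parry by (rule parry_measureI[OF invariant_parry])
  show "measure_entropy parry f \<le> ereal (ln \<rho>)" by (rule P.measure_entropy_le_rho)
  define D where "D = (\<Sum>i<m. u i) * vsum m"
  have Dpos: "D > 0" unfolding D_def vsum_def
    using m_pos u_pos v_pos by (intro mult_pos_pos sum_pos) auto
  have atom: "P.cyl n (P.block n t) \<le> D / \<rho> ^ n" if "t \<in> {0..1}" for n t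
  proof -
    let ?C = "P.block n -` {P.block n t} \<inter> space parry"
    have C: "?C \<in> sets borel" "?C \<subseteq> {0..1}"
      using simple_functionD(2)[OF P.simple_block, of n "{P.block n t}"] by (auto simp: P.in_sets_M)
    have "measure parry_real ?C \<le> (\<Sum>i<m. u i) * (vsum m / \<rho> ^ n)"
    proof (rule parry_small_oscillation[OF C])
      show "0 \<le> vsum m / \<rho> ^ n" using rho_pos vsum_nonneg by simp
      fix a b assume ab: "a \<in> ?C" "b \<in> ?C"
      then have "\<rho> ^ n * \<bar>F a - F b\<bar> \<le> vsum m"
        by (intro itinerary_F_close) (auto simp: space_parry)
      then show "\<bar>F a - F b\<bar> \<le> vsum m / \<rho> ^ n" using rho_pos by (simp add: field_simps)
    qed
    then show ?thesis unfolding P.cyl_def atom_prob_def measure_parry[OF C(2)] by (simp add: D_def)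
  qed
  have low: "n * ln \<rho> - ln D \<le> P.block_entropy symb n" for n
  proof -
    have "P.expectation (\<lambda>t. n * ln \<rho> - ln D) \<le> P.expectation (\<lambda>t. - ln (P.cyl n (P.block n t)))"
    proof (rule integral_mono_AE)
      show "integrable parry (\<lambda>t. - ln (P.cyl n (P.block n t)))" by (rule P.integrable_simple[OF P.simple_block])
      show "AE t in parry. n * ln \<rho> - ln D \<le> - ln (P.cyl n (P.block n t))"
        using P.AE_atom_prob_pos[OF P.simple_block[of n]] AE_space
      proof eventually_elim
        case (elim t)
        then have pos: "P.cyl n (P.block n t) > 0" "t \<in> {0..1}" by (auto simp: P.cyl_def space_parry)
        then have "ln (P.cyl n (P.block n t)) \<le> ln (D / \<rho> ^ n)"
          using atom[OF pos(2), of n] by (subst ln_le_cancel_iff) (use Dpos rho_pos in auto)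
        also have "\<dots> = ln D - n * ln \<rho>" using Dpos rho_pos by (simp add: ln_div ln_realpow)
        finally show ?case by simp
      qed
    qed simp
    then show ?thesis by (simp add: label_entropy_def P.cyl_def P.prob_space)
  qed
  have "ln \<rho> \<le> P.entropy_rate symb"
  proof (rule LIMSEQ_le[OF _ P.entropy_rate_tendsto[OF P.simple_symb]])
    have "(\<lambda>n. ln \<rho> - ln D / real n) \<longlonglongrightarrow> ln \<rho> - 0" by (intro tendsto_diff tendsto_const lim_const_over_n)
    then show "(\<lambda>n. ln \<rho> - ln D / real n) \<longlonglongrightarrow> ln \<rho>" by simp
    have "ln \<rho> - ln D / real n \<le> P.block_entropy symb n / real n" if "n \<ge> 1" for n
      using divide_right_mono[OF low[of n], of n] that by (simp add: diff_divide_distrib)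
    then show "\<exists>N. \<forall>n\<ge>N. ln \<rho> - ln D / real n \<le> P.block_entropy symb n / real n" by blast
  qed
  then show "ereal (ln \<rho>) \<le> measure_entropy parry f" unfolding P.measure_entropy_symb by simp
qed

lemma topological_entropy_eq: "topological_entropy 0 1 f = ereal (ln \<rho>)"
  unfolding topological_entropy_def
proof (rule antisym)
  show "(SUP M\<in>{M. invariant_borel_prob 0 1 f M}. measure_entropy M f) \<le> ereal (ln \<rho>)"
    by (rule SUP_least) (use parry_measureI parry_measure.measure_entropy_le_rho in blast)
  show "ereal (ln \<rho>) \<le> (SUP M\<in>{M. invariant_borel_prob 0 1 f M}. measure_entropy M f)"
    unfolding measure_entropy_parry[symmetric] by (rule SUP_upper) (simp add: invariant_parry)
qed

lemma max_entropy_measure_iff: "max_entropy_measure 0 1 f M \<longleftrightarrow> M = parry"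
  unfolding max_entropy_measure_def topological_entropy_eq
  using invariant_parry measure_entropy_parry max_entropy_unique parry_measureI by metis

end

section \<open>Integrability of the logarithm at the fixed point\<close>

locale power_law_at_0 = parry_data +
  fixes \<delta> \<alpha> :: real
  assumes \<delta>: "\<delta> > 0" and \<alpha>: "\<alpha> > 1" and f_power: "\<And>t. t \<in> {0..\<delta>} \<Longrightarrow> f t = t powr (1 / \<alpha>)"
begin

definition \<epsilon> :: real where "\<epsilon> = min \<delta> (x 1) / 2"

lemma x_1: "x 1 > 0" "x 1 \<le> 1"
  using x_less_Suc[OF m_pos] x_mem[of 1] m_pos by (auto simp: x_0)

lemma \<epsilon>: "0 < \<epsilon>" "\<epsilon> < \<delta>" "\<epsilon> < x 1" "\<epsilon> < 1"
  using \<delta> x_1 by (auto simp: \<epsilon>_def min_def)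

lemma g_0: "t \<in> {0<..\<epsilon>} \<Longrightarrow> g 0 t = t powr (1 / \<alpha>)"
  using f_eq_g[OF m_pos, of t] f_power[of t] \<epsilon> by (auto simp: x_0)

lemma g_0_0: "g 0 0 = 0"
proof -
  have "(g 0 \<longlongrightarrow> g 0 0) (at 0 within {0..x 1})"
    using g_cont[OF m_pos] x_1 by (auto simp: continuous_on x_0)
  then have l: "(g 0 \<longlongrightarrow> g 0 0) (at_right 0)" using x_1 by (simp add: at_within_Icc_at_right)
  have "((\<lambda>t. t powr (1 / \<alpha>)) \<longlongrightarrow> 0) (at_right 0)"
    using tendsto_powr2[OF tendsto_ident_at tendsto_const, of 0 "{0<..}" "1 / \<alpha>"] \<alpha>
    by (auto simp: eventually_at_filter)
  moreover have "\<forall>\<^sub>F t in at_right 0. t powr (1 / \<alpha>) = g 0 t"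
    using eventually_at_right_real[OF \<epsilon>(1)] by eventually_elim (simp add: g_0)
  ultimately have "(g 0 \<longlongrightarrow> 0) (at_right 0)" by (rule Lim_transform_eventually)
  with l show ?thesis by (rule tendsto_unique[OF trivial_limit_at_right_real])
qed

lemma F_nonneg: "t \<in> {0..1} \<Longrightarrow> 0 \<le> F t"
  using cdf_class_range[OF F(1)] by auto

lemma F_g_0: 
  assumes "t \<in> cls 0" shows "F (g 0 t) = \<rho> * F t"
proof -
  have e: "x 0 \<in> cls 0" using x_less_Suc[OF m_pos] by simp
  have "t \<in> {0..1}" using cls_subset[OF m_pos] assms by blast
  then have "0 \<le> F t" "0 \<le> F (g 0 t)" using F_nonneg g_range01[OF m_pos assms] by auto
  moreover have "\<bar>F t\<bar> = \<bar>F (g 0 t)\<bar> / \<rho>"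
    using F_conformal[OF m_pos e assms] by (simp add: x_0 g_0_0 F_0)
  ultimately show ?thesis using rho_pos by (simp add: field_simps)
qed

text \<open>
  At the largest zero \<open>t\<close> of \<open>F\<close> in the first interval, conformality shows that \<open>g 0 t\<close> is a zero
  too. It lies in the first interval, because \<open>F\<close> is positive from \<open>x 1\<close> on, and expansion moves it to the
  right of \<open>t\<close> unless \<open>t = 0\<close>.
\<close>

lemma F_eps_pos: "F \<epsilon> > 0"
proof (rule ccontr)
  assume n: "\<not> F \<epsilon> > 0"
  define Z where "Z = {t \<in> cls 0. F t \<le> 0}"
  have c01: "cls 0 \<subseteq> {0..1}" by (rule cls_subset[OF m_pos])
  have "closed Z" unfolding Z_def
    by (intro continuous_on_closed_Collect_le continuous_on_subset[OF F_cont c01] continuous_intros)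
  moreover have "Z \<subseteq> cls 0" by (auto simp: Z_def)
  then have "bounded Z" by (rule bounded_subset[OF bounded_closed_interval])
  ultimately have cZ: "compact Z" by (simp add: compact_eq_bounded_closed)
  have eZ: "\<epsilon> \<in> Z" using n \<epsilon> by (auto simp: Z_def x_0)
  obtain t where t: "t \<in> Z" "\<And>s. s \<in> Z \<Longrightarrow> s \<le> t" using compact_attains_sup[OF cZ] eZ by blast
  have tc: "t \<in> cls 0" and t0: "t > 0" using t(1) t(2)[OF eZ] \<epsilon> by (auto simp: Z_def)
  have "F t = 0" using t(1) F_nonneg[of t] c01 by (auto simp: Z_def)
  then have Fg: "F (g 0 t) = 0" using F_g_0[OF tc] by simp
  have r: "g 0 t \<in> {0..1}" by (rule g_range01[OF m_pos tc])
  have "g 0 t < x 1"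
  proof (rule ccontr)
    assume "\<not> g 0 t < x 1"
    then have "F (x 1) \<le> F (g 0 t)" using r x_1 by (intro mono_onD[OF F_mono]) auto
    moreover have "F (x 1) = v 0" using F_pts[of 1] m_pos by (simp add: vsum_def)
    ultimately show False using Fg v_pos[OF m_pos] by simp
  qed
  then have "g 0 t \<in> Z" using r Fg by (auto simp: Z_def x_0)
  then have "g 0 t \<le> t" by (rule t(2))
  moreover have "c * \<bar>t - 0\<bar> \<le> \<bar>g 0 t - g 0 0\<bar>"
    using tc x_less_Suc[OF m_pos] by (intro g_expand[OF m_pos]) (auto simp: x_0)
  then have "c * t \<le> g 0 t" using t0 r by (simp add: g_0_0)
  ultimately have "c * t \<le> 1 * t" by simp
  then show False using t0 c_gt_1 by simp
qed

definition L :: real where "L = - ln \<epsilon>"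

text \<open>
  The preimages of \<open>\<epsilon>\<close> under the iterates of the first branch, that is \<open>\<epsilon>\<close> raised to the power \<open>\<alpha> ^ n\<close>.
\<close>

definition ladder :: "nat \<Rightarrow> real" where "ladder n = exp (- L * \<alpha> ^ n)"

lemma L_pos: "L > 0" using \<epsilon> by (simp add: L_def)

lemma ladder_0: "ladder 0 = \<epsilon>" using \<epsilon> by (simp add: ladder_def L_def)

lemma ladder_Suc_less: "ladder (Suc n) < ladder n"
  using L_pos \<alpha> by (simp add: ladder_def)

lemma ladder_le: "ladder n \<le> \<epsilon>"
proof -
  have "decseq ladder" by (rule decseq_SucI) (rule less_imp_le[OF ladder_Suc_less])
  then show ?thesis using decseqD[of ladder 0 n] by (simp add: ladder_0)
qed

lemma ladder_cls: "ladder n \<in> cls 0"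
  using ladder_le[of n] \<epsilon> by (auto simp: ladder_def x_0)

text \<open>
  The first branch maps each point of the ladder to the previous one.
\<close>

lemma F_ladder: "F (ladder n) = F \<epsilon> / \<rho> ^ n"
proof (induction n)
  case 0
  then show ?case by (simp add: ladder_0)
next
  case (Suc n)
  have "g 0 (ladder (Suc n)) = ladder (Suc n) powr (1 / \<alpha>)"
    by (rule g_0) (use ladder_le[of "Suc n"] in \<open>simp add: ladder_def\<close>)
  also have "\<dots> = ladder n" using \<alpha> by (simp add: ladder_def powr_def)
  finally have "F (ladder n) = \<rho> * F (ladder (Suc n))" using F_g_0[OF ladder_cls[of "Suc n"]] by simp
  then show ?case using Suc rho_pos by (simp add: field_simps)
qed

definition rung :: "nat \<Rightarrow> real set" where "rung n = {ladder (Suc n)<..ladder n}"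

definition rung_mass :: real where "rung_mass = u 0 * F \<epsilon> * (1 - 1 / \<rho>)"

lemma rung_mass_pos: "rung_mass > 0"
  using u_pos[OF m_pos] F_eps_pos rho_gt_1 by (simp add: rung_mass_def)

lemma emeasure_rung: "emeasure parry_real (rung n) = ennreal (rung_mass / \<rho> ^ n)"
proof -
  have "measure parry_real (rung n) = parry_cdf (ladder n) - parry_cdf (ladder (Suc n))"
    unfolding rung_def by (rule parry_real_Ioc) (rule less_imp_le[OF ladder_Suc_less])
  also have "\<dots> = u 0 * (F (ladder n) - F (ladder (Suc n)))"
    by (rule parry_cdf_diff[OF m_pos ladder_cls ladder_cls])
  also have "\<dots> = rung_mass / \<rho> ^ n" using rho_pos by (simp add: F_ladder rung_mass_def field_simps)
  finally show ?thesis by (simp add: pr.emeasure_eq_measure)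
qed

lemma disjoint_rungs: "disjoint_family rung"
proof -
  have "decseq ladder" by (rule decseq_SucI) (rule less_imp_le[OF ladder_Suc_less])
  then have "rung k \<inter> rung n = {}" if "k < n" for k n
    using decseqD[of ladder "Suc k" n] that by (auto simp: rung_def)
  then show ?thesis unfolding disjoint_family_on_def by (metis inf_commute linorder_neqE_nat)
qed

lemma rung_exists:
  assumes "0 < t" "t \<le> \<epsilon>"
  obtains n where "t \<in> rung n"
proof -
  obtain N where "- ln t / L < \<alpha> ^ N" using real_arch_pow[OF \<alpha>] by blast
  then have "- L * \<alpha> ^ N < ln t" using L_pos by (simp add: field_simps)
  then have N: "ladder N < t" unfolding ladder_def using assms(1) by (metis exp_less_mono exp_ln)
  define k where "k = (LEAST k. ladder k < t)"
  have k: "ladder k < t" unfolding k_def by (rule LeastI[of "\<lambda>k. ladder k < t", OF N])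
  have "k \<noteq> 0" using k assms ladder_0 by (metis not_less)
  then obtain n where n: "k = Suc n" by (cases k) auto
  then have "\<not> ladder n < t" using not_less_Least[of n "\<lambda>k. ladder k < t"] by (simp add: k_def)
  then show ?thesis using that[of n] k n by (auto simp: rung_def)
qed

lemma ln_rung:
  assumes "t \<in> rung n"
  shows "L * \<alpha> ^ n \<le> \<bar>ln t\<bar>" "\<bar>ln t\<bar> \<le> L * \<alpha> ^ Suc n"
proof -
  have t: "exp (- L * \<alpha> ^ Suc n) < t" "t \<le> exp (- L * \<alpha> ^ n)" using assms by (auto simp: rung_def ladder_def)
  then have "t > 0" using exp_gt_zero less_trans by blast
  then have l: "- L * \<alpha> ^ Suc n < ln t" "ln t \<le> - L * \<alpha> ^ n"
    using t by (metis exp_less_cancel_iff exp_ln, metis exp_le_cancel_iff exp_ln)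
  moreover have "L * \<alpha> ^ n > 0" using L_pos \<alpha> by simp
  ultimately show "L * \<alpha> ^ n \<le> \<bar>ln t\<bar>" "\<bar>ln t\<bar> \<le> L * \<alpha> ^ Suc n" by auto
qed

lemma rung_borel: "rung n \<in> sets parry_real" by (simp add: rung_def)

lemma nn_integral_rungs:
  "(\<integral>\<^sup>+t. (\<Sum>n. ennreal (h n) * indicator (rung n) t) \<partial>parry_real) = (\<Sum>n. ennreal (h n) * ennreal (rung_mass / \<rho> ^ n))"
proof -
  have "(\<integral>\<^sup>+t. (\<Sum>n. ennreal (h n) * indicator (rung n) t) \<partial>parry_real)
     = (\<Sum>n. \<integral>\<^sup>+t. ennreal (h n) * indicator (rung n) t \<partial>parry_real)"
    by (rule nn_integral_suminf) (use rung_borel in measurable)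
  then show ?thesis by (simp add: nn_integral_cmult_indicator[OF rung_borel] emeasure_rung)
qed

lemma log_integral_eq:
  "(\<integral>\<^sup>+t\<in>{t \<in> space parry. 0 < t}. ennreal \<bar>ln (t - 0)\<bar> \<partial>parry) = (\<integral>\<^sup>+t. ennreal \<bar>ln t\<bar> * indicator {0<..1} t \<partial>parry_real)"
proof -
  have "(\<integral>\<^sup>+t\<in>{t \<in> space parry. 0 < t}. ennreal \<bar>ln (t - 0)\<bar> \<partial>parry)
     = (\<integral>\<^sup>+t. (ennreal \<bar>ln (t - 0)\<bar> * indicator {t \<in> space parry. 0 < t} t) * indicator {0..1} t \<partial>parry_real)"
    unfolding parry_def by (rule nn_integral_restrict_space) simp
  also have "\<dots> = (\<integral>\<^sup>+t. ennreal \<bar>ln t\<bar> * indicator {0<..1} t \<partial>parry_real)"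
    by (rule nn_integral_cong) (auto simp: space_parry split: split_indicator)
  finally show ?thesis .
qed

text \<open>
  The integral is dominated by a geometric series of ratio \<open>\<alpha> / \<rho>\<close>; away from \<open>0\<close> the logarithm is
  bounded by \<open>L\<close>.
\<close>

lemma adapted_if:
  assumes "\<alpha> < \<rho>"
  shows "(\<integral>\<^sup>+t. ennreal \<bar>ln t\<bar> * indicator {0<..1} t \<partial>parry_real) < \<infinity>"
proof -
  have "(\<integral>\<^sup>+t. ennreal \<bar>ln t\<bar> * indicator {0<..1} t \<partial>parry_real)
     \<le> (\<integral>\<^sup>+t. (\<Sum>n. ennreal (L * \<alpha> ^ Suc n) * indicator (rung n) t) + ennreal L \<partial>parry_real)"
  proof (rule nn_integral_mono)
    fix t :: real
    show "ennreal \<bar>ln t\<bar> * indicator {0<..1} t \<le> (\<Sum>n. ennreal (L * \<alpha> ^ Suc n) * indicator (rung n) t) + ennreal L"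
    proof (cases "t \<in> {0<..1}")
      case True
      show ?thesis
      proof (cases "t \<le> \<epsilon>")
        case le: True
        obtain n where n: "t \<in> rung n" using rung_exists[OF _ le] True by auto
        have "ennreal \<bar>ln t\<bar> \<le> ennreal (L * \<alpha> ^ Suc n)" using ln_rung(2)[OF n] by (rule ennreal_leI)
        also have "\<dots> = (\<Sum>n. ennreal (L * \<alpha> ^ Suc n) * indicator (rung n) t)"
          by (rule suminf_cmult_indicator[OF disjoint_rungs n, symmetric])
        finally show ?thesis using True by (auto intro: add_increasing2)
      next
        case False
        then have "ln \<epsilon> \<le> ln t" "ln t \<le> 0" using True \<epsilon> by auto
        then have "ennreal \<bar>ln t\<bar> \<le> ennreal L" by (intro ennreal_leI) (simp add: L_def)
        then show ?thesis using True by (auto intro: add_increasing)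
      qed
    qed simp
  qed
  also have "\<dots> = (\<integral>\<^sup>+t. (\<Sum>n. ennreal (L * \<alpha> ^ Suc n) * indicator (rung n) t) \<partial>parry_real) + (\<integral>\<^sup>+t. ennreal L \<partial>parry_real)"
    by (rule nn_integral_add) (use rung_borel in measurable)
  also have "\<dots> = (\<Sum>n. ennreal (L * \<alpha> ^ Suc n) * ennreal (rung_mass / \<rho> ^ n)) + ennreal L"
    unfolding nn_integral_rungs by (simp add: pr.emeasure_space_1[unfolded pr.space_eq_univ])
  also have "(\<Sum>n. ennreal (L * \<alpha> ^ Suc n) * ennreal (rung_mass / \<rho> ^ n)) = (\<Sum>n. ennreal (L * \<alpha> * rung_mass * (\<alpha> / \<rho>) ^ n))"
    using L_pos \<alpha> rung_mass_pos rho_pos by (intro suminf_cong) (simp add: ennreal_mult[symmetric] power_divide)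
  also have "\<dots> = ennreal (\<Sum>n. L * \<alpha> * rung_mass * (\<alpha> / \<rho>) ^ n)"
    using L_pos \<alpha> rung_mass_pos rho_pos assms
    by (intro suminf_ennreal2 summable_mult summable_geometric) auto
  finally show ?thesis by (rule order_le_less_trans) (simp add: ennreal_add_eq_top less_top[symmetric])
qed

text \<open>
  On every rung the logarithm contributes at least \<open>L * rung_mass\<close>.
\<close>

lemma not_adapted_if:
  assumes "\<rho> \<le> \<alpha>"
  shows "(\<integral>\<^sup>+t. ennreal \<bar>ln t\<bar> * indicator {0<..1} t \<partial>parry_real) = \<infinity>"
proof -
  have "(\<Sum>n. ennreal (L * rung_mass)) \<le> (\<Sum>n. ennreal (L * \<alpha> ^ n) * ennreal (rung_mass / \<rho> ^ n))"
  proof (rule suminf_le)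
    fix n
    have "1 \<le> (\<alpha> / \<rho>) ^ n" using assms rho_pos by (intro one_le_power) simp
    then have "L * rung_mass * 1 \<le> L * rung_mass * (\<alpha> / \<rho>) ^ n" using L_pos rung_mass_pos by (intro mult_left_mono) auto
    then have "L * rung_mass \<le> L * \<alpha> ^ n * (rung_mass / \<rho> ^ n)" by (simp add: power_divide mult_ac)
    then have "ennreal (L * rung_mass) \<le> ennreal (L * \<alpha> ^ n * (rung_mass / \<rho> ^ n))" by (rule ennreal_leI)
    then show "ennreal (L * rung_mass) \<le> ennreal (L * \<alpha> ^ n) * ennreal (rung_mass / \<rho> ^ n)"
      by (subst ennreal_mult[symmetric]) (use L_pos rung_mass_pos \<alpha> rho_pos in auto)
  qed auto
  also have "\<dots> = (\<integral>\<^sup>+t. (\<Sum>n. ennreal (L * \<alpha> ^ n) * indicator (rung n) t) \<partial>parry_real)"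
    by (rule nn_integral_rungs[symmetric])
  also have "\<dots> \<le> (\<integral>\<^sup>+t. ennreal \<bar>ln t\<bar> * indicator {0<..1} t \<partial>parry_real)"
  proof (rule nn_integral_mono)
    fix t :: real
    show "(\<Sum>n. ennreal (L * \<alpha> ^ n) * indicator (rung n) t) \<le> ennreal \<bar>ln t\<bar> * indicator {0<..1} t"
    proof (cases "\<exists>n. t \<in> rung n")
      case True
      then obtain n where n: "t \<in> rung n" by blast
      have "ladder (Suc n) < t" "t \<le> ladder n" using n by (auto simp: rung_def)
      moreover have "0 < ladder (Suc n)" by (simp add: ladder_def)
      ultimately have "t \<in> {0<..1}" using ladder_le[of n] \<epsilon> by auto
      then show ?thesis
        unfolding suminf_cmult_indicator[OF disjoint_rungs n] using ennreal_leI[OF ln_rung(1)[OF n]] by simp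
    next
      case False
      then have "(\<Sum>n. ennreal (L * \<alpha> ^ n) * indicator (rung n) t) = (\<Sum>n. 0)"
        by (intro suminf_cong) auto
      then show ?thesis by simp
    qed
  qed
  finally have le: "(\<Sum>n. ennreal (L * rung_mass)) \<le> (\<integral>\<^sup>+t. ennreal \<bar>ln t\<bar> * indicator {0<..1} t \<partial>parry_real)" .
  have "(\<Sum>n. ennreal (L * rung_mass)) = \<infinity>"
  proof -
    have "(\<Sum>n::nat. ennreal (L * rung_mass)) = (\<integral>\<^sup>+n. ennreal (L * rung_mass) \<partial>count_space (UNIV :: nat set))"
      by (rule nn_integral_count_space_nat[symmetric])
    also have "\<dots> = \<infinity>" using L_pos rung_mass_pos by (simp add: ennreal_mult_eq_top_iff)
    finally show ?thesis .
  qed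
  with le show ?thesis by (simp add: top_unique)
qed

lemma adapted_parry_iff: "adapted parry 0 \<longleftrightarrow> \<alpha> < \<rho>"
proof -
  have "emeasure parry {0} = 0"
    using emeasure_parry[of "{0}"] by (simp add: pr.emeasure_eq_measure parry_real_singleton)
  then show ?thesis
    unfolding adapted_def log_integral_eq using adapted_if not_adapted_if by (cases "\<alpha> < \<rho>") auto
qed

end

theorem theorem3p1:
  fixes f :: "real \<Rightarrow> real" and m :: nat and x :: "nat \<Rightarrow> real" and \<delta> \<alpha> :: real
  assumes "expanding_markov_map 0 1 f m x"
    and "transitive_markov f m x"
    and "\<delta> > 0" and "\<alpha> > 1"
    and "\<And>t. t \<in> {0..\<delta>} \<Longrightarrow> f t = t powr (1 / \<alpha>)"
    and "\<And>i. 1 \<le> i \<Longrightarrow> i < m \<Longrightarrow> \<not> right_singularity f (x i)"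
    and "\<And>i. 1 \<le> i \<Longrightarrow> i \<le> m \<Longrightarrow> \<not> left_singularity f (x i)"
  shows "(\<exists>!\<mu>. max_entropy_measure 0 1 f \<mu>) \<and>
         (\<forall>\<mu>. max_entropy_measure 0 1 f \<mu> \<longrightarrow>
            (adapted \<mu> 0 \<longleftrightarrow> topological_entropy 0 1 f > ereal (ln \<alpha>)))"
proof -
  obtain g p q c where "expanding_markov m x f g p q c"
    using expanding_markov_of_map[OF assms(1,2)] by blast
  then interpret expanding_markov m x f g p q c .
  obtain \<rho> :: real and u v :: "nat \<Rightarrow> real" where "\<rho> > 0 \<and> (\<forall>i<m. u i > 0 \<and> v i > 0) \<and> (\<Sum>i<m. u i * v i) = 1 \<and>
    (\<forall>i<m. (\<Sum>j<m. branch_matrix p q i j * v j) = \<rho> * v i) \<and>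
    (\<forall>j<m. (\<Sum>i<m. u i * branch_matrix p q i j) = \<rho> * u j)"
    using perron_frobenius[OF irreducible m_pos] by blast
  then interpret power_law_at_0 m x f g p q c \<rho> u v \<delta> \<alpha>
    using assms(3-5) by unfold_locales auto
  have "topological_entropy 0 1 f > ereal (ln \<alpha>) \<longleftrightarrow> \<alpha> < \<rho>"
    using rho_pos assms(4) by (simp add: topological_entropy_eq)
  then show ?thesis by (auto simp: max_entropy_measure_iff adapted_parry_iff)
qed

end
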